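(* Let $G$ be a locally compact group. Then the following assertions are equivalent. (a) $G$ is weight regular. (b) $G$ is countable and discrete. (c) $G$ is finite or there exists a weight function $\omega:G\to[1,\infty)$ such that $\Omega$ is zero cluster.
   Context: All groups are Hausdorff locally compact. A weight (weight function) on $G$ is a continuous function $\omega:G\to[1,\infty)$ with $\omega(e)=1$ and $\omega(xy)\le\omega(x)\omega(y)$ for all $x,y\in G$. Define $\Omega:G\times G\to(0,1]$ by $\Omega(x,y)=\omega(xy)/(\omega(x)\omega(y))$. A function $F:G\times G\to\mathbb{C}$ is zero cluster if for every pair of sequences $(x_n)_n$ and $(y_m)_m$ of distinct elements of $G$, $\lim_n\lim_m F(x_n,y_m)=\lim_m\lim_n F(x_n,y_m)=0$ whenever both iterated limits exist. $M(G,\omega)$ is the Banach algebra (under convolution, norm $\|\mu\|_\omega=\|\omega\mu\|$) of complex regular Borel measures $\mu$ on $G$ with $\omega\mu\in M(G)$. A functional $\lambda\in M(G,\omega)^*$ vanishes at infinity if for every $\varepsilon>0$ there is a compact $K\subseteq G$ with $|\langle\lambda,\mu\rangle|<\varepsilon$ for all $\mu\in M(G,\omega)$ with $|\mu|(K)=0$ and $\|\mu\|_\omega=1$. $M_*(G,\omega)$ is the (norm closed) subspace of $M(G,\omega)^*$ of all functionals that vanish at infinity. First Arens product: for a Banach algebra $\mathfrak A$, $f\in\mathfrak A^*$, $a,b\in\mathfrak A$, $\Phi,\Psi\in\mathfrak A^{**}$, put $\langle fa,b\rangle=\langle f,ab\rangle$, $\langle\Psi f,a\rangle=\langle\Psi,fa\rangle$,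 $\langle\Phi\diamond\Psi,f\rangle=\langle\Phi,\Psi f\rangle$. The same formulas, with $\mathfrak A=M(G,\omega)$ and $f$ in the left introverted subspace $M_*(G,\omega)$ of $M(G,\omega)^*$, define the product making $M_*(G,\omega)^*$ a Banach algebra. A Banach algebra $\mathfrak A$ is Arens regular if for every $\Phi\in\mathfrak A^{**}$ the map $\Psi\mapsto\Phi\diamond\Psi$ is weak$^*$-weak$^*$ continuous on $\mathfrak A^{**}$. A locally compact group $G$ is weight regular if there exists a weight function $\omega:G\to[1,\infty)$ such that $M_*(G,\omega)^*$ is Arens regular. *)

theory Defs
  imports "HOL-Analysis.Analysis"
begin

text \<open>
  A locally compact group is a type of sort \<open>{topological_group_add, t2_space}\<close> whose topology is
  locally compact. The group operation is written additively, as the library does for its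
  topological groups, but it is \<^emph>\<open>not\<close> assumed to be commutative:
  \<open>x + y\<close> is the product $xy$, \<open>0\<close> is the identity $e$.
\<close>

section \<open>Weights and zero cluster functions\<close>

definition weight :: "('a::{topological_group_add, t2_space} \<Rightarrow> real) \<Rightarrow> bool" where
  "weight \<omega> \<longleftrightarrow> continuous_on UNIV \<omega> \<and> (\<forall>x. 1 \<le> \<omega> x) \<and> \<omega> 0 = 1 \<and>
     (\<forall>x y. \<omega> (x + y) \<le> \<omega> x * \<omega> y)"

definition Omega :: "('a::{topological_group_add, t2_space} \<Rightarrow> real) \<Rightarrow> 'a \<times> 'a \<Rightarrow> real" where
  "Omega \<omega> = (\<lambda>(x, y). \<omega> (x + y) / (\<omega> x * \<omega> y))"

text \<open>In the following definition \<open>r\<close> and \<open>s\<close> are the inner limits, \<open>l\<close> and \<open>k\<close> the iterated ones.\<close>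

definition zero_cluster :: "('a \<times> 'a \<Rightarrow> complex) \<Rightarrow> bool" where
  "zero_cluster F \<longleftrightarrow>
     (\<forall>x y :: nat \<Rightarrow> 'a. \<forall>r s l k. inj x \<longrightarrow> inj y \<longrightarrow>
        (\<forall>n. (\<lambda>m. F (x n, y m)) \<longlonglongrightarrow> r n) \<longrightarrow> r \<longlonglongrightarrow> l \<longrightarrow>
        (\<forall>m. (\<lambda>n. F (x n, y m)) \<longlonglongrightarrow> s m) \<longrightarrow> s \<longlonglongrightarrow> k \<longrightarrow>
        l = 0 \<and> k = 0)"

section \<open>Complex regular Borel measures\<close>

text \<open>
  A complex Borel measure is represented by its set function, which is extended by 0 to the
  non-Borel sets so that equality of measures is equality of functions.
\<close>

definition complex_measure :: "('a::topological_space set \<Rightarrow> complex) \<Rightarrow> bool" where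
  "complex_measure \<mu> \<longleftrightarrow> (\<forall>E. E \<notin> sets borel \<longrightarrow> \<mu> E = 0) \<and>
     (\<forall>A :: nat \<Rightarrow> 'a set. range A \<subseteq> sets borel \<longrightarrow> disjoint_family A \<longrightarrow>
        (\<lambda>n. \<mu> (A n)) sums \<mu> (\<Union>n. A n))"

text \<open>The total variation measure $|\mu|$.\<close>

definition total_var :: "('a::topological_space set \<Rightarrow> complex) \<Rightarrow> 'a measure" where
  "total_var \<mu> = measure_of UNIV (sets borel)
     (\<lambda>E. SUP A \<in> {A :: nat \<Rightarrow> 'a set. range A \<subseteq> sets borel \<and> disjoint_family A \<and> (\<Union>n. A n) = E}.
        \<Sum>n. ennreal (cmod (\<mu> (A n))))"

definition regular_measure :: "'a::topological_space measure \<Rightarrow> bool" where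
  "regular_measure M \<longleftrightarrow> (\<forall>E \<in> sets borel.
     emeasure M E = (INF U \<in> {U. open U \<and> E \<subseteq> U}. emeasure M U) \<and>
     emeasure M E = (SUP K \<in> {K. compact K \<and> K \<subseteq> E}. emeasure M K))"

definition meas_space :: "('a::t2_space set \<Rightarrow> complex) set"  \<comment> \<open>$M(G)$\<close> where
  "meas_space = {\<mu>. complex_measure \<mu> \<and> regular_measure (total_var \<mu>)}"

text \<open>The norm $\|\mu\| = |\mu|(G)$.\<close>

definition meas_norm :: "('a::topological_space set \<Rightarrow> complex) \<Rightarrow> real" where
  "meas_norm \<mu> = measure (total_var \<mu>) UNIV"

text \<open>
  Integration with respect to a complex measure is defined through the Jordan decompositions of
  its real and imaginary parts; \<open>pos_var \<nu>\<close> is the positive variation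
  $\nu^+(E) = \sup\{\nu(A) : A \subseteq E\}$ of a signed measure \<open>\<nu>\<close>, and $\nu^- = (-\nu)^+$.
  The function \<open>ennreal\<close> maps negative numbers to 0, which is harmless as
  \<open>A = {}\<close> is one of the competitors.
\<close>

definition pos_var :: "('a::topological_space set \<Rightarrow> real) \<Rightarrow> 'a measure" where
  "pos_var \<nu> = measure_of UNIV (sets borel)
     (\<lambda>E. SUP A \<in> {A. A \<in> sets borel \<and> A \<subseteq> E}. ennreal (\<nu> A))"

definition cmeas_integral ::
    "('a::topological_space set \<Rightarrow> complex) \<Rightarrow> ('a \<Rightarrow> complex) \<Rightarrow> complex" where
  "cmeas_integral \<mu> f =
     ((\<integral>x. f x \<partial>pos_var (\<lambda>E. Re (\<mu> E))) - (\<integral>x. f x \<partial>pos_var (\<lambda>E. - Re (\<mu> E)))) +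
     \<i> * ((\<integral>x. f x \<partial>pos_var (\<lambda>E. Im (\<mu> E))) - (\<integral>x. f x \<partial>pos_var (\<lambda>E. - Im (\<mu> E))))"

text \<open>
  The measure $\omega\mu$, $(\omega\mu)(E) = \int_E \omega\,d\mu$. It is meaningful only if
  \<open>\<omega>\<close> is integrable with respect to $|\mu|$.
\<close>

definition times_measure ::
    "('a::topological_space \<Rightarrow> real) \<Rightarrow> ('a set \<Rightarrow> complex) \<Rightarrow> 'a set \<Rightarrow> complex" where
  "times_measure \<omega> \<mu> = (\<lambda>E. if E \<in> sets borel
     then cmeas_integral \<mu> (\<lambda>x. indicator E x * complex_of_real (\<omega> x)) else 0)"

text \<open>
  $M(G,\omega)$ and its norm. Since $\omega \ge 1$, a measure \<open>\<mu>\<close> for which $\omega\mu$ is a finite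
  complex measure is itself finite, so nothing is lost by taking \<open>\<mu>\<close> from \<open>meas_space\<close>.
\<close>

definition wmeas_space :: "('a::{topological_group_add, t2_space} \<Rightarrow> real) \<Rightarrow> ('a set \<Rightarrow> complex) set" where
  "wmeas_space \<omega> = {\<mu> \<in> meas_space. integrable (total_var \<mu>) \<omega> \<and> times_measure \<omega> \<mu> \<in> meas_space}"

definition wmeas_norm :: "('a::{topological_group_add, t2_space} \<Rightarrow> real) \<Rightarrow> ('a set \<Rightarrow> complex) \<Rightarrow> real" where
  "wmeas_norm \<omega> \<mu> = meas_norm (times_measure \<omega> \<mu>)"

text \<open>
  Convolution: $(\mu * \nu)(E) = \int\!\int 1_E(xy)\,d\mu(x)\,d\nu(y)$ for Borel sets \<open>E\<close>. For
  regular \<open>\<mu>\<close> the inner integral is a bounded Borel function of $y$.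
\<close>

definition conv_meas ::
    "('a::{topological_group_add, t2_space} set \<Rightarrow> complex) \<Rightarrow> ('a set \<Rightarrow> complex) \<Rightarrow> 'a set \<Rightarrow> complex" where
  "conv_meas \<mu> \<nu> = (\<lambda>E. if E \<in> sets borel
     then cmeas_integral \<nu> (\<lambda>y. cmeas_integral \<mu> (\<lambda>x. indicator E (x + y))) else 0)"

section \<open>Duals and Arens products\<close>

text \<open>
  All complex normed spaces that occur are spaces of complex-valued functions with the pointwise
  vector space operations. Such a space is given by its carrier \<open>X\<close> and its norm \<open>N\<close>, which matters
  only on \<open>X\<close>; an algebra has in addition a product \<open>p\<close>. A functional on \<open>X\<close> is extended by 0
  outside \<open>X\<close>, so the dual is a space of the same kind.
\<close>

definition dual_space ::
    "('i \<Rightarrow> complex) set \<Rightarrow> (('i \<Rightarrow> complex) \<Rightarrow> real) \<Rightarrow> (('i \<Rightarrow> complex) \<Rightarrow> complex) set" where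
  "dual_space X N = {f.
     (\<forall>x\<in>X. \<forall>y\<in>X. f (\<lambda>i. x i + y i) = f x + f y) \<and>
     (\<forall>c. \<forall>x\<in>X. f (\<lambda>i. c * x i) = c * f x) \<and>
     (\<exists>B. \<forall>x\<in>X. cmod (f x) \<le> B * N x) \<and>
     (\<forall>x. x \<notin> X \<longrightarrow> f x = 0)}"

definition dual_norm ::
    "('i \<Rightarrow> complex) set \<Rightarrow> (('i \<Rightarrow> complex) \<Rightarrow> real) \<Rightarrow> (('i \<Rightarrow> complex) \<Rightarrow> complex) \<Rightarrow> real" where
  "dual_norm X N f = (SUP x \<in> {x \<in> X. N x \<le> 1}. cmod (f x))"

text \<open>The weak* topology on the dual of \<open>(X, N)\<close>.\<close>

definition weak_star ::
    "('i \<Rightarrow> complex) set \<Rightarrow> (('i \<Rightarrow> complex) \<Rightarrow> real) \<Rightarrow> (('i \<Rightarrow> complex) \<Rightarrow> complex) topology" where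
  "weak_star X N = topology_generated_by
     {{f \<in> dual_space X N. f x \<in> U} | x U. x \<in> X \<and> open U}"

text \<open>
  The functionals $fa$ and $\Psi f$ and the first Arens product $\Phi \diamond \Psi$.
  In \<open>arens_prod X p F\<close>, \<open>F\<close> is a left introverted subspace of the dual of the algebra \<open>X\<close> (the whole
  dual, or functionals vanishing at infinity), and \<open>\<Phi>\<close>, \<open>\<Psi>\<close> are functionals on \<open>F\<close>.
\<close>

definition fun_act ::
    "'v set \<Rightarrow> ('v \<Rightarrow> 'v \<Rightarrow> 'v) \<Rightarrow> ('v \<Rightarrow> complex) \<Rightarrow> 'v \<Rightarrow> 'v \<Rightarrow> complex" where
  "fun_act X p f a = (\<lambda>b. if b \<in> X then f (p a b) else 0)"

definition bidual_act ::
    "'v set \<Rightarrow> ('v \<Rightarrow> 'v \<Rightarrow> 'v) \<Rightarrow> (('v \<Rightarrow> complex) \<Rightarrow> complex) \<Rightarrow> ('v \<Rightarrow> complex) \<Rightarrow> 'v \<Rightarrow> complex" where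
  "bidual_act X p \<Psi> f = (\<lambda>a. if a \<in> X then \<Psi> (fun_act X p f a) else 0)"

definition arens_prod ::
    "'v set \<Rightarrow> ('v \<Rightarrow> 'v \<Rightarrow> 'v) \<Rightarrow> ('v \<Rightarrow> complex) set \<Rightarrow>
     (('v \<Rightarrow> complex) \<Rightarrow> complex) \<Rightarrow> (('v \<Rightarrow> complex) \<Rightarrow> complex) \<Rightarrow> ('v \<Rightarrow> complex) \<Rightarrow> complex" where
  "arens_prod X p F \<Phi> \<Psi> = (\<lambda>f. if f \<in> F then \<Phi> (bidual_act X p \<Psi> f) else 0)"

text \<open>Arens regularity of the Banach algebra with carrier \<open>X\<close>, norm \<open>N\<close> and product \<open>p\<close>.\<close>

definition arens_regular ::
    "('i \<Rightarrow> complex) set \<Rightarrow> (('i \<Rightarrow> complex) \<Rightarrow> real) \<Rightarrow>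
     (('i \<Rightarrow> complex) \<Rightarrow> ('i \<Rightarrow> complex) \<Rightarrow> ('i \<Rightarrow> complex)) \<Rightarrow> bool" where
  "arens_regular X N p \<longleftrightarrow>
     (\<forall>\<Phi> \<in> dual_space (dual_space X N) (dual_norm X N).
        continuous_map
          (weak_star (dual_space X N) (dual_norm X N))
          (weak_star (dual_space X N) (dual_norm X N))
          (\<lambda>\<Psi>. arens_prod X p (dual_space X N) \<Phi> \<Psi>))"

section \<open>Weight regular groups\<close>

definition vanishes_at_infinity ::
    "('a::{topological_group_add, t2_space} \<Rightarrow> real) \<Rightarrow> (('a set \<Rightarrow> complex) \<Rightarrow> complex) \<Rightarrow> bool" where
  "vanishes_at_infinity \<omega> l \<longleftrightarrow> (\<forall>\<epsilon>>0. \<exists>K. compact K \<and>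
     (\<forall>\<mu> \<in> wmeas_space \<omega>. emeasure (total_var \<mu>) K = 0 \<longrightarrow> wmeas_norm \<omega> \<mu> = 1 \<longrightarrow> cmod (l \<mu>) < \<epsilon>))"

text \<open>$M_*(G,\omega)$ with the norm of $M(G,\omega)^*$, and its dual with the Arens product.\<close>

definition Mstar ::
    "('a::{topological_group_add, t2_space} \<Rightarrow> real) \<Rightarrow> (('a set \<Rightarrow> complex) \<Rightarrow> complex) set" where
  "Mstar \<omega> = {l \<in> dual_space (wmeas_space \<omega>) (wmeas_norm \<omega>). vanishes_at_infinity \<omega> l}"

definition Mstar_norm ::
    "('a::{topological_group_add, t2_space} \<Rightarrow> real) \<Rightarrow> (('a set \<Rightarrow> complex) \<Rightarrow> complex) \<Rightarrow> real" where
  "Mstar_norm \<omega> = dual_norm (wmeas_space \<omega>) (wmeas_norm \<omega>)"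

definition Mstar_dual ::
    "('a::{topological_group_add, t2_space} \<Rightarrow> real) \<Rightarrow> ((('a set \<Rightarrow> complex) \<Rightarrow> complex) \<Rightarrow> complex) set" where
  "Mstar_dual \<omega> = dual_space (Mstar \<omega>) (Mstar_norm \<omega>)"

definition Mstar_dual_norm ::
    "('a::{topological_group_add, t2_space} \<Rightarrow> real) \<Rightarrow> ((('a set \<Rightarrow> complex) \<Rightarrow> complex) \<Rightarrow> complex) \<Rightarrow> real" where
  "Mstar_dual_norm \<omega> = dual_norm (Mstar \<omega>) (Mstar_norm \<omega>)"

definition Mstar_dual_prod ::
    "('a::{topological_group_add, t2_space} \<Rightarrow> real) \<Rightarrow> ((('a set \<Rightarrow> complex) \<Rightarrow> complex) \<Rightarrow> complex) \<Rightarrow>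
     ((('a set \<Rightarrow> complex) \<Rightarrow> complex) \<Rightarrow> complex) \<Rightarrow> (('a set \<Rightarrow> complex) \<Rightarrow> complex) \<Rightarrow> complex" where
  "Mstar_dual_prod \<omega> = arens_prod (wmeas_space \<omega>) conv_meas (Mstar \<omega>)"

definition weight_regular :: "'a::{topological_group_add, t2_space} itself \<Rightarrow> bool" where
  "weight_regular _ \<longleftrightarrow> (\<exists>\<omega> :: 'a \<Rightarrow> real. weight \<omega> \<and>
     arens_regular (Mstar_dual \<omega>) (Mstar_dual_norm \<omega>) (Mstar_dual_prod \<omega>))"

end

theory Submission
  imports Defs
begin

text \<open>
  The point masses span a copy of $\ell^1(G,\omega)$ in $M_*(G,\omega)^*$. If a level set
  $\{\omega \le C\}$ is infinite, it contains sequences $x_n$, $y_m$ such that no product $x_n y_m$ with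
  $n < m$ equals one with $n \ge m$. Summing the point values over the first kind of products is a
  bounded functional on $M_*(G,\omega)^*$ whose iterated limits along $(x_n, y_m)$ are 1 and 0, so the
  algebra is not Arens regular. Hence a regular weight has finite level sets; being continuous, it
  forces $G$ to be discrete and countable. A zero cluster $\Omega$ forces finite level sets as well,
  because $\Omega \ge C^{-2}$ on pairs from a level set.

  Conversely, a countable discrete group carries a weight $\omega = 1 + l$ with a proper length
  function $l$. Then $\Omega(x,y) \le 1/\omega(x) + 1/\omega(y)$, so $\Omega$ is zero cluster, and every
  bilinear form $(a,b) \mapsto f(ab)$ is a norm limit of forms of finite rank, for which the two Arens
  products agree.

  That the Arens product on $M_*(G,\omega)^*$ is defined rests on two facts. Convolution preserves
  regularity of measures, although the Borel sets of $G \times G$ need not be generated by rectangles.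
  And $M_*(G,\omega)$ is left introverted, because up to a small error in norm every functional on it
  only sees a compact subset of $G$.
\<close>

section \<open>Complex measures and their total variation\<close>

text \<open>Integrals against complex measures are defined through Jordan decompositions, which
  behave badly under sums and convolutions. By Radon-Nikodym, every complex measure is
  \<open>cdens M h\<close> for any finite Borel measure \<open>M\<close> that dominates it, and its
  integral of \<open>f\<close> becomes the ordinary integral of the product of \<open>h\<close> and
  \<open>f\<close>. Membership in M(G,\<omega>) then reduces to finding one regular positive measure
  that dominates and integrates \<omega>.

  The dual of M_*(G,\<omega>) is never computed. It is probed by point masses \<open>pt x\<close>,
  point values \<open>a (pf z)\<close> and restrictions \<open>cut B a\<close>. What makes these
  work is that the norm of M(G,\<omega>) adds up over a set and its complement, so that functionals
  with disjoint supports combine like bounded functions.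

  The two sequences in a level set are the odd and even terms of one sparse sequence: a coincidence
  of two products would have a strictly largest index, which the construction excludes. For
  regularity, both factors are split along a finite set \<open>F\<close>; three of the four
  resulting terms have finite rank, and in the fourth both factors live where \<omega>(xy) is small
  against \<omega>(x)\<omega>(y).\<close>

lemma complex_measure_sums:
  assumes "complex_measure \<mu>" "range A \<subseteq> sets borel" "disjoint_family A"
  shows "(\<lambda>n. \<mu> (A n)) sums \<mu> (\<Union>n. A n)"
  using assms by (auto simp: complex_measure_def)

lemma complex_measure_empty:
  assumes "complex_measure \<mu>" shows "\<mu> {} = 0"
proof -
  have "(\<lambda>n::nat. \<mu> {}) sums \<mu> {}"
    using complex_measure_sums[OF assms, of "\<lambda>_. {}"] by (auto simp: disjoint_family_on_def)
  then show ?thesis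
    using sums_summable summable_const_iff by blast
qed

lemma complex_measure_Un:
  assumes "complex_measure \<mu>" "A \<in> sets borel" "B \<in> sets borel" "A \<inter> B = {}"
  shows "\<mu> (A \<union> B) = \<mu> A + \<mu> B"
proof -
  have "range (binaryset A B) \<subseteq> sets borel"
    using assms by (auto simp: binaryset_def)
  moreover have "disjoint_family (binaryset A B)"
    using assms by (auto simp: disjoint_family_on_def binaryset_def)
  ultimately have "(\<lambda>n. \<mu> (binaryset A B n)) sums \<mu> (A \<union> B)"
    using complex_measure_sums[OF assms(1)] by (metis UN_binaryset_eq)
  moreover have "(\<lambda>n. \<mu> (binaryset A B n)) sums (\<mu> A + \<mu> B)"
    using binaryset_sums[of \<mu> A B] complex_measure_empty[OF assms(1)] by simp
  ultimately show ?thesis using sums_unique2 by blast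
qed

text \<open>The remainder of a series of disjoint sets is bounded by \<open>M\<close> of a
  decreasing sequence with empty intersection, so finite additivity suffices. This is the test for
  set functions given by a formula, such as densities and convolutions.\<close>

lemma complex_measure_of_dominated:
  assumes fin: "finite_measure M" and sM: "sets M = sets borel"
    and add: "\<And>A B. A \<in> sets borel \<Longrightarrow> B \<in> sets borel \<Longrightarrow> A \<inter> B = {} \<Longrightarrow> \<mu> (A \<union> B) = \<mu> A + \<mu> B"
    and dom: "\<And>A. A \<in> sets borel \<Longrightarrow> cmod (\<mu> A) \<le> measure M A"
    and zero: "\<And>A. A \<notin> sets borel \<Longrightarrow> \<mu> A = 0"
  shows "complex_measure \<mu>"
  unfolding complex_measure_def
proof (intro conjI allI impI)
  interpret finite_measure M by fact
  fix A :: "nat \<Rightarrow> 'a set" assume A: "range A \<subseteq> sets borel" and dj: "disjoint_family A"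
  have Ab[simp]: "A i \<in> sets borel" for i using A by auto
  have UNb: "(\<Union>i<n. A i) \<in> sets borel" for n by (intro sets.finite_UN) auto
  have m0: "\<mu> {} = 0" using add[of "{}" "{}"] by simp
  have fsum: "\<mu> (\<Union>i<n. A i) = (\<Sum>i<n. \<mu> (A i))" for n
  proof (induction n)
    case (Suc n)
    have "(\<Union>i<Suc n. A i) = (\<Union>i<n. A i) \<union> A n" by (auto simp: less_Suc_eq)
    moreover have "(\<Union>i<n. A i) \<inter> A n = {}"
      using dj by (auto simp: disjoint_family_on_def) (metis IntI empty_iff less_irrefl)
    ultimately show ?case using Suc add[OF UNb Ab, of n n] by simp
  qed (simp add: m0)
  define T where "T n = (\<Union>i. A i) - (\<Union>i<n. A i)" for n
  have Tb: "T n \<in> sets borel" for n unfolding T_def using UNb by (intro sets.Diff sets.countable_UN) auto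
  have diff: "\<mu> (\<Union>i. A i) - (\<Sum>i<n. \<mu> (A i)) = \<mu> (T n)" for n
  proof -
    have "(\<Union>i. A i) = (\<Union>i<n. A i) \<union> T n" by (auto simp: T_def)
    moreover have "(\<Union>i<n. A i) \<inter> T n = {}" by (auto simp: T_def)
    ultimately have "\<mu> (\<Union>i. A i) = \<mu> (\<Union>i<n. A i) + \<mu> (T n)"
      using add[OF UNb Tb, of n n] by argo
    then show ?thesis by (simp add: fsum)
  qed
  have "(\<lambda>n. measure M (T n)) \<longlonglongrightarrow> measure M (\<Inter>n. T n)"
    by (rule finite_Lim_measure_decseq) (use Tb sM in \<open>auto simp: decseq_def T_def\<close>)
  moreover have "(\<Inter>n. T n) = {}" by (auto simp: T_def)
  ultimately have lim: "(\<lambda>n. measure M (T n)) \<longlonglongrightarrow> 0" by simp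
  have "(\<lambda>n. \<mu> (\<Union>i. A i) - (\<Sum>i<n. \<mu> (A i))) \<longlonglongrightarrow> 0"
    unfolding diff
    by (rule Lim_null_comparison[OF _ lim]) (use dom Tb in auto)
  then show "(\<lambda>n. \<mu> (A n)) sums \<mu> (\<Union>n. A n)"
    unfolding sums_def using tendsto_diff[OF tendsto_const[of "\<mu> (\<Union>i. A i)"]] by fastforce
qed (use zero in auto)

section \<open>The total variation is a measure\<close>

definition partitions :: "'a::topological_space set \<Rightarrow> (nat \<Rightarrow> 'a set) set" where
  "partitions E = {A. range A \<subseteq> sets borel \<and> disjoint_family A \<and> (\<Union>n. A n) = E}"

definition tvar :: "('a::topological_space set \<Rightarrow> complex) \<Rightarrow> 'a set \<Rightarrow> ennreal" where
  "tvar \<mu> E = (SUP A \<in> partitions E. \<Sum>n. ennreal (cmod (\<mu> (A n))))"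

lemma total_var_eq: "total_var \<mu> = measure_of UNIV (sets borel) (tvar \<mu>)"
  unfolding total_var_def tvar_def partitions_def ..

lemma sets_total_var [simp, measurable_cong]: "sets (total_var \<mu>) = sets borel"
  unfolding total_var_eq using sets.sigma_sets_eq[of borel] by (simp add: sets_measure_of)

lemma space_total_var [simp]: "space (total_var \<mu>) = UNIV"
  unfolding total_var_eq by (simp add: space_measure_of)

lemma partitionsD:
  assumes "A \<in> partitions E"
  shows "A n \<in> sets borel" "disjoint_family A" "(\<Union>n. A n) = E" "range A \<subseteq> sets borel"
  using assms by (auto simp: partitions_def)

lemma tvar_upper: "A \<in> partitions E \<Longrightarrow> (\<Sum>n. ennreal (cmod (\<mu> (A n)))) \<le> tvar \<mu> E"
  unfolding tvar_def by (rule SUP_upper)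

lemma partitions_trivial: "E \<in> sets borel \<Longrightarrow> binaryset E {} \<in> partitions E"
  by (auto simp: partitions_def binaryset_def disjoint_family_on_def split: if_splits)

lemma cmod_le_tvar:
  assumes "complex_measure \<mu>" "E \<in> sets borel"
  shows "ennreal (cmod (\<mu> E)) \<le> tvar \<mu> E"
proof -
  have "(\<lambda>n. ennreal (cmod (\<mu> (binaryset E {} n)))) sums (ennreal (cmod (\<mu> E)) + 0)"
    using binaryset_sums[of "\<lambda>A. ennreal (cmod (\<mu> A))" E "{}"] complex_measure_empty[OF assms(1)] by simp
  then show ?thesis
    using tvar_upper[OF partitions_trivial[OF assms(2)], of \<mu>] sums_unique by fastforce
qed

lemma tvar_le_emeasure:
  assumes dom: "\<And>A. A \<in> sets borel \<Longrightarrow> ennreal (cmod (\<mu> A)) \<le> emeasure M A"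
    and sM: "sets M = sets borel"
  shows "tvar \<mu> E \<le> emeasure M E"
  unfolding tvar_def
proof (rule SUP_least)
  fix A assume A: "A \<in> partitions E"
  have "(\<Sum>n. ennreal (cmod (\<mu> (A n)))) \<le> (\<Sum>n. emeasure M (A n))"
    by (intro suminf_le dom) (use partitionsD[OF A] in auto)
  also have "\<dots> = emeasure M E"
    using partitionsD[OF A] by (subst suminf_emeasure) (auto simp: sM)
  finally show "(\<Sum>n. ennreal (cmod (\<mu> (A n)))) \<le> emeasure M E" .
qed

lemma cmod_sums_le:
  assumes "f sums (s::complex)"
  shows "ennreal (cmod s) \<le> (\<Sum>n. ennreal (cmod (f n)))"
proof (rule LIMSEQ_le_const2)
  show "(\<lambda>n. ennreal (cmod (\<Sum>i<n. f i))) \<longlonglongrightarrow> ennreal (cmod s)"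
    using assms unfolding sums_def by (intro tendsto_intros)
  have "ennreal (cmod (\<Sum>i<n. f i)) \<le> (\<Sum>n. ennreal (cmod (f n)))" for n
  proof -
    have "ennreal (cmod (\<Sum>i<n. f i)) \<le> ennreal (\<Sum>i<n. cmod (f i))"
      by (intro ennreal_leI norm_sum)
    also have "\<dots> = (\<Sum>i<n. ennreal (cmod (f i)))" by (simp add: sum_ennreal)
    also have "\<dots> \<le> (\<Sum>n. ennreal (cmod (f n)))" by (intro sum_le_suminf) auto
    finally show ?thesis .
  qed
  then show "\<exists>N. \<forall>n\<ge>N. ennreal (cmod (\<Sum>i<n. f i)) \<le> (\<Sum>n. ennreal (cmod (f n)))" by auto
qed

text \<open>A partition of \<open>A\<close> and one of \<open>B\<close> interleave to a partition of
  the union; then suprema are taken over each of them in turn.\<close>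

lemma tvar_superadditive:
  assumes "A \<inter> B = {}" "A \<in> sets borel" "B \<in> sets borel"
  shows "tvar \<mu> A + tvar \<mu> B \<le> tvar \<mu> (A \<union> B)"
proof -
  have key: "(\<Sum>n. ennreal (cmod (\<mu> (P n)))) + (\<Sum>n. ennreal (cmod (\<mu> (Q n)))) \<le> tvar \<mu> (A \<union> B)"
    if P: "P \<in> partitions A" and Q: "Q \<in> partitions B" for P Q
  proof -
    let ?f = "\<lambda>X. ennreal (cmod (\<mu> X))"
    define R where "R n = (if even n then P (n div 2) else Q (n div 2))" for n
    have "R \<in> partitions (A \<union> B)"
      unfolding partitions_def
    proof (intro CollectI conjI)
      show "range R \<subseteq> sets borel" using partitionsD[OF P] partitionsD[OF Q] by (auto simp: R_def)
      have PA: "P i \<subseteq> A" for i using partitionsD(3)[OF P] by auto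
      have QB: "Q i \<subseteq> B" for i using partitionsD(3)[OF Q] by auto
      have eq: "m = n" if "even m = even n" "m div 2 = n div 2" for m n :: nat
        using that by (metis div_mult_mod_eq parity_cases)
      show "disjoint_family R"
        unfolding disjoint_family_on_def
      proof (intro ballI impI)
        fix m n :: nat assume "m \<noteq> n"
        then show "R m \<inter> R n = {}"
          using PA[of "m div 2"] PA[of "n div 2"] QB[of "m div 2"] QB[of "n div 2"] assms(1) eq[of m n]
            disjoint_family_onD[OF partitionsD(2)[OF P], of "m div 2" "n div 2"]
            disjoint_family_onD[OF partitionsD(2)[OF Q], of "m div 2" "n div 2"]
          unfolding R_def by (cases "even m"; cases "even n") (simp; blast)+
      qed
      have "P i \<subseteq> \<Union> (range R)" for i
      proof -
        have "R (2*i) = P i" by (simp add: R_def)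
        then show ?thesis by blast
      qed
      moreover have "Q i \<subseteq> \<Union> (range R)" for i
      proof -
        have "R (2*i+1) = Q i" by (simp add: R_def)
        then show ?thesis by blast
      qed
      moreover have "R i \<subseteq> A \<union> B" for i using PA QB by (auto simp: R_def)
      ultimately show "\<Union> (range R) = A \<union> B"
        using partitionsD(3)[OF P] partitionsD(3)[OF Q] by blast
    qed
    then have up: "(\<Sum>n. ?f (R n)) \<le> tvar \<mu> (A \<union> B)" by (rule tvar_upper)
    \<comment> \<open>The first 2m terms of \<open>R\<close> are the first m terms of
      \<open>P\<close> and of \<open>Q\<close>, so partial sums suffice for the limit.\<close>
    have "(\<Sum>i<m. ?f (P i)) + (\<Sum>i<m. ?f (Q i)) = (\<Sum>i<2*m. ?f (R i))" for m
      by (induction m) (simp_all add: R_def algebra_simps)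
    then have fin: "(\<Sum>i<m. ?f (P i)) + (\<Sum>i<m. ?f (Q i)) \<le> tvar \<mu> (A \<union> B)" for m
      using order_trans[OF sum_le_suminf[of "\<lambda>n. ?f (R n)" "{..<2*m}"] up] by simp
    show ?thesis
      by (rule LIMSEQ_le_const2[OF tendsto_add[OF summable_LIMSEQ summable_LIMSEQ]]) (use fin in auto)
  qed
  have "partitions A \<noteq> {}" "partitions B \<noteq> {}"
    using partitions_trivial assms by blast+
  then have "tvar \<mu> A + (\<Sum>n. ennreal (cmod (\<mu> (Q n)))) \<le> tvar \<mu> (A \<union> B)" if "Q \<in> partitions B" for Q
    unfolding tvar_def[of \<mu> A] using that
    by (subst ennreal_SUP_add_left[symmetric]) (auto intro!: SUP_least key)
  then show ?thesis
    unfolding tvar_def[of \<mu> B] using \<open>partitions B \<noteq> {}\<close>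
    by (subst ennreal_SUP_add_right) (auto intro!: SUP_least)
qed

lemma tvar_mono:
  assumes "A \<in> sets borel" "B \<in> sets borel" "A \<subseteq> B"
  shows "tvar \<mu> A \<le> tvar \<mu> B"
proof -
  have "tvar \<mu> A \<le> tvar \<mu> A + tvar \<mu> (B - A)" by simp
  also have "\<dots> \<le> tvar \<mu> (A \<union> (B - A))"
    by (intro tvar_superadditive) (use assms in auto)
  also have "A \<union> (B - A) = B" using assms by blast
  finally show ?thesis .
qed

lemma tvar_empty:
  fixes \<mu> :: "'a::topological_space set \<Rightarrow> complex"
  assumes "complex_measure \<mu>" shows "tvar \<mu> {} = 0"
proof -
  have "(\<Sum>n. ennreal (cmod (\<mu> (A n)))) = 0" if "A \<in> partitions {}" for A :: "nat \<Rightarrow> 'a set"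
  proof -
    have "A n = {}" for n using that by (auto simp: partitions_def)
    then show ?thesis by (simp add: complex_measure_empty[OF assms])
  qed
  then have "tvar \<mu> {} \<le> 0"
    unfolding tvar_def by (intro SUP_least) (rule eq_refl, blast)
  then show ?thesis by simp
qed

lemma suminf_ennreal_swap:
  fixes f :: "nat \<Rightarrow> nat \<Rightarrow> ennreal"
  shows "(\<Sum>i. \<Sum>j. f i j) = (\<Sum>j. \<Sum>i. f i j)"
  using nn_integral_suminf[of "\<lambda>i j. f i j" "count_space UNIV"]
  by (simp add: nn_integral_count_space_nat)

text \<open>One inequality is superadditivity on finite unions. For the other, a partition
  \<open>A\<close> of the union is refined by the sets \<open>E i\<close>, and the double sum is
  interchanged.\<close>

lemma tvar_countably_additive:
  assumes \<mu>: "complex_measure \<mu>"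
  shows "countably_additive (sets borel) (tvar \<mu>)"
proof (rule countably_additiveI)
  fix E :: "nat \<Rightarrow> 'a set"
  assume E: "range E \<subseteq> sets borel" and dj: "disjoint_family E"
  have Eb: "E i \<in> sets borel" for i using E by auto
  have "(\<Sum>i<n. tvar \<mu> (E i)) \<le> tvar \<mu> (\<Union>i<n. E i)" for n
  proof (induction n)
    case (Suc n)
    have dis: "(\<Union>i<n. E i) \<inter> E n = {}"
      using dj by (auto simp: disjoint_family_on_def) (metis IntI empty_iff less_irrefl)
    have "(\<Sum>i<Suc n. tvar \<mu> (E i)) \<le> tvar \<mu> (\<Union>i<n. E i) + tvar \<mu> (E n)"
      using Suc by (simp add: add_right_mono)
    also have "\<dots> \<le> tvar \<mu> ((\<Union>i<n. E i) \<union> E n)"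
      by (intro tvar_superadditive dis) (use Eb in auto)
    also have "(\<Union>i<n. E i) \<union> E n = (\<Union>i<Suc n. E i)" by (auto simp: less_Suc_eq)
    finally show ?case .
  qed simp
  also have "tvar \<mu> (\<Union>i<n. E i) \<le> tvar \<mu> (\<Union>i. E i)" for n
    by (intro tvar_mono) (use Eb in auto)
  finally have "(\<Sum>i. tvar \<mu> (E i)) \<le> tvar \<mu> (\<Union>i. E i)"
    by (intro suminf_le_const) auto
  moreover have "tvar \<mu> (\<Union>i. E i) \<le> (\<Sum>i. tvar \<mu> (E i))"
    unfolding tvar_def[of \<mu> "\<Union>i. E i"]
  proof (rule SUP_least)
    fix A assume A: "A \<in> partitions (\<Union>i. E i)"
    note A' = partitionsD[OF A]
    have s: "(\<lambda>i. \<mu> (A j \<inter> E i)) sums \<mu> (A j)" for j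
    proof -
      have "(\<lambda>i. \<mu> (A j \<inter> E i)) sums \<mu> (\<Union>i. A j \<inter> E i)"
        by (rule complex_measure_sums[OF \<mu>])
          (use A'(1) Eb dj in \<open>auto simp: disjoint_family_on_def disjoint_iff\<close>)
      moreover have "(\<Union>i. A j \<inter> E i) = A j" using A'(3) by blast
      ultimately show ?thesis by simp
    qed
    have "(\<Sum>j. ennreal (cmod (\<mu> (A j)))) \<le> (\<Sum>j. \<Sum>i. ennreal (cmod (\<mu> (A j \<inter> E i))))"
      by (intro suminf_le cmod_sums_le s) auto
    also have "\<dots> = (\<Sum>i. \<Sum>j. ennreal (cmod (\<mu> (A j \<inter> E i))))" by (rule suminf_ennreal_swap)
    also have "\<dots> \<le> (\<Sum>i. tvar \<mu> (E i))"
    proof (intro suminf_le)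
      fix i
      have "(\<lambda>j. A j \<inter> E i) \<in> partitions (E i)"
        using A' Eb by (auto simp: partitions_def disjoint_family_on_def)
      then show "(\<Sum>j. ennreal (cmod (\<mu> (A j \<inter> E i)))) \<le> tvar \<mu> (E i)"
        by (rule tvar_upper)
    qed auto
    finally show "(\<Sum>j. ennreal (cmod (\<mu> (A j)))) \<le> (\<Sum>i. tvar \<mu> (E i))" .
  qed
  ultimately show "(\<Sum>i. tvar \<mu> (E i)) = tvar \<mu> (\<Union>i. E i)" by (rule antisym)
qed

text \<open>\<open>measure_of\<close> yields the zero measure unless its set function is positive
  and countably additive, so the values of \<open>total_var\<close> are available only from here
  on.\<close>

lemma emeasure_total_var:
  assumes "complex_measure \<mu>" "E \<in> sets borel"
  shows "emeasure (total_var \<mu>) E = tvar \<mu> E"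
  by (rule emeasure_measure_of[OF total_var_eq])
    (use assms tvar_empty tvar_countably_additive in \<open>auto simp: positive_def\<close>)

lemma cmod_le_total_var:
  assumes "complex_measure \<mu>"
  shows "ennreal (cmod (\<mu> E)) \<le> emeasure (total_var \<mu>) E"
proof (cases "E \<in> sets borel")
  case True
  then show ?thesis using cmod_le_tvar[OF assms True] emeasure_total_var[OF assms True] by simp
next
  case False
  then show ?thesis using assms by (simp add: complex_measure_def)
qed

text \<open>The total variation is the least positive measure dominating the complex measure; this
  is the usual way to bound it from above.\<close>

lemma total_var_le:
  assumes "complex_measure \<mu>" "sets M = sets borel"
    and "\<And>A. A \<in> sets borel \<Longrightarrow> ennreal (cmod (\<mu> A)) \<le> emeasure M A"
  shows "emeasure (total_var \<mu>) E \<le> emeasure M E"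
proof (cases "E \<in> sets borel")
  case True
  then show ?thesis using assms tvar_le_emeasure[of \<mu> M E] emeasure_total_var[OF assms(1) True] by simp
next
  case False
  then show ?thesis by (simp add: emeasure_notin_sets)
qed

section \<open>Complex measures with densities\<close>

text \<open>The complex measure h dM. The value 0 off the Borel sets matches the convention of
  \<open>complex_measure\<close>, so that measures can be compared as functions.\<close>

definition cdens :: "'a::topological_space measure \<Rightarrow> ('a \<Rightarrow> complex) \<Rightarrow> 'a set \<Rightarrow> complex" where
  "cdens M h E = (if E \<in> sets borel then \<integral>x. indicator E x *\<^sub>R h x \<partial>M else 0)"

text \<open>Identifies a measure given by a supremum formula, as in \<open>pos_var\<close>, with one
  already known.\<close>

lemma measure_of_eq_measure:
  assumes "sets D = sets (borel :: 'a::topological_space measure)"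
    and "\<And>E. E \<in> sets borel \<Longrightarrow> f E = emeasure D E"
  shows "measure_of UNIV (sets borel) f = D"
proof -
  have "measure_of UNIV (sets borel) f = measure_of UNIV (sets borel) (emeasure D)"
    using assms sets.sigma_sets_eq[of "borel :: 'a measure"] by (intro measure_of_eq) auto
  also have "\<dots> = D"
    using measure_of_of_measure[of D] sets_eq_imp_space_eq[OF assms(1)] assms(1) by simp
  finally show ?thesis .
qed

context
  fixes M :: "'a::topological_space measure"
  assumes sM[measurable_cong]: "sets M = sets borel"
begin

lemma integrable_indicator_scaleR:
  fixes h :: "'a \<Rightarrow> 'b::{banach, second_countable_topology}"
  assumes "integrable M h" "E \<in> sets borel"
  shows "integrable M (\<lambda>x. indicator E x *\<^sub>R h x)"
  using assms sM by (intro integrable_mult_indicator) auto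

lemma cmod_cdens_le:
  assumes h: "integrable M h" and E: "E \<in> sets borel"
  shows "ennreal (cmod (cdens M h E)) \<le> emeasure (density M (\<lambda>x. ennreal (cmod (h x)))) E"
proof -
  have "ennreal (cmod (cdens M h E)) \<le> (\<integral>\<^sup>+x. ennreal (cmod (indicator E x *\<^sub>R h x)) \<partial>M)"
    using integral_norm_bound_ennreal[OF integrable_indicator_scaleR[OF h E]] E by (simp add: cdens_def)
  also have "\<dots> = (\<integral>\<^sup>+x. ennreal (cmod (h x)) * indicator E x \<partial>M)"
    by (intro nn_integral_cong) (auto simp: indicator_def)
  also have "\<dots> = emeasure (density M (\<lambda>x. ennreal (cmod (h x)))) E"
    using h E sM by (subst emeasure_density) auto
  finally show ?thesis .
qed

lemma finite_measure_density_cmod: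
  assumes "integrable M (h :: 'a \<Rightarrow> complex)"
  shows "finite_measure (density M (\<lambda>x. ennreal (cmod (h x))))"
proof (rule finite_measureI)
  have "emeasure (density M (\<lambda>x. ennreal (cmod (h x)))) (space M) = (\<integral>\<^sup>+x. ennreal (cmod (h x)) \<partial>M)"
    using assms by (subst emeasure_density) (auto intro!: nn_integral_cong)
  also have "\<dots> < \<infinity>" using assms by (simp add: integrable_iff_bounded)
  finally show "emeasure (density M (\<lambda>x. ennreal (cmod (h x)))) (space (density M (\<lambda>x. ennreal (cmod (h x))))) \<noteq> \<infinity>"
    by simp
qed

lemma cdens_Un:
  assumes h: "integrable M h" and "A \<in> sets borel" "B \<in> sets borel" "A \<inter> B = {}"
  shows "cdens M h (A \<union> B) = cdens M h A + cdens M h B"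
proof -
  have "cdens M h (A \<union> B) = (\<integral>x. indicator A x *\<^sub>R h x + indicator B x *\<^sub>R h x \<partial>M)"
    using assms by (auto simp: cdens_def indicator_def intro!: Bochner_Integration.integral_cong)
  also have "\<dots> = cdens M h A + cdens M h B"
    using assms by (subst Bochner_Integration.integral_add) (auto simp: cdens_def integrable_indicator_scaleR)
  finally show ?thesis .
qed

lemma complex_measure_cdens:
  assumes h: "integrable M h"
  shows "complex_measure (cdens M h)"
proof (rule complex_measure_of_dominated[OF finite_measure_density_cmod[OF h]])
  interpret D: finite_measure "density M (\<lambda>x. ennreal (cmod (h x)))"
    by (rule finite_measure_density_cmod[OF h])
  show "cmod (cdens M h A) \<le> measure (density M (\<lambda>x. ennreal (cmod (h x)))) A" if "A \<in> sets borel" for A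
    using cmod_cdens_le[OF h that] by (simp add: D.emeasure_eq_measure)
qed (simp_all add: sM cdens_Un[OF h], simp add: cdens_def)

text \<open>The bound from above is the triangle inequality for integrals. For the bound from below,
  \<open>E\<close> is cut into countably many pieces on which \<open>h\<close> is almost constant;
  on each of them the modulus of the integral nearly equals the integral of the modulus.\<close>

lemma total_var_cdens:
  assumes fin: "finite_measure M" and h: "integrable M h"
  shows "total_var (cdens M h) = density M (\<lambda>x. ennreal (cmod (h x)))"
proof (rule measure_eqI)
  interpret finite_measure M by fact
  have hm[measurable]: "h \<in> borel_measurable M" using h by auto
  have spM: "space M = UNIV" using sets_eq_imp_space_eq[OF sM] by simp
  note cm = complex_measure_cdens[OF h]
  fix E assume "E \<in> sets (total_var (cdens M h))"
  then have E[measurable]: "E \<in> sets borel" by simp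
  show "emeasure (total_var (cdens M h)) E = emeasure (density M (\<lambda>x. ennreal (cmod (h x)))) E"
  proof (rule antisym)
    show "emeasure (total_var (cdens M h)) E \<le> emeasure (density M (\<lambda>x. ennreal (cmod (h x)))) E"
      by (rule total_var_le[OF cm]) (use cmod_cdens_le[OF h] sM in auto)
    show "emeasure (density M (\<lambda>x. ennreal (cmod (h x)))) E \<le> emeasure (total_var (cdens M h)) E"
    proof (rule ennreal_le_epsilon)
      fix e :: real assume "e > 0"
      \<comment> \<open>Chosen so that the total error, 4d times the mass of the space, is at most
        \<open>e\<close>; the summand 1 keeps the denominator positive.\<close>
      define d where "d = e / (4 * (measure M UNIV + 1))"
      have d: "d > 0" using \<open>e > 0\<close> by (auto simp: d_def intro!: divide_pos_pos add_nonneg_pos)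
      \<comment> \<open>Squares of side \<open>d\<close> in the complex plane, numbered by
        \<open>to_nat\<close> so that the pieces form a sequence.\<close>
      define cell where "cell z = to_nat (\<lfloor>Re z / d\<rfloor>, \<lfloor>Im z / d\<rfloor>)" for z :: complex
      have cell_close: "cmod (z - w) \<le> 2 * d" if "cell z = cell w" for z w
      proof -
        have "\<lfloor>Re z / d\<rfloor> = \<lfloor>Re w / d\<rfloor>" "\<lfloor>Im z / d\<rfloor> = \<lfloor>Im w / d\<rfloor>"
          using that by (auto simp: cell_def)
        then have "\<bar>Re z / d - Re w / d\<bar> \<le> 1" "\<bar>Im z / d - Im w / d\<bar> \<le> 1" by linarith+
        then have "\<bar>Re z - Re w\<bar> \<le> d" "\<bar>Im z - Im w\<bar> \<le> d"
          using d by (auto simp: diff_divide_distrib[symmetric] abs_divide)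
        then show ?thesis using cmod_le[of "z - w"] by simp
      qed
      define A where "A n = E \<inter> {x \<in> space M. cell (h x) = n}" for n
      have cellm: "{x \<in> space M. cell (h x) = n} \<in> sets M" for n
        unfolding cell_def by measurable
      then have A[measurable]: "A n \<in> sets M" for n
        unfolding A_def using E sM by auto
      have Ab: "A n \<in> sets borel" for n using A sM by auto
      have part: "A \<in> partitions E"
        using Ab unfolding partitions_def by (auto simp: A_def disjoint_family_on_def spM)
      \<comment> \<open>Replacing \<open>h\<close> by the constant \<open>c\<close> costs 2d per
        unit of mass, once in each of the two integrals; hence 4d.\<close>
      have bound: "emeasure (density M (\<lambda>x. ennreal (cmod (h x)))) (A n)
          \<le> ennreal (cmod (cdens M h (A n))) + ennreal (4 * d) * emeasure M (A n)" for n
      proof (cases "A n = {}")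
        case False
        then obtain x0 where x0: "x0 \<in> A n" by blast
        define c where "c = h x0"
        have close: "cmod (h x - c) \<le> 2 * d" if "x \<in> A n" for x
          using that x0 cell_close by (auto simp: A_def c_def)
        have ind: "integrable M (\<lambda>x. indicator (A n) x *\<^sub>R (h x - c))"
          using h by (intro integrable_indicator_scaleR Ab) auto
        have "c * measure M (A n) = (\<integral>x. indicator (A n) x *\<^sub>R c \<partial>M)"
          using A[of n] sM by (simp add: spM scaleR_conv_of_real)
        also have "\<dots> = (\<integral>x. indicator (A n) x *\<^sub>R h x - indicator (A n) x *\<^sub>R (h x - c) \<partial>M)"
          by (intro Bochner_Integration.integral_cong) (auto simp: algebra_simps)
        also have "\<dots> = cdens M h (A n) - (\<integral>x. indicator (A n) x *\<^sub>R (h x - c) \<partial>M)"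
          using ind Ab by (subst Bochner_Integration.integral_diff)
            (auto simp: cdens_def intro!: integrable_indicator_scaleR h)
        finally have "cmod (c * measure M (A n)) \<le> cmod (cdens M h (A n)) + cmod (\<integral>x. indicator (A n) x *\<^sub>R (h x - c) \<partial>M)"
          by (simp only: norm_triangle_ineq4)
        then have "cmod c * measure M (A n) \<le> cmod (cdens M h (A n)) + cmod (\<integral>x. indicator (A n) x *\<^sub>R (h x - c) \<partial>M)"
          by (simp add: norm_mult)
        also have "cmod (\<integral>x. indicator (A n) x *\<^sub>R (h x - c) \<partial>M) \<le> (\<integral>x. indicator (A n) x *\<^sub>R (2 * d) \<partial>M)"
        proof (rule order_trans[OF integral_norm_bound integral_mono])
          show "integrable M (\<lambda>x. cmod (indicator (A n) x *\<^sub>R (h x - c)))"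
            using ind by (rule integrable_norm)
          show "integrable M (\<lambda>x. indicator (A n) x *\<^sub>R (2 * d))"
            by (intro integrable_indicator_scaleR Ab) auto
          show "cmod (indicator (A n) x *\<^sub>R (h x - c)) \<le> indicator (A n) x *\<^sub>R (2 * d)" for x
            using close[of x] by (auto simp: indicator_def)
        qed
        also have "\<dots> = 2 * d * measure M (A n)" by (simp add: spM)
        finally have 1: "cmod c * measure M (A n) \<le> cmod (cdens M h (A n)) + 2 * d * measure M (A n)" by simp
        have "emeasure (density M (\<lambda>x. ennreal (cmod (h x)))) (A n)
            = (\<integral>\<^sup>+x. ennreal (cmod (h x)) * indicator (A n) x \<partial>M)"
          by (subst emeasure_density) auto
        also have "\<dots> \<le> (\<integral>\<^sup>+x. ennreal (cmod c + 2 * d) * indicator (A n) x \<partial>M)"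
        proof (rule nn_integral_mono)
          fix x
          have "cmod (h x) \<le> cmod c + 2 * d" if "x \<in> A n"
            using close[OF that] norm_triangle_ineq2[of "h x" c] by linarith
          then show "ennreal (cmod (h x)) * indicator (A n) x \<le> ennreal (cmod c + 2 * d) * indicator (A n) x"
            by (auto simp: indicator_def intro!: ennreal_leI)
        qed
        also have "\<dots> = ennreal (cmod c + 2 * d) * emeasure M (A n)"
          by (rule nn_integral_cmult_indicator) auto
        also have "\<dots> = ennreal (cmod c * measure M (A n) + 2 * d * measure M (A n))"
          using d by (simp add: emeasure_eq_measure ennreal_mult[symmetric] algebra_simps)
        also have "\<dots> \<le> ennreal (cmod (cdens M h (A n)) + 4 * d * measure M (A n))"
          using 1 by (intro ennreal_leI) linarith
        also have "\<dots> = ennreal (cmod (cdens M h (A n))) + ennreal (4 * d) * emeasure M (A n)"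
          using d by (simp add: emeasure_eq_measure ennreal_mult[symmetric] ennreal_plus[symmetric] del: ennreal_plus)
        finally show ?thesis .
      qed simp
      have un: "(\<Union>n. A n) = E" and dj: "disjoint_family A" using partitionsD[OF part] by auto
      have "emeasure (density M (\<lambda>x. ennreal (cmod (h x)))) E
          = (\<Sum>n. emeasure (density M (\<lambda>x. ennreal (cmod (h x)))) (A n))"
        using A dj by (subst suminf_emeasure) (auto simp: un)
      also have "\<dots> \<le> (\<Sum>n. ennreal (cmod (cdens M h (A n))) + ennreal (4 * d) * emeasure M (A n))"
        by (intro suminf_le bound) auto
      also have "\<dots> = (\<Sum>n. ennreal (cmod (cdens M h (A n)))) + ennreal (4 * d) * (\<Sum>n. emeasure M (A n))"
        by (subst suminf_add[symmetric]) auto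
      also have "(\<Sum>n. emeasure M (A n)) = emeasure M E"
        using A dj by (subst suminf_emeasure) (auto simp: un)
      also have "(\<Sum>n. ennreal (cmod (cdens M h (A n)))) \<le> emeasure (total_var (cdens M h)) E"
        using tvar_upper[OF part] emeasure_total_var[OF cm E] by simp
      also have "ennreal (4 * d) * emeasure M E \<le> ennreal e"
      proof -
        have cancel: "4 * (e / (4 * m)) * m = e" if "m \<noteq> 0" for m :: real
          using that by simp
        have "4 * d * measure M E \<le> 4 * d * (measure M UNIV + 1)"
          using d bounded_measure[of E] spM by (intro mult_left_mono) auto
        also have "\<dots> = e"
          unfolding d_def using measure_nonneg[of M UNIV] by (intro cancel) linarith
        finally show ?thesis using d by (simp add: emeasure_eq_measure ennreal_mult[symmetric] ennreal_leI)
      qed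
      finally show "emeasure (density M (\<lambda>x. ennreal (cmod (h x)))) E
          \<le> emeasure (total_var (cdens M h)) E + ennreal e" 
        by (simp add: add_left_mono add_right_mono)
    qed
  qed
qed (simp add: sM)

text \<open>The supremum is attained on the part of \<open>E\<close> where \<open>f\<close> is
  positive, which is the Hahn decomposition made explicit by the density.\<close>

lemma pos_var_density:
  fixes f :: "'a \<Rightarrow> real"
  assumes f: "integrable M f"
    and \<nu>: "\<And>E. E \<in> sets borel \<Longrightarrow> \<nu> E = (\<integral>x. indicator E x *\<^sub>R f x \<partial>M)"
  shows "pos_var \<nu> = density M (\<lambda>x. ennreal (max 0 (f x)))"
  unfolding pos_var_def
proof (rule measure_of_eq_measure)
  have spM: "space M = UNIV" using sets_eq_imp_space_eq[OF sM] by simp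
  have fm[measurable]: "f \<in> borel_measurable M" using f by auto
  have fmax: "integrable M (\<lambda>x. max 0 (f x))" using f by simp
  fix E :: "'a set" assume E[measurable]: "E \<in> sets borel"
  have em: "emeasure (density M (\<lambda>x. ennreal (max 0 (f x)))) A = ennreal (\<integral>x. indicator A x *\<^sub>R max 0 (f x) \<partial>M)"
    if "A \<in> sets borel" for A
  proof -
    have "emeasure (density M (\<lambda>x. ennreal (max 0 (f x)))) A = (\<integral>\<^sup>+x. ennreal (indicator A x *\<^sub>R max 0 (f x)) \<partial>M)"
      using that sM by (subst emeasure_density) (auto intro!: nn_integral_cong simp: indicator_def)
    also have "\<dots> = ennreal (\<integral>x. indicator A x *\<^sub>R max 0 (f x) \<partial>M)"
      by (intro nn_integral_eq_integral integrable_indicator_scaleR[OF fmax that]) (auto simp: indicator_def)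
    finally show ?thesis .
  qed
  show "(SUP A\<in>{A \<in> sets borel. A \<subseteq> E}. ennreal (\<nu> A)) = emeasure (density M (\<lambda>x. ennreal (max 0 (f x)))) E"
  proof (rule antisym)
    show "(SUP A\<in>{A \<in> sets borel. A \<subseteq> E}. ennreal (\<nu> A)) \<le> emeasure (density M (\<lambda>x. ennreal (max 0 (f x)))) E"
    proof (rule SUP_least)
      fix A assume "A \<in> {A \<in> sets borel. A \<subseteq> E}"
      then have A: "A \<in> sets borel" "A \<subseteq> E" by auto
      have "ennreal (\<nu> A) \<le> ennreal (\<integral>x. indicator A x *\<^sub>R max 0 (f x) \<partial>M)"
        unfolding \<nu>[OF A(1)]
        by (intro ennreal_leI integral_mono integrable_indicator_scaleR f fmax A(1)) (auto simp: indicator_def)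
      also have "\<dots> = emeasure (density M (\<lambda>x. ennreal (max 0 (f x)))) A" using em[OF A(1)] by simp
      also have "\<dots> \<le> emeasure (density M (\<lambda>x. ennreal (max 0 (f x)))) E"
        using A E sM by (intro emeasure_mono) auto
      finally show "ennreal (\<nu> A) \<le> emeasure (density M (\<lambda>x. ennreal (max 0 (f x)))) E" .
    qed
    define A where "A = E \<inter> {x \<in> space M. 0 < f x}"
    have "{x \<in> space M. 0 < f x} \<in> sets M" by measurable
    then have A: "A \<in> sets borel" "A \<subseteq> E" using E sM by (auto simp: A_def)
    have "emeasure (density M (\<lambda>x. ennreal (max 0 (f x)))) E = ennreal (\<integral>x. indicator E x *\<^sub>R max 0 (f x) \<partial>M)"
      by (rule em[OF E])
    also have "(\<integral>x. indicator E x *\<^sub>R max 0 (f x) \<partial>M) = \<nu> A"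
      unfolding \<nu>[OF A(1)] by (intro Bochner_Integration.integral_cong) (auto simp: indicator_def A_def)
    also have "ennreal (\<nu> A) \<le> (SUP A\<in>{A \<in> sets borel. A \<subseteq> E}. ennreal (\<nu> A))"
      using A by (intro SUP_upper) auto
    finally show "emeasure (density M (\<lambda>x. ennreal (max 0 (f x)))) E \<le> (SUP A\<in>{A \<in> sets borel. A \<subseteq> E}. ennreal (\<nu> A))" .
  qed
qed (simp add: sM)

text \<open>The four variations have as densities the positive parts of the real and imaginary part
  of \<open>h\<close> and of their negatives. They recombine because a real number is the difference
  of its positive and negative part.\<close>

lemma cmeas_integral_cdens:
  assumes h: "integrable M h" and f[measurable]: "f \<in> borel_measurable borel"
    and hf: "integrable M (\<lambda>x. h x * f x)"
  shows "cmeas_integral (cdens M h) f = (\<integral>x. h x * f x \<partial>M)"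
proof -
  have hm[measurable]: "h \<in> borel_measurable M" using h by auto
  have I: "(\<integral>x. f x \<partial>pos_var \<nu>) = (\<integral>x. max 0 (g x) *\<^sub>R f x \<partial>M)"
    "integrable M (\<lambda>x. max 0 (g x) *\<^sub>R f x)"
    if g: "integrable M g" "\<And>x. \<bar>g x\<bar> \<le> cmod (h x)"
      and \<nu>: "\<forall>E\<in>sets borel. \<nu> E = (\<integral>x. indicator E x *\<^sub>R g x \<partial>M)" for g :: "'a \<Rightarrow> real" and \<nu>
  proof -
    have [measurable]: "g \<in> borel_measurable M" using g by auto
    show "(\<integral>x. f x \<partial>pos_var \<nu>) = (\<integral>x. max 0 (g x) *\<^sub>R f x \<partial>M)"
      using \<nu> by (subst pos_var_density[OF g(1)], simp, subst integral_density) auto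
    show "integrable M (\<lambda>x. max 0 (g x) *\<^sub>R f x)"
    proof (rule Bochner_Integration.integrable_bound[OF hf])
      have "max 0 (g x) \<le> cmod (h x)" for x using g(2)[of x] by auto
      then show "AE x in M. cmod (max 0 (g x) *\<^sub>R f x) \<le> cmod (h x * f x)"
        by (auto simp: norm_mult intro!: mult_right_mono)
    qed measurable
  qed
  have ii: "integrable M (\<lambda>x. indicator E x *\<^sub>R h x)" if "E \<in> sets borel" for E
    by (rule integrable_indicator_scaleR[OF h that])
  have R: "Re (cdens M h E) = (\<integral>x. indicator E x *\<^sub>R Re (h x) \<partial>M)"
    "Im (cdens M h E) = (\<integral>x. indicator E x *\<^sub>R Im (h x) \<partial>M)" if "E \<in> sets borel" for E
    using ii[OF that] that by (auto simp: cdens_def integral_Re[symmetric] integral_Im[symmetric] simp del: integral_Re integral_Im)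
  have R': "- Re (cdens M h E) = (\<integral>x. indicator E x *\<^sub>R - Re (h x) \<partial>M)"
    "- Im (cdens M h E) = (\<integral>x. indicator E x *\<^sub>R - Im (h x) \<partial>M)" if "E \<in> sets borel" for E
    using R[OF that] by auto
  have gi: "integrable M (\<lambda>x. Re (h x))" "integrable M (\<lambda>x. - Re (h x))"
     "integrable M (\<lambda>x. Im (h x))" "integrable M (\<lambda>x. - Im (h x))"
    using h by auto
  have gb: "\<bar>Re (h x)\<bar> \<le> cmod (h x)" "\<bar>- Re (h x)\<bar> \<le> cmod (h x)" 
     "\<bar>Im (h x)\<bar> \<le> cmod (h x)" "\<bar>- Im (h x)\<bar> \<le> cmod (h x)" for x
    by (auto simp: abs_Re_le_cmod abs_Im_le_cmod)
  have B: "\<forall>E\<in>sets borel. Re (cdens M h E) = (\<integral>x. indicator E x *\<^sub>R Re (h x) \<partial>M)"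
    "\<forall>E\<in>sets borel. - Re (cdens M h E) = (\<integral>x. indicator E x *\<^sub>R - Re (h x) \<partial>M)"
    "\<forall>E\<in>sets borel. Im (cdens M h E) = (\<integral>x. indicator E x *\<^sub>R Im (h x) \<partial>M)"
    "\<forall>E\<in>sets borel. - Im (cdens M h E) = (\<integral>x. indicator E x *\<^sub>R - Im (h x) \<partial>M)"
    using R R' by blast+
  note I1 = I[OF gi(1) gb(1) B(1)] note I2 = I[OF gi(2) gb(2) B(2)]
  note I3 = I[OF gi(3) gb(3) B(3)] note I4 = I[OF gi(4) gb(4) B(4)]
  have "cmeas_integral (cdens M h) f = (\<integral>x. (max 0 (Re (h x)) *\<^sub>R f x - max 0 (- Re (h x)) *\<^sub>R f x)
      + \<i> * (max 0 (Im (h x)) *\<^sub>R f x - max 0 (- Im (h x)) *\<^sub>R f x) \<partial>M)"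
    unfolding cmeas_integral_def I1(1) I2(1) I3(1) I4(1) using I1(2) I2(2) I3(2) I4(2) by simp
  also have "\<dots> = (\<integral>x. h x * f x \<partial>M)"
  proof (intro Bochner_Integration.integral_cong refl)
    fix x
    have m: "max 0 r *\<^sub>R z - max 0 (- r) *\<^sub>R z = of_real r * z" for r :: real and z :: complex
      by (auto simp: max_def scaleR_conv_of_real)
    show "(max 0 (Re (h x)) *\<^sub>R f x - max 0 (- Re (h x)) *\<^sub>R f x)
      + \<i> * (max 0 (Im (h x)) *\<^sub>R f x - max 0 (- Im (h x)) *\<^sub>R f x) = h x * f x"
      unfolding m by (subst (3) complex_eq[of "h x"]) (simp add: algebra_simps)
  qed
  finally show ?thesis .
qed

text \<open>Domination by \<open>M\<close> makes Re \<mu> + M nonnegative, so facts about positive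
  measures apply to it and \<open>M\<close> can be subtracted afterwards.\<close>

lemma shifted_measure:
  assumes fin: "finite_measure M" and \<mu>: "complex_measure \<mu>"
    and dom: "\<And>A. A \<in> sets borel \<Longrightarrow> cmod (\<mu> A) \<le> measure M A"
  obtains Q where "sets Q = sets borel" "finite_measure Q"
    "\<And>E. E \<in> sets borel \<Longrightarrow> measure Q E = Re (\<mu> E) + measure M E"
    "\<And>E. E \<in> sets borel \<Longrightarrow> emeasure Q E = ennreal (Re (\<mu> E) + measure M E)"
proof -
  interpret finite_measure M by fact
  let ?q = "\<lambda>E. ennreal (Re (\<mu> E) + measure M E)"
  define Q where "Q = measure_of UNIV (sets borel) ?q"
  have nn: "0 \<le> Re (\<mu> E) + measure M E" if "E \<in> sets borel" for E
    using dom[OF that] abs_Re_le_cmod[of "\<mu> E"] by linarith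
  have em: "emeasure Q E = ?q E" if "E \<in> sets borel" for E
  proof (rule emeasure_measure_of[OF Q_def])
    show "countably_additive (sets Q) ?q"
    proof (rule countably_additiveI)
      fix A :: "nat \<Rightarrow> 'a set" assume "range A \<subseteq> sets Q" and dj: "disjoint_family A"
      then have A: "range A \<subseteq> sets borel"
        using sets.sigma_sets_eq[of "borel :: 'a measure"] by (simp add: Q_def)
      have "(\<lambda>n. Re (\<mu> (A n)) + measure M (A n)) sums (Re (\<mu> (\<Union>n. A n)) + measure M (\<Union>n. A n))"
        using A dj sM by (intro sums_add sums_Re complex_measure_sums[OF \<mu>] finite_measure_UNION) auto
      then show "(\<Sum>i. ?q (A i)) = ?q (\<Union>i. A i)"
        using A by (subst suminf_ennreal2) (auto simp: sums_iff intro!: nn)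
    qed
  qed (use that complex_measure_empty[OF \<mu>] in \<open>auto simp: Q_def positive_def\<close>)
  have sQ: "sets Q = sets borel"
    using sets.sigma_sets_eq[of "borel :: 'a measure"] by (simp add: Q_def)
  then have "finite_measure Q"
    by (intro finite_measureI) (simp add: em sets_eq_imp_space_eq[OF sQ])
  then show ?thesis using em nn sQ that[of Q] by (auto simp: measure_def)
qed

text \<open>The positive measure Re \<mu> + M is absolutely continuous with respect to
  \<open>M\<close>; subtracting 1 from its density gives that of Re \<mu>.\<close>

lemma real_density_exists:
  assumes fin: "finite_measure M" and \<mu>: "complex_measure \<mu>"
    and dom: "\<And>A. A \<in> sets borel \<Longrightarrow> cmod (\<mu> A) \<le> measure M A"
  obtains g :: "'a \<Rightarrow> real" where "integrable M g"
    "\<And>E. E \<in> sets borel \<Longrightarrow> Re (\<mu> E) = (\<integral>x. indicator E x *\<^sub>R g x \<partial>M)"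
proof -
  interpret finite_measure M by fact
  have spM: "space M = UNIV" using sets_eq_imp_space_eq[OF sM] by simp
  obtain Q where Q: "sets Q = sets borel" "finite_measure Q"
    "\<And>E. E \<in> sets borel \<Longrightarrow> measure Q E = Re (\<mu> E) + measure M E"
    "\<And>E. E \<in> sets borel \<Longrightarrow> emeasure Q E = ennreal (Re (\<mu> E) + measure M E)"
    using shifted_measure[OF assms] by blast
  interpret Q: finite_measure Q by fact
  have "absolutely_continuous M Q"
    unfolding absolutely_continuous_def
  proof
    fix A assume "A \<in> null_sets M"
    then have "A \<in> sets borel" "measure M A = 0" using sM by (auto simp: measure_def)
    then show "A \<in> null_sets Q" using dom[of A] Q by auto
  qed
  then obtain r where r[measurable]: "r \<in> borel_measurable M" "density M r = Q"
    using Radon_Nikodym_finite_measure[OF Q(2)] Q(1) sM by auto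
  have rE: "emeasure Q E = (\<integral>\<^sup>+x. r x * indicator E x \<partial>M)" if "E \<in> sets borel" for E
    using that sM by (subst r(2)[symmetric], subst emeasure_density) auto
  have rfin: "(\<integral>\<^sup>+x. r x \<partial>M) \<noteq> \<infinity>"
    using rE[of UNIV] Q.emeasure_finite[of UNIV] by simp
  then have ae: "AE x in M. r x \<noteq> \<infinity>" by (intro nn_integral_PInf_AE) auto
  define g where "g x = enn2real (r x)" for x
  have gm[measurable]: "g \<in> borel_measurable M" unfolding g_def by measurable
  have gE: "(\<integral>\<^sup>+x. ennreal (indicator E x *\<^sub>R g x) \<partial>M) = emeasure Q E" if "E \<in> sets borel" for E
    unfolding rE[OF that] using ae
    by (intro nn_integral_cong_AE) (auto simp: g_def indicator_def less_top elim!: eventually_mono)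
  have gi: "integrable M g"
    using gE[of UNIV] Q(4)[of UNIV] by (intro integrableI_nonneg) (auto simp: g_def)
  have "(\<integral>x. indicator E x *\<^sub>R (g x - 1) \<partial>M) = Re (\<mu> E)" if E: "E \<in> sets borel" for E
  proof -
    have "ennreal (\<integral>x. indicator E x *\<^sub>R g x \<partial>M) = emeasure Q E"
      unfolding gE[OF E, symmetric]
      by (intro nn_integral_eq_integral[symmetric] integrable_indicator_scaleR gi E) (auto simp: g_def indicator_def)
    then have 1: "(\<integral>x. indicator E x *\<^sub>R g x \<partial>M) = Re (\<mu> E) + measure M E"
      unfolding Q.emeasure_eq_measure Q(3)[OF E, symmetric]
      by (subst (asm) ennreal_inj) (auto intro!: integral_nonneg_AE simp: g_def)
    have "(\<integral>x. indicator E x *\<^sub>R (g x - 1) \<partial>M) = (\<integral>x. indicator E x *\<^sub>R g x - indicator E x *\<^sub>R 1 \<partial>M)"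
      by (intro Bochner_Integration.integral_cong) (auto simp: algebra_simps)
    also have "\<dots> = (\<integral>x. indicator E x *\<^sub>R g x \<partial>M) - (\<integral>x. indicator E x *\<^sub>R 1 \<partial>M)"
      by (intro Bochner_Integration.integral_diff integrable_indicator_scaleR gi E) auto
    also have "(\<integral>x. indicator E x *\<^sub>R 1 \<partial>M) = measure M E"
      by (simp add: spM)
    finally show ?thesis using 1 by simp
  qed
  then show ?thesis using that[of "\<lambda>x. g x - 1"] gi by auto
qed

theorem complex_Radon_Nikodym:
  assumes fin: "finite_measure M" and \<mu>: "complex_measure \<mu>"
    and dom: "\<And>A. A \<in> sets borel \<Longrightarrow> cmod (\<mu> A) \<le> measure M A"
  obtains h where "integrable M h" "\<mu> = cdens M h"
proof -
  obtain g where g: "integrable M g"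
    "\<And>E. E \<in> sets borel \<Longrightarrow> Re (\<mu> E) = (\<integral>x. indicator E x *\<^sub>R g x \<partial>M)"
    using real_density_exists[OF assms] by blast
  \<comment> \<open>The imaginary part is the real part after multiplication by -i.\<close>
  have "complex_measure (\<lambda>E. - \<i> * \<mu> E)"
    using \<mu> unfolding complex_measure_def by (auto intro!: sums_mult sums_minus)
  then obtain k where k: "integrable M k"
    "\<And>E. E \<in> sets borel \<Longrightarrow> Im (\<mu> E) = (\<integral>x. indicator E x *\<^sub>R k x \<partial>M)"
    using real_density_exists[OF fin, of "\<lambda>E. - \<i> * \<mu> E"] dom by (auto simp: norm_mult)
  define h where "h x = complex_of_real (g x) + \<i> * complex_of_real (k x)" for x
  have h: "integrable M h" unfolding h_def using g k by auto
  moreover have "\<mu> E = cdens M h E" for E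
  proof (cases "E \<in> sets borel")
    case True
    note i = integrable_indicator_scaleR[OF h True]
    have "cdens M h E = (\<integral>x. indicator E x *\<^sub>R h x \<partial>M)" using True by (simp add: cdens_def)
    moreover have "Re \<dots> = Re (\<mu> E)" 
      using i by (simp add: integral_Re[symmetric] g(2)[OF True] h_def del: integral_Re)
    moreover have "Im (\<integral>x. indicator E x *\<^sub>R h x \<partial>M) = Im (\<mu> E)" 
      using i by (simp add: integral_Im[symmetric] k(2)[OF True] h_def del: integral_Im)
    ultimately show ?thesis by (simp add: complex_eq_iff)
  next
    case False
    then show ?thesis using \<mu> by (simp add: cdens_def complex_measure_def)
  qed
  ultimately show ?thesis using that[of h] by auto
qed

end

section \<open>Finite regular Borel measures\<close>

definition radon :: "'a::topological_space measure \<Rightarrow> bool" where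
  "radon M \<longleftrightarrow> sets M = sets borel \<and> finite_measure M \<and> regular_measure M"

lemma radonD:
  assumes "radon M"
  shows "sets M = sets borel" "finite_measure M" "regular_measure M" "space M = UNIV"
  using assms sets_eq_imp_space_eq[of M borel] by (auto simp: radon_def)

lemma compact_borel: "compact K \<Longrightarrow> K \<in> sets (borel :: 'a::t2_space measure)"
  by (simp add: borel_closed compact_imp_closed)

lemma measure_le_iff_emeasure_le:
  assumes "finite_measure M" "finite_measure P"
  shows "measure P A \<le> measure M A \<longleftrightarrow> emeasure P A \<le> emeasure M A"
  using assms by (simp add: finite_measure.emeasure_eq_measure)

text \<open>For finite measures, regularity amounts to a sandwich of small gap between a compact and
  an open set. In this form it passes to dominated measures by monotonicity.\<close>

lemma regular_measure_approx:
  fixes M :: "'a::t2_space measure"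
  assumes sM: "sets M = sets borel" and fin: "finite_measure M"
    and R: "regular_measure M" and E: "E \<in> sets borel" and e: "0 < e"
  shows "\<exists>K U. compact K \<and> open U \<and> K \<subseteq> E \<and> E \<subseteq> U \<and> measure M (U - K) < e"
proof -
  interpret finite_measure M by fact
  have inf: "emeasure M E = (INF U \<in> {U. open U \<and> E \<subseteq> U}. emeasure M U)"
    and sup: "emeasure M E = (SUP K \<in> {K. compact K \<and> K \<subseteq> E}. emeasure M K)"
    using bspec[OF R[unfolded regular_measure_def] E] by blast+
  have "emeasure M E < emeasure M E + ennreal (e / 2)"
    using e by (simp add: emeasure_eq_measure ennreal_plus[symmetric] ennreal_less_iff del: ennreal_plus)
  then obtain U where U: "open U" "E \<subseteq> U" "emeasure M U < emeasure M E + ennreal (e / 2)"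
    by (subst (asm) (1) inf) (auto simp: INF_less_iff)
  then have mU: "measure M U < measure M E + e / 2"
    using e by (simp add: emeasure_eq_measure ennreal_plus[symmetric] ennreal_less_iff del: ennreal_plus)
  obtain K where K: "compact K" "K \<subseteq> E" "measure M E < measure M K + e / 2"
  \<comment> \<open>In the other case the difference \<open>measure M E - e / 2\<close> is
    nonnegative, so \<open>ennreal\<close> does not truncate it.\<close>
  proof (cases "measure M E < e / 2")
    case True
    then show ?thesis using that[of "{}"] by simp
  next
    case False
    then have "ennreal (measure M E - e / 2) < emeasure M E"
      using e by (simp add: emeasure_eq_measure ennreal_less_iff)
    then obtain K where K: "compact K" "K \<subseteq> E" "ennreal (measure M E - e / 2) < emeasure M K"
      by (subst (asm) sup) (auto simp: less_SUP_iff)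
    then show ?thesis using that[of K] False by (simp add: emeasure_eq_measure ennreal_less_iff)
  qed
  have "measure M (U - K) = measure M U - measure M K"
    using U K sM by (intro finite_measure_Diff) (auto simp: compact_borel)
  also have "\<dots> < e" using mU K by linarith
  finally show ?thesis using U K by blast
qed

lemma regular_measureI_approx:
  fixes M :: "'a::t2_space measure"
  assumes sM: "sets M = sets borel" and fin: "finite_measure M"
    and A: "\<And>E e. E \<in> sets borel \<Longrightarrow> 0 < e \<Longrightarrow>
      \<exists>K U. compact K \<and> open U \<and> K \<subseteq> E \<and> E \<subseteq> U \<and> measure M (U - K) < e"
  shows "regular_measure M"
  unfolding regular_measure_def
proof (intro ballI conjI)
  interpret finite_measure M by fact
  fix E :: "'a set" assume E: "E \<in> sets borel"
  have ap: "\<exists>K U. compact K \<and> open U \<and> K \<subseteq> E \<and> E \<subseteq> U \<and> emeasure M U \<le> emeasure M E + ennreal e \<and>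
      emeasure M E \<le> emeasure M K + ennreal e" if e: "0 < e" for e
  proof -
    obtain K U where KU: "compact K" "open U" "K \<subseteq> E" "E \<subseteq> U" "measure M (U - K) < e"
      using A[OF E e] by blast
    have "measure M U = measure M K + measure M (U - K)"
      using KU sM by (subst finite_measure_Diff) (auto simp: compact_borel)
    moreover have "measure M K \<le> measure M E" "measure M E \<le> measure M U"
      using KU sM E by (auto intro!: finite_measure_mono simp: compact_borel)
    ultimately have "measure M U \<le> measure M E + e" "measure M E \<le> measure M K + e"
      using KU by linarith+
    then show ?thesis using KU e
      by (intro exI[of _ K] exI[of _ U])
        (simp add: emeasure_eq_measure ennreal_plus[symmetric] ennreal_leI del: ennreal_plus)
  qed
  show "emeasure M E = (INF U \<in> {U. open U \<and> E \<subseteq> U}. emeasure M U)"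
  proof (rule antisym)
    show "emeasure M E \<le> (INF U \<in> {U. open U \<and> E \<subseteq> U}. emeasure M U)"
      using sM by (intro INF_greatest emeasure_mono) auto
    show "(INF U \<in> {U. open U \<and> E \<subseteq> U}. emeasure M U) \<le> emeasure M E"
    proof (rule ennreal_le_epsilon)
      fix e :: real assume "0 < e"
      then obtain U where "open U" "E \<subseteq> U" "emeasure M U \<le> emeasure M E + ennreal e" using ap by blast
      then show "(INF U \<in> {U. open U \<and> E \<subseteq> U}. emeasure M U) \<le> emeasure M E + ennreal e"
        by (intro INF_lower2[of U]) auto
    qed
  qed
  show "emeasure M E = (SUP K \<in> {K. compact K \<and> K \<subseteq> E}. emeasure M K)"
  proof (rule antisym)
    show "(SUP K \<in> {K. compact K \<and> K \<subseteq> E}. emeasure M K) \<le> emeasure M E"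
      using sM E by (intro SUP_least emeasure_mono) auto
    show "emeasure M E \<le> (SUP K \<in> {K. compact K \<and> K \<subseteq> E}. emeasure M K)"
    proof (rule ennreal_le_epsilon)
      fix e :: real assume "0 < e"
      then obtain K where K: "compact K" "K \<subseteq> E" "emeasure M E \<le> emeasure M K + ennreal e" using ap by blast
      then have "emeasure M K \<le> (SUP K \<in> {K. compact K \<and> K \<subseteq> E}. emeasure M K)"
        by (intro SUP_upper) auto
      then show "emeasure M E \<le> (SUP K \<in> {K. compact K \<and> K \<subseteq> E}. emeasure M K) + ennreal e"
        using K by (meson add_right_mono order_trans)
    qed
  qed
qed

lemma radon_approx:
  fixes M :: "'a::t2_space measure"
  assumes "radon M" "E \<in> sets borel" "0 < e"
  obtains K U where "compact K" "open U" "K \<subseteq> E" "E \<subseteq> U" "measure M (U - K) < e"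
  using regular_measure_approx[of M E e] assms by (auto simp: radon_def)

text \<open>The sandwich found for the larger measure serves for the smaller one too.\<close>

lemma radonI_dominated:
  fixes M P :: "'a::t2_space measure"
  assumes M: "radon M" and sP: "sets P = sets borel"
    and le: "\<And>A. A \<in> sets borel \<Longrightarrow> emeasure P A \<le> emeasure M A"
  shows "radon P"
  unfolding radon_def
proof (intro conjI sP)
  interpret M: finite_measure M using radonD[OF M] by auto
  show fin: "finite_measure P"
    using le[of UNIV] M.emeasure_finite[of UNIV] sets_eq_imp_space_eq[OF sP]
    by (intro finite_measureI) (auto simp: top_unique)
  show "regular_measure P"
  proof (rule regular_measureI_approx[OF sP fin])
    fix E :: "'a set" and e :: real assume "E \<in> sets borel" "0 < e"
    then obtain K U where KU: "compact K" "open U" "K \<subseteq> E" "E \<subseteq> U" "measure M (U - K) < e"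
      using radon_approx[OF M] by metis
    moreover have "U - K \<in> sets borel" using KU by (auto simp: compact_borel)
    then have "measure P (U - K) \<le> measure M (U - K)"
      using le[of "U - K"] measure_le_iff_emeasure_le[OF M.finite_measure_axioms fin] by simp
    ultimately show "\<exists>K U. compact K \<and> open U \<and> K \<subseteq> E \<and> E \<subseteq> U \<and> measure P (U - K) < e"
      by (meson le_less_trans)
  qed
qed

text \<open>The sets with a sandwich of arbitrarily small gap form a sigma-algebra, so it is enough
  that open sets are exhausted by compact subsets.\<close>

lemma radonI_open:
  fixes M :: "'a::t2_space measure"
  assumes sM: "sets M = sets borel" and fin: "finite_measure M"
    and op: "\<And>U e. open U \<Longrightarrow> 0 < e \<Longrightarrow> \<exists>K. compact K \<and> K \<subseteq> U \<and> measure M (U - K) < e"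
  shows "radon M"
  unfolding radon_def
proof (intro conjI sM fin regular_measureI_approx)
  interpret finite_measure M by fact
  let ?P = "\<lambda>E. \<forall>e>0. \<exists>K U. compact K \<and> open U \<and> K \<subseteq> E \<and> E \<subseteq> U \<and> measure M (U - K) < e"
  fix E :: "'a set" and e :: real assume E: "E \<in> sets borel" and e: "0 < e"
  have "E \<in> sigma_sets UNIV {S. open S}" using E by (simp add: borel_def)
  then have "?P E"
  proof (induction rule: sigma_sets.induct)
    case (Basic U)
    show ?case
    proof (intro allI impI)
      fix e :: real assume "0 < e"
      then obtain K where "compact K" "K \<subseteq> U" "measure M (U - K) < e" using op[of U e] Basic by auto
      then show "\<exists>K V. compact K \<and> open V \<and> K \<subseteq> U \<and> U \<subseteq> V \<and> measure M (V - K) < e"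
        using Basic by (intro exI[of _ K] exI[of _ U]) simp
    qed
  next
    case Empty
    show ?case by (auto intro!: exI[of _ "{}"])
  next
    case (Compl E)
    show ?case
    proof (intro allI impI)
      fix e :: real assume e: "0 < e"
      then obtain K U where KU: "compact K" "open U" "K \<subseteq> E" "E \<subseteq> U" "measure M (U - K) < e / 2"
        using Compl.IH by (metis half_gt_zero)
      \<comment> \<open>The complement of \<open>U\<close> is closed but perhaps not compact;
        intersecting with a compact \<open>C\<close> of almost full measure repairs this.\<close>
      obtain C where C: "compact C" "measure M (UNIV - C) < e / 2"
        using op[of UNIV "e / 2"] e by auto
      have "compact (C - U)" using C KU by (intro compact_diff)
      moreover have "open (- K)" using KU by (simp add: compact_imp_closed open_Compl)
      moreover have mb: "U - K \<in> sets M" "UNIV - C \<in> sets M"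
        using KU C sM by (auto simp: compact_borel)
      then have "measure M (- K - (C - U)) \<le> measure M ((U - K) \<union> (UNIV - C))"
        by (intro finite_measure_mono) auto
      moreover have "\<dots> \<le> measure M (U - K) + measure M (UNIV - C)"
        by (rule measure_Un_le[OF mb])
      moreover have "C - U \<subseteq> UNIV - E" "UNIV - E \<subseteq> - K" using KU by auto
      ultimately show "\<exists>K U. compact K \<and> open U \<and> K \<subseteq> UNIV - E \<and> UNIV - E \<subseteq> U \<and> measure M (U - K) < e"
        using KU(5) C(2) by (intro exI[of _ "C - U"] exI[of _ "- K"]) auto
    qed
  next
    case (Union E)
    show ?case
    proof (intro allI impI)
      fix e :: real assume e: "0 < e"
      \<comment> \<open>These errors add up to e/2, which leaves e/2 for replacing the infinite
        union of the compact sets by a finite one.\<close>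
      have "\<exists>K U. compact K \<and> open U \<and> K \<subseteq> E n \<and> E n \<subseteq> U \<and> measure M (U - K) < e / 2 * (1/2) ^ Suc n" for n
      proof -
        have "0 < e / 2 * (1/2) ^ Suc n" using e by simp
        then show ?thesis using Union.IH[of n] by blast
      qed
      then have "\<forall>n. \<exists>Z. compact (fst Z) \<and> open (snd Z) \<and> fst Z \<subseteq> E n \<and> E n \<subseteq> snd Z \<and>
          measure M (snd Z - fst Z) < e / 2 * (1/2) ^ Suc n"
        by simp
      then obtain Z where Z: "\<And>n. compact (fst (Z n)) \<and> open (snd (Z n)) \<and> fst (Z n) \<subseteq> E n \<and> E n \<subseteq> snd (Z n) \<and>
          measure M (snd (Z n) - fst (Z n)) < e / 2 * (1/2) ^ Suc n"
        unfolding choice_iff by blast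
      define K U where "K n = fst (Z n)" and "U n = snd (Z n)" for n
      have KU: "compact (K n)" "open (U n)" "K n \<subseteq> E n" "E n \<subseteq> U n"
        "measure M (U n - K n) < e / 2 * (1/2) ^ Suc n" for n
        using Z[of n] by (auto simp: K_def U_def)
      have Kb: "K n \<in> sets M" "U n \<in> sets M" for n using KU sM by (auto simp: compact_borel)
      \<comment> \<open>The gap when only the first n compact sets are kept; in the limit its
        measure is at most e/2.\<close>
      define D where "D n = (\<Union>n. U n) - (\<Union>i<n. K i)" for n
      have D: "D n \<in> sets M" for n
        unfolding D_def using Kb by (intro sets.Diff sets.countable_UN sets.finite_UN) auto
      have lim: "(\<lambda>n. measure M (D n)) \<longlonglongrightarrow> measure M (\<Inter>n. D n)"
        by (rule finite_Lim_measure_decseq) (use D in \<open>auto simp: decseq_def D_def\<close>)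
      have bd: "measure M (\<Inter>n. D n) \<le> e / 2"
      proof -
        have sm: "summable (\<lambda>n. e / 2 * (1/2) ^ Suc n)" by (intro summable_mult) simp
        have sm2: "summable (\<lambda>n. measure M (U n - K n))"
          by (rule summable_comparison_test'[OF sm, of 0]) (use KU(5) in \<open>auto intro: less_imp_le\<close>)
        have "measure M (\<Inter>n. D n) \<le> measure M (\<Union>n. U n - K n)"
        proof (rule finite_measure_mono)
          show "(\<Inter>n. D n) \<subseteq> (\<Union>n. U n - K n)"
          proof
            fix x assume x: "x \<in> (\<Inter>n. D n)"
            then obtain n where "x \<in> U n" by (auto simp: D_def)
            moreover have "x \<in> D (Suc n)" using x by blast
            then have "x \<notin> K n" by (auto simp: D_def)
            ultimately show "x \<in> (\<Union>n. U n - K n)" by blast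
          qed
        qed (use Kb in auto)
        also have "\<dots> \<le> (\<Sum>n. measure M (U n - K n))"
          using Kb sm2 by (intro finite_measure_subadditive_countably) auto
        also have "\<dots> \<le> (\<Sum>n. e / 2 * (1/2) ^ Suc n)"
          using KU(5) by (intro suminf_le sm sm2) (auto intro: less_imp_le)
        also have "\<dots> = e / 2"
          using power_half_series by (subst suminf_mult) (auto simp: sums_iff)
        finally show ?thesis .
      qed
      have "\<forall>\<^sub>F n in sequentially. measure M (D n) < e"
        by (rule order_tendstoD(2)[OF lim]) (use bd e in linarith)
      then obtain n where n: "measure M (D n) < e" by (auto simp: eventually_sequentially)
      have "compact (\<Union>i<n. K i)" "open (\<Union>n. U n)" using KU by auto
      moreover have "(\<Union>i<n. K i) \<subseteq> \<Union> (range E)" using KU(3) by fastforce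
      moreover have "\<Union> (range E) \<subseteq> (\<Union>n. U n)" by (intro UN_mono KU(4)) simp
      ultimately show "\<exists>K U. compact K \<and> open U \<and> K \<subseteq> \<Union> (range E) \<and> \<Union> (range E) \<subseteq> U \<and> measure M (U - K) < e"
        using n unfolding D_def by (intro exI[of _ "\<Union>i<n. K i"] exI[of _ "\<Union>n. U n"]) simp
    qed
  qed
  then show "\<exists>K U. compact K \<and> open U \<and> K \<subseteq> E \<and> E \<subseteq> U \<and> measure M (U - K) < e" using e by blast
qed

text \<open>The sum is a common dominating measure for two complex measures. Two sandwiches combine
  to the union of the inner and the intersection of the outer sets.\<close>

lemma radon_add:
  fixes M N :: "'a::t2_space measure"
  assumes M: "radon M" and N: "radon N"
  obtains Q where "radon Q" "\<And>A. emeasure Q A = emeasure M A + emeasure N A"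
    "\<And>f. f \<in> borel_measurable borel \<Longrightarrow> (\<integral>\<^sup>+x. f x \<partial>Q) = (\<integral>\<^sup>+x. f x \<partial>M) + (\<integral>\<^sup>+x. f x \<partial>N)"
proof -
  note M' = radonD[OF M] and N' = radonD[OF N]
  interpret M: finite_measure M by (rule M')
  interpret N: finite_measure N by (rule N')
  define Q where "Q = measure_of UNIV (sets borel) (\<lambda>A. emeasure M A + emeasure N A)"
  have sQ: "sets Q = sets borel"
    using sets.sigma_sets_eq[of "borel :: 'a measure"] by (simp add: Q_def)
  have emQ: "emeasure Q A = emeasure M A + emeasure N A" for A
  proof (cases "A \<in> sets borel")
    case True
    show ?thesis
    proof (rule emeasure_measure_of[OF Q_def])
      show "countably_additive (sets Q) (\<lambda>A. emeasure M A + emeasure N A)"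
        by (rule countably_additiveI) (use sQ M' N' in \<open>auto simp: suminf_emeasure suminf_add[symmetric]\<close>)
    qed (use True sQ in \<open>auto simp: positive_def\<close>)
  next
    case False
    then show ?thesis using sQ M' N' by (simp add: emeasure_notin_sets)
  qed
  have fin: "finite_measure Q"
    by (rule finite_measureI) (simp add: emQ M.emeasure_eq_measure N.emeasure_eq_measure)
  interpret Q: finite_measure Q by fact
  have mQ: "measure Q A = measure M A + measure N A" for A
    using emQ[of A] by (simp add: M.emeasure_eq_measure N.emeasure_eq_measure Q.emeasure_eq_measure
      ennreal_plus[symmetric] del: ennreal_plus)
  have "radon Q"
    unfolding radon_def
  proof (intro conjI sQ fin regular_measureI_approx)
    fix E :: "'a set" and e :: real assume E: "E \<in> sets borel" and e: "0 < e"
    obtain K U where KU: "compact K" "open U" "K \<subseteq> E" "E \<subseteq> U" "measure M (U - K) < e / 2"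
      using radon_approx[OF M E half_gt_zero[OF e]] by blast
    obtain L V where LV: "compact L" "open V" "L \<subseteq> E" "E \<subseteq> V" "measure N (V - L) < e / 2"
      using radon_approx[OF N E half_gt_zero[OF e]] by blast
    have "measure M (U \<inter> V - (K \<union> L)) \<le> measure M (U - K)"
      using KU LV M' by (intro M.finite_measure_mono) (auto simp: compact_borel)
    moreover have "measure N (U \<inter> V - (K \<union> L)) \<le> measure N (V - L)"
      using KU LV N' by (intro N.finite_measure_mono) (auto simp: compact_borel)
    ultimately have "measure Q (U \<inter> V - (K \<union> L)) < e" using KU LV by (simp add: mQ)
    then show "\<exists>K U. compact K \<and> open U \<and> K \<subseteq> E \<and> E \<subseteq> U \<and> measure Q (U - K) < e"
      using KU LV by (intro exI[of _ "K \<union> L"] exI[of _ "U \<inter> V"]) auto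
  qed
  moreover have "(\<integral>\<^sup>+x. f x \<partial>Q) = (\<integral>\<^sup>+x. f x \<partial>M) + (\<integral>\<^sup>+x. f x \<partial>N)" if "f \<in> borel_measurable borel" for f
  proof -
    have mc: "g \<in> borel_measurable M" "g \<in> borel_measurable N" "g \<in> borel_measurable Q"
      if "g \<in> borel_measurable borel" for g :: "'a \<Rightarrow> ennreal"
      using that M'(1) N'(1) sQ by (auto cong: measurable_cong_sets)
    show ?thesis using that
    proof (induction rule: borel_measurable_induct)
      case (cong f g)
      then show ?case by (simp add: space_borel)
    next
      case (set A)
      then show ?case using M' N' sQ by (simp add: emQ)
    next
      case (mult u c)
      then show ?case by (simp add: nn_integral_cmult mc distrib_left)
    next
      case (add u v)
      then show ?case by (simp add: nn_integral_add mc ac_simps)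
    next
      case (seq U)
      have "(\<integral>\<^sup>+x. (SUP i. U i x) \<partial>P) = (SUP i. integral\<^sup>N P (U i))" if "sets P = sets borel" for P
        using that seq by (intro nn_integral_monotone_convergence_SUP) (auto cong: measurable_cong_sets)
      moreover have "incseq (\<lambda>i. integral\<^sup>N P (U i))" for P
        using seq(3) by (auto simp: incseq_def le_fun_def intro!: nn_integral_mono)
      ultimately show ?case using seq M' N' sQ by (simp add: image_comp ennreal_SUP_add)
    qed
  qed
  ultimately show ?thesis using that emQ by blast
qed

text \<open>The weight may be unbounded, so \<open>w\<close> is truncated at a level
  \<open>n\<close> above which little mass lies; below it the sandwich of \<open>M\<close> is scaled
  by \<open>n\<close>.\<close>

lemma radon_density:
  fixes M :: "'a::t2_space measure"
  assumes M: "radon M" and w: "integrable M (w :: 'a \<Rightarrow> real)" and nn: "\<And>x. 0 \<le> w x"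
  shows "radon (density M (\<lambda>x. ennreal (w x)))"
proof -
  note M' = radonD[OF M]
  interpret finite_measure M by (rule M')
  have [measurable]: "w \<in> borel_measurable M" using w by auto
  let ?D = "density M (\<lambda>x. ennreal (w x))"
  have emD: "emeasure ?D A = ennreal (\<integral>x. indicator A x *\<^sub>R w x \<partial>M)" if "A \<in> sets borel" for A
  proof -
    have "emeasure ?D A = (\<integral>\<^sup>+x. ennreal (indicator A x *\<^sub>R w x) \<partial>M)"
      using that M' by (subst emeasure_density) (auto intro!: nn_integral_cong simp: indicator_def)
    also have "\<dots> = ennreal (\<integral>x. indicator A x *\<^sub>R w x \<partial>M)"
      using nn by (intro nn_integral_eq_integral integrable_indicator_scaleR[OF M'(1) w that])
       (auto simp: indicator_def)
    finally show ?thesis .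
  qed
  have fin: "finite_measure ?D"
    by (rule finite_measureI) (simp add: M' emD)
  have mD: "measure ?D A = (\<integral>x. indicator A x *\<^sub>R w x \<partial>M)" if "A \<in> sets borel" for A
    using emD[OF that] nn by (simp add: measure_def integral_nonneg_AE)
  show ?thesis
    unfolding radon_def
  proof (intro conjI fin regular_measureI_approx)
    fix E :: "'a set" and e :: real assume E: "E \<in> sets borel" and e: "0 < e"
    have wn: "integrable M (\<lambda>x. min (w x) (real n))" for n
      by (intro Bochner_Integration.integrable_bound[OF w]) (use nn in auto)
    have "(\<lambda>n. \<integral>x. min (w x) (real n) \<partial>M) \<longlonglongrightarrow> (\<integral>x. w x \<partial>M)"
    proof (rule integral_dominated_convergence[where w = w])
      show "AE x in M. (\<lambda>n. min (w x) (real n)) \<longlonglongrightarrow> w x"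
      proof (rule AE_I2)
        fix x
        have "\<forall>\<^sub>F n in sequentially. min (w x) (real n) = w x"
          using eventually_ge_at_top[of "nat \<lceil>w x\<rceil>"] by eventually_elim linarith
        then show "(\<lambda>n. min (w x) (real n)) \<longlonglongrightarrow> w x" by (rule tendsto_eventually)
      qed
    qed (use w nn in auto)
    then have "\<forall>\<^sub>F n in sequentially. (\<integral>x. w x \<partial>M) - e / 2 < (\<integral>x. min (w x) (real n) \<partial>M)"
      using e by (intro order_tendstoD(1)) auto
    then obtain n where n: "(\<integral>x. w x \<partial>M) - e / 2 < (\<integral>x. min (w x) (real n) \<partial>M)"
      by (auto simp: eventually_sequentially)
    \<comment> \<open>The denominator uses n + 1 because n may be 0.\<close>
    have "0 < e / (2 * (real n + 1))" using e by simp
    then obtain K U where KU: "compact K" "open U" "K \<subseteq> E" "E \<subseteq> U" "measure M (U - K) < e / (2 * (real n + 1))"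
      using radon_approx[OF M E] by metis
    have b: "U - K \<in> sets borel" using KU by (auto simp: compact_borel)
    have a1: "integrable M (\<lambda>x. indicator (U - K) x *\<^sub>R real n)"
      by (rule integrable_indicator_scaleR[OF M'(1) _ b]) simp
    have a2: "integrable M (\<lambda>x. w x - min (w x) (real n))" using w wn by simp
    have "measure ?D (U - K) = (\<integral>x. indicator (U - K) x *\<^sub>R w x \<partial>M)" by (rule mD[OF b])
    also have "\<dots> \<le> (\<integral>x. (w x - min (w x) (real n)) + indicator (U - K) x *\<^sub>R real n \<partial>M)"
      by (intro integral_mono integrable_indicator_scaleR[OF M'(1)] Bochner_Integration.integrable_add
         Bochner_Integration.integrable_diff w wn b integrable_const) (auto simp: indicator_def nn)
    also have "\<dots> = ((\<integral>x. w x \<partial>M) - (\<integral>x. min (w x) (real n) \<partial>M)) + (\<integral>x. indicator (U - K) x *\<^sub>R real n \<partial>M)"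
      by (simp only: Bochner_Integration.integral_add[OF a2 a1] Bochner_Integration.integral_diff[OF w wn])
    also have "(\<integral>x. indicator (U - K) x *\<^sub>R real n \<partial>M) = real n * measure M (U - K)"
      by (subst has_bochner_integral_integral_eq[OF has_bochner_integral_indicator])
        (use M' b in \<open>auto simp: less_top[symmetric]\<close>)
    also have "real n * measure M (U - K) \<le> (real n + 1) * (e / (2 * (real n + 1)))"
      using KU(5) by (intro mult_mono) auto
    also have "\<dots> = e / 2"
    proof -
      have "m * (e / (2 * m)) = e / 2" if "m \<noteq> 0" for m :: real using that by simp
      then show ?thesis by (metis add_nonneg_pos less_irrefl of_nat_0_le_iff zero_less_one)
    qed
    finally have "measure ?D (U - K) < e" using n by linarith
    then show "\<exists>K U. compact K \<and> open U \<and> K \<subseteq> E \<and> E \<subseteq> U \<and> measure ?D (U - K) < e"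
      using KU by blast
  qed (use M' in simp_all)
qed

section \<open>Convolution of finite regular measures\<close>

lemma continuous_add_left: "continuous_on UNIV (\<lambda>x. x + y)"
  for y :: "'a::topological_monoid_add"
  by (intro continuous_intros)

lemma add_left_measurable [measurable]: "(\<lambda>x. x + y) \<in> borel_measurable borel"
  for y :: "'a::topological_monoid_add"
  by (rule borel_measurable_continuous_onI[OF continuous_add_left])

lemma translate_borel [simp]:
  fixes y :: "'a::topological_monoid_add"
  assumes "E \<in> sets borel"
  shows "(\<lambda>x. x + y) -` E \<in> sets borel"
  using measurable_sets[OF add_left_measurable assms] by simp

text \<open>This is the tube lemma for the compact set \<open>K\<close> and the open preimage of
  \<open>U\<close> under addition.\<close>

lemma open_translates_of_compact:
  fixes K U :: "'a::{topological_monoid_add, t2_space} set"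
  assumes "compact K" "open U"
  shows "open {y. K \<subseteq> (\<lambda>x. x + y) -` U}"
proof (subst open_subopen, intro ballI)
  fix y assume "y \<in> {y. K \<subseteq> (\<lambda>x. x + y) -` U}"
  then have "{y} \<times> K \<subseteq> (\<lambda>(y, x). x + y) -` U" by auto
  moreover have "open ((\<lambda>(y, x :: 'a). x + y) -` U)"
    using assms by (intro open_vimage) (auto intro!: continuous_intros simp: split_beta)
  ultimately obtain X where "y \<in> X" "open X" "X \<times> K \<subseteq> (\<lambda>(y, x). x + y) -` U"
    using Elementary_Topology.tube_lemma[OF assms(1)] by metis
  then show "\<exists>T. open T \<and> y \<in> T \<and> T \<subseteq> {y. K \<subseteq> (\<lambda>x. x + y) -` U}"
    by (intro exI[of _ X]) auto
qed

text \<open>For open sets the function is lower semicontinuous; Dynkin's lemma gives the rest.\<close>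

lemma measurable_translate_measure:
  fixes M :: "'a::{topological_monoid_add, t2_space} measure"
  assumes M: "radon M" and E: "E \<in> sets borel"
  shows "(\<lambda>y. emeasure M ((\<lambda>x. x + y) -` E)) \<in> borel_measurable borel"
proof -
  note M' = radonD[OF M]
  interpret finite_measure M by (rule M')
  have "Int_stable {S::'a set. open S}" by (auto simp: Int_stable_def)
  moreover have "{S::'a set. open S} \<subseteq> Pow UNIV" by simp
  moreover have "E \<in> sigma_sets UNIV {S. open S}" using E by (simp add: borel_def)
  ultimately show ?thesis
  proof (induction rule: sigma_sets_induct_disjoint)
    case (basic U)
    then have U: "open U" by simp
    show ?case
    proof (rule borel_measurableI_greater)
      fix t :: ennreal
      have "open {y. t < emeasure M ((\<lambda>x. x + y) -` U)}"
      proof (subst open_subopen, intro ballI)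
        fix y assume "y \<in> {y. t < emeasure M ((\<lambda>x. x + y) -` U)}"
        then have "t < emeasure M ((\<lambda>x. x + y) -` U)" by simp
        \<comment> \<open>By inner regularity the inequality is already witnessed by a compact
          \<open>K\<close>, and \<open>K\<close> stays inside the translate for all nearby
          \<open>y\<close>.\<close>
        also have "\<dots> = (SUP K \<in> {K. compact K \<and> K \<subseteq> (\<lambda>x. x + y) -` U}. emeasure M K)"
          using bspec[OF M'(3)[unfolded regular_measure_def] translate_borel[of U y], THEN conjunct2] U
          by simp
        finally obtain K where K: "compact K" "K \<subseteq> (\<lambda>x. x + y) -` U" "t < emeasure M K"
          by (auto simp: less_SUP_iff)
        show "\<exists>T. open T \<and> y \<in> T \<and> T \<subseteq> {y. t < emeasure M ((\<lambda>x. x + y) -` U)}"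
        proof (intro exI conjI)
          show "open {y. K \<subseteq> (\<lambda>x. x + y) -` U}" using K U by (intro open_translates_of_compact)
          show "{y. K \<subseteq> (\<lambda>x. x + y) -` U} \<subseteq> {y. t < emeasure M ((\<lambda>x. x + y) -` U)}"
          proof clarify
            fix y assume "K \<subseteq> (\<lambda>x. x + y) -` U"
            then have "emeasure M K \<le> emeasure M ((\<lambda>x. x + y) -` U)"
              using U M' by (intro emeasure_mono) auto
            then show "t < emeasure M ((\<lambda>x. x + y) -` U)" using K(3) by (rule less_le_trans[rotated])
          qed
        qed (use K in simp)
      qed
      then show "{y \<in> space borel. t < emeasure M ((\<lambda>x. x + y) -` U)} \<in> sets borel" by simp
    qed
  next
    case empty
    show ?case by simp
  next
    case (compl A)
    then have A: "A \<in> sets borel" by (simp add: borel_def)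
    have "emeasure M ((\<lambda>x. x + y) -` (UNIV - A)) = emeasure M UNIV - emeasure M ((\<lambda>x. x + y) -` A)" for y
      unfolding vimage_Diff vimage_UNIV using A M' by (intro emeasure_Diff) auto
    moreover have [measurable]: "(\<lambda>y. emeasure M ((\<lambda>x. x + y) -` A)) \<in> borel_measurable borel"
      using compl(2) .
    ultimately show ?case by simp
  next
    case (union A)
    then have A: "A i \<in> sets borel" for i by (auto simp: borel_def)
    have "emeasure M ((\<lambda>x. x + y) -` (\<Union>i. A i)) = (\<Sum>i. emeasure M ((\<lambda>x. x + y) -` A i))" for y
      unfolding vimage_UN using A M' union(1)
      by (intro suminf_emeasure[symmetric]) (auto simp: disjoint_family_on_def disjoint_iff)
    then show ?case using union by simp
  qed
qed

text \<open>Convolution of positive measures, written as an iterated integral. The integrand is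
  Borel by \<open>measurable_translate_measure\<close>, so no product sigma-algebra enters.\<close>

definition mconv ::
    "'a::{topological_group_add, t2_space} measure \<Rightarrow> 'a measure \<Rightarrow> 'a measure" where
  "mconv M N = measure_of UNIV (sets borel) (\<lambda>E. \<integral>\<^sup>+y. emeasure M ((\<lambda>x. x + y) -` E) \<partial>N)"

lemma sets_mconv [simp]: "sets (mconv M N) = sets borel"
  unfolding mconv_def using sets.sigma_sets_eq[of "borel :: 'a measure"] by simp

lemma space_mconv [simp]: "space (mconv M N) = UNIV"
  unfolding mconv_def by simp

context
  fixes M N :: "'a::{topological_group_add, t2_space} measure"
  assumes M: "radon M" and N: "radon N"
begin

lemma emeasure_mconv:
  assumes E: "E \<in> sets borel"
  shows "emeasure (mconv M N) E = (\<integral>\<^sup>+y. emeasure M ((\<lambda>x. x + y) -` E) \<partial>N)"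
proof (rule emeasure_measure_of[OF mconv_def])
  show "countably_additive (sets (mconv M N)) (\<lambda>E. \<integral>\<^sup>+y. emeasure M ((\<lambda>x. x + y) -` E) \<partial>N)"
  proof (rule countably_additiveI)
    fix A :: "nat \<Rightarrow> 'a set" assume A: "range A \<subseteq> sets (mconv M N)" "disjoint_family A"
    then have Ab: "A i \<in> sets borel" for i by auto
    have mN: "(\<lambda>y. emeasure M ((\<lambda>x. x + y) -` A i)) \<in> borel_measurable N" for i
      using measurable_translate_measure[OF M Ab] radonD(1)[OF N] by (simp cong: measurable_cong_sets)
    have "(\<Sum>i. \<integral>\<^sup>+y. emeasure M ((\<lambda>x. x + y) -` A i) \<partial>N) = (\<integral>\<^sup>+y. (\<Sum>i. emeasure M ((\<lambda>x. x + y) -` A i)) \<partial>N)"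
      by (intro nn_integral_suminf[symmetric] mN)
    also have "\<dots> = (\<integral>\<^sup>+y. emeasure M ((\<lambda>x. x + y) -` (\<Union>i. A i)) \<partial>N)"
      unfolding vimage_UN using Ab A(2) radonD(1)[OF M]
      by (intro nn_integral_cong suminf_emeasure) (auto simp: disjoint_family_on_def disjoint_iff)
    finally show "(\<Sum>i. \<integral>\<^sup>+y. emeasure M ((\<lambda>x. x + y) -` A i) \<partial>N)
       = (\<integral>\<^sup>+y. emeasure M ((\<lambda>x. x + y) -` (\<Union>i. A i)) \<partial>N)" .
  qed
qed (use E in \<open>auto simp: positive_def\<close>)

lemma finite_measure_mconv: "finite_measure (mconv M N)"
proof (rule finite_measureI)
  interpret M: finite_measure M by (rule radonD[OF M])
  interpret N: finite_measure N by (rule radonD[OF N])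
  show "emeasure (mconv M N) (space (mconv M N)) \<noteq> \<infinity>"
    using radonD[OF N] by (simp add: emeasure_mconv ennreal_mult_eq_top_iff)
qed

text \<open>Measurability of the inner integral is part of the claim because each step of the
  induction on \<open>f\<close> needs it for the outer integral.\<close>

lemma nn_integral_mconv:
  assumes "f \<in> borel_measurable borel"
  shows "(\<lambda>y. \<integral>\<^sup>+x. f (x + y) \<partial>M) \<in> borel_measurable borel \<and>
    (\<integral>\<^sup>+z. f z \<partial>mconv M N) = (\<integral>\<^sup>+y. \<integral>\<^sup>+x. f (x + y) \<partial>M \<partial>N)"
  using assms
proof (induction rule: borel_measurable_induct)
  case (cong f g)
  then have "f = g" by (auto simp: fun_eq_iff)
  then show ?case using cong by simp
next
  case (set A)
  have ind: "(\<integral>\<^sup>+x. indicator A (x + y) \<partial>M) = emeasure M ((\<lambda>x. x + y) -` A)" for y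
  proof -
    have "(\<integral>\<^sup>+x. indicator A (x + y) \<partial>M) = (\<integral>\<^sup>+x. indicator ((\<lambda>x. x + y) -` A) x \<partial>M)"
      by (intro nn_integral_cong) (auto simp: indicator_def)
    then show ?thesis using set radonD(1)[OF M] by simp
  qed
  show ?case unfolding ind
    using set measurable_translate_measure[OF M set] emeasure_mconv[OF set] by simp
next
  case (mult u c)
  have mM: "(\<lambda>x. u (x + y)) \<in> borel_measurable M" for y
    using mult(2) measurable_compose[OF add_left_measurable mult(2)] radonD(1)[OF M]
    by (simp cong: measurable_cong_sets)
  have mN: "(\<lambda>y. \<integral>\<^sup>+x. u (x + y) \<partial>M) \<in> borel_measurable N"
    using mult.IH radonD(1)[OF N] by (simp cong: measurable_cong_sets)
  show ?case using mult mM mN by (auto simp: nn_integral_cmult cong: measurable_cong_sets)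
next
  case (add u v)
  have mM: "(\<lambda>x. w (x + y)) \<in> borel_measurable M" if "w \<in> borel_measurable borel" for w :: "'a \<Rightarrow> ennreal" and y
    using measurable_compose[OF add_left_measurable that] radonD(1)[OF M] by (simp cong: measurable_cong_sets)
  have mN: "(\<lambda>y. \<integral>\<^sup>+x. u (x + y) \<partial>M) \<in> borel_measurable N" "(\<lambda>y. \<integral>\<^sup>+x. v (x + y) \<partial>M) \<in> borel_measurable N"
    using add.IH radonD(1)[OF N] by (simp_all cong: measurable_cong_sets)
  show ?case using add mM mN by (auto simp: nn_integral_add cong: measurable_cong_sets)
next
  case (seq U)
  have mM: "(\<lambda>x. U i (x + y)) \<in> borel_measurable M" for i y
    using measurable_compose[OF add_left_measurable seq(1)] radonD(1)[OF M] by (simp cong: measurable_cong_sets)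
  have mN: "(\<lambda>y. \<integral>\<^sup>+x. U i (x + y) \<partial>M) \<in> borel_measurable N" for i
    using seq.IH radonD(1)[OF N] by (simp cong: measurable_cong_sets)
  have S: "(SUP i. U i) z = (SUP i. U i z)" for z by (simp add: image_comp)
  have 1: "(\<integral>\<^sup>+x. (SUP i. U i) (x + y) \<partial>M) = (SUP i. \<integral>\<^sup>+x. U i (x + y) \<partial>M)" for y
    unfolding S using seq(3) by (intro nn_integral_monotone_convergence_SUP mM) (auto simp: incseq_def le_fun_def)
  have 2: "(\<integral>\<^sup>+z. (SUP i. U i) z \<partial>mconv M N) = (SUP i. \<integral>\<^sup>+z. U i z \<partial>mconv M N)"
    unfolding S using seq(1,3) by (intro nn_integral_monotone_convergence_SUP)
      (auto simp: incseq_def le_fun_def cong: measurable_cong_sets)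
  have 3: "(\<integral>\<^sup>+y. (SUP i. \<integral>\<^sup>+x. U i (x + y) \<partial>M) \<partial>N) = (SUP i. \<integral>\<^sup>+y. \<integral>\<^sup>+x. U i (x + y) \<partial>M \<partial>N)"
    using seq(3) by (intro nn_integral_monotone_convergence_SUP mN)
      (auto simp: incseq_def le_fun_def intro!: nn_integral_mono)
  have "(\<lambda>y. SUP i. \<integral>\<^sup>+x. U i (x + y) \<partial>M) \<in> borel_measurable borel"
    using seq.IH by (intro borel_measurable_SUP) auto
  then show ?case unfolding 1 2 3 using seq.IH by auto
qed

lemma locally_compact_neighbourhood:
  assumes LC: "locally_compact_space (euclidean :: 'a topology)" and "open V" "y \<in> V"
  obtains O' W where "open O'" "compact W" "y \<in> O'" "O' \<subseteq> W" "W \<subseteq> (V :: 'a set)"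
proof -
  have "neighbourhood_base_of (compactin (euclidean :: 'a topology)) euclidean"
    using LC locally_compact_space_neighbourhood_base[of "euclidean :: 'a topology"] by (simp add: Hausdorff_space_def separation_t2 disjnt_def; metis separation_t2)
  then show ?thesis using assms that
    unfolding neighbourhood_base_of by (metis compactin_euclidean_iff open_openin)
qed

lemma compact_set_add:
  assumes "compact (A :: 'a set)" "compact B"
  shows "compact ((\<lambda>(x, y). x + y) ` (A \<times> B))"
  using assms by (intro compact_continuous_image compact_Times) (auto intro!: continuous_intros simp: split_beta)

text \<open>If a union \<open>B\<close> of compact subsets that exhausts the inner measure of \<open>U\<close> missed a part of
  positive measure, the strict inequality \<open>M (B - y) \<le> q < M (U - y)\<close> would persist on a compact
  set of \<open>y\<close>'s of positive measure, and finitely many compact rectangles there would beat \<open>B\<close>.\<close>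

lemma radon_mconv:
  assumes LC: "locally_compact_space (euclidean :: 'a topology)"
  shows "radon (mconv M N)"
proof (rule radonI_open[OF sets_mconv finite_measure_mconv])
  note M' = radonD[OF M] and N' = radonD[OF N]
  interpret M: finite_measure M by (rule M')
  interpret N: finite_measure N by (rule N')
  interpret R: finite_measure "mconv M N" by (rule finite_measure_mconv)
  let ?R = "mconv M N"
  let ?T = "\<lambda>y E. (\<lambda>x. x + y) -` E"
  fix U :: "'a set" and e :: real assume U: "open U" and e: "0 < e"
  have Ub: "U \<in> sets borel" using U by simp
  \<comment> \<open>\<open>Sup S\<close> is the inner measure of \<open>U\<close>; the compact sets
    \<open>C n\<close> approach it, and \<open>B\<close> is their union.\<close>
  define S where "S = measure ?R ` {K. compact K \<and> K \<subseteq> U}"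
  have "S \<noteq> {}" by (auto simp: S_def)
  have bdd: "bdd_above S" by (auto simp: S_def intro!: bdd_aboveI[of _ "measure ?R UNIV"] R.finite_measure_mono)
  have ex: "\<exists>K. compact K \<and> K \<subseteq> U \<and> Sup S - d < measure ?R K" if "0 < d" for d :: real
    using less_cSup_iff[OF \<open>S \<noteq> {}\<close> bdd, of "Sup S - d"] that by (auto simp: S_def)
  have "\<forall>n. \<exists>K. compact K \<and> K \<subseteq> U \<and> Sup S - 1 / real (Suc n) < measure ?R K"
    by (intro allI ex) simp
  then obtain C where C: "\<And>n. compact (C n)" "\<And>n. C n \<subseteq> U" "\<And>n. Sup S - 1 / real (Suc n) < measure ?R (C n)"
    by metis
  define B where "B = (\<Union>n. C n)"
  have Cb: "C n \<in> sets borel" for n using C by (simp add: compact_borel)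
  then have Bb: "B \<in> sets borel" by (auto simp: B_def)
  have BU: "B \<subseteq> U" using C(2) by (auto simp: B_def)
  \<comment> \<open>Joining \<open>K\<close> to \<open>C n\<close> gives another compact subset of
    \<open>U\<close>, whose measure cannot exceed \<open>Sup S\<close>; so \<open>K\<close> adds
    nothing to \<open>B\<close>.\<close>
  have null: "measure ?R (K - B) = 0" if K: "compact K" "K \<subseteq> U" for K
  proof -
    have Kb: "K \<in> sets borel" using K by (simp add: compact_borel)
    have "measure ?R (K - B) \<le> 1 / real (Suc n)" for n
    proof -
      have "measure ?R (K - B) + measure ?R (C n) = measure ?R ((K - B) \<union> C n)"
        using Kb Bb Cb by (intro R.finite_measure_Union[symmetric]) (auto simp: B_def)
      also have "\<dots> \<le> measure ?R (K \<union> C n)" using Kb Cb by (intro R.finite_measure_mono) auto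
      also have "\<dots> \<le> Sup S" 
        unfolding S_def using K C by (intro cSup_upper bdd[unfolded S_def] imageI CollectI conjI compact_Un Un_least)
      finally show ?thesis using C(3)[of n] by linarith
    qed
    then have "measure ?R (K - B) \<le> 0"
      by (intro LIMSEQ_le_const[OF LIMSEQ_inverse_real_of_nat]) (auto simp: inverse_eq_divide)
    then show ?thesis using measure_nonneg[of ?R "K - B"] by linarith
  qed
  have "emeasure ?R (U - B) = 0"
  proof (rule ccontr)
    assume pos: "emeasure ?R (U - B) \<noteq> 0"
    have mT: "(\<lambda>y. emeasure M (?T y E)) \<in> borel_measurable N" if "E \<in> sets borel" for E
      using measurable_translate_measure[OF M that] N'(1) by (simp cong: measurable_cong_sets)
    have split: "measure M (?T y X) - measure M (?T y Y) = measure M (?T y (X - Y))"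
      if "X \<in> sets borel" "Y \<in> sets borel" "Y \<subseteq> X" for X Y y
      unfolding vimage_Diff using that M' by (intro M.finite_measure_Diff[symmetric]) auto
    \<comment> \<open>The \<open>y\<close> at which the level \<open>q\<close> separates the
      measures of the translates of \<open>B\<close> and of \<open>U\<close>.\<close>
    define D where "D q = {y. measure M (?T y B) \<le> q \<and> q < measure M (?T y U)}" for q
    have mm: "(\<lambda>y. measure M (?T y E)) \<in> borel_measurable borel" if "E \<in> sets borel" for E
      unfolding measure_def using measurable_translate_measure[OF M that] by measurable
    have Db: "D q \<in> sets borel" for q
    proof -
      have [measurable]: "(\<lambda>y. measure M (?T y B)) \<in> borel_measurable borel"
        "(\<lambda>y. measure M (?T y U)) \<in> borel_measurable borel" using mm Bb Ub by auto
      have "{y \<in> space borel. measure M (?T y B) \<le> q \<and> q < measure M (?T y U)} \<in> sets borel" by measurable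
      then show ?thesis by (simp add: D_def)
    qed
    \<comment> \<open>Rational levels are countably many. If all these sets were null, the
      translates of \<open>U - B\<close> would be null for almost all \<open>y\<close>, and so would
      \<open>U - B\<close> for the convolution.\<close>
    have "\<exists>q\<in>\<rat>. measure N (D q) > 0"
    proof (rule ccontr)
      assume none: "\<not> ?thesis"
      have "measure N (D q) = 0" if "q \<in> \<rat>" for q
      proof -
        have "\<not> 0 < measure N (D q)" using none that by blast
        then show ?thesis using measure_nonneg[of N "D q"] by linarith
      qed
      then have z: "emeasure N (D q) = 0" if "q \<in> \<rat>" for q
        using that by (simp add: N.emeasure_eq_measure)
      have "(\<Union>q\<in>\<rat>. D q) \<in> null_sets N"
        using z Db N' by (intro null_sets_UN') (auto simp: countable_rat null_sets_def)
      then have "AE y in N. y \<notin> (\<Union>q\<in>\<rat>. D q)" by (rule AE_not_in)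
      then have "AE y in N. emeasure M (?T y (U - B)) = 0"
      proof eventually_elim
        case (elim y)
        have "measure M (?T y U) \<le> measure M (?T y B)"
          using elim Rats_dense_in_real[of "measure M (?T y B)" "measure M (?T y U)"]
          by (force simp: D_def not_less[symmetric])
        then have "measure M (?T y (U - B)) = 0"
          using split[OF Ub Bb BU, of y] measure_nonneg[of M "?T y (U - B)"] by linarith
        then show ?case by (simp only: M.emeasure_eq_measure ennreal_0)
      qed
      then have "(\<integral>\<^sup>+y. emeasure M (?T y (U - B)) \<partial>N) = 0"
        using mT[of "U - B"] Ub Bb by (subst nn_integral_0_iff_AE) auto
      then show False using pos Ub Bb by (subst (asm) emeasure_mconv) auto
    qed
    then obtain q where q: "measure N (D q) > 0" by blast
    obtain L V where L: "compact L" "L \<subseteq> D q" "D q \<subseteq> V" "open V" "measure N (V - L) < measure N (D q)"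
      using radon_approx[OF N Db q] by metis
    have Lb: "L \<in> sets borel" using L by (simp add: compact_borel)
    have Lpos: "measure N L > 0"
    proof (rule ccontr)
      assume "\<not> measure N L > 0"
      then have "measure N (D q) = measure N (D q - L)"
        using L Lb Db[of q] N' measure_nonneg[of N L] by (subst N.finite_measure_Diff) auto
      also have "\<dots> \<le> measure N (V - L)" using L Lb N' by (intro N.finite_measure_mono) auto
      finally show False using L by simp
    qed
    \<comment> \<open>A compact part \<open>C\<close> of the translate of \<open>U\<close> already
      exceeds \<open>q\<close>. It stays inside for all \<open>y\<close> in a compact neighbourhood
      \<open>W\<close>, so the sum set of \<open>C\<close> and \<open>W\<close> is a compact subset
      of \<open>U\<close>.\<close>
    have "\<exists>C O' W. compact C \<and> compact W \<and> open O' \<and> y \<in> O' \<and> O' \<subseteq> W \<and> W \<subseteq> {y. C \<subseteq> ?T y U} \<and> q < measure M C"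
      if y: "y \<in> L" for y
    proof -
      have q': "0 < measure M (?T y U) - q" using y L by (auto simp: D_def)
      obtain C X where C: "compact C" "C \<subseteq> ?T y U" "?T y U \<subseteq> X" "open X" "measure M (X - C) < measure M (?T y U) - q"
        using radon_approx[OF M translate_borel[OF Ub] q'] by metis
      have "measure M (?T y U) - measure M C = measure M (?T y U - C)"
        using C Ub M' by (intro M.finite_measure_Diff[symmetric]) (auto simp: compact_borel)
      also have "\<dots> \<le> measure M (X - C)" using C M' by (intro M.finite_measure_mono) (auto simp: compact_borel)
      finally have "q < measure M C" using C by linarith
      moreover have "open {y. C \<subseteq> ?T y U}" using C U by (intro open_translates_of_compact)
      then obtain O' W where "open O'" "compact W" "y \<in> O'" "O' \<subseteq> W" "W \<subseteq> {y. C \<subseteq> ?T y U}"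
        using locally_compact_neighbourhood[OF LC, of _ y] C by blast
      ultimately show ?thesis using C by blast
    qed
    then have "\<forall>y\<in>L. \<exists>Z. compact (fst Z) \<and> compact (snd (snd Z)) \<and> open (fst (snd Z)) \<and> y \<in> fst (snd Z) \<and>
        fst (snd Z) \<subseteq> snd (snd Z) \<and> snd (snd Z) \<subseteq> {z. fst Z \<subseteq> ?T z U} \<and> q < measure M (fst Z)"
      by simp
    from bchoice[OF this] obtain Z where Z: "\<forall>y\<in>L. compact (fst (Z y)) \<and> compact (snd (snd (Z y))) \<and>
        open (fst (snd (Z y))) \<and> y \<in> fst (snd (Z y)) \<and> fst (snd (Z y)) \<subseteq> snd (snd (Z y)) \<and>
        snd (snd (Z y)) \<subseteq> {z. fst (Z y) \<subseteq> ?T z U} \<and> q < measure M (fst (Z y))" ..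
    define C' O' W where "C' y = fst (Z y)" and "O' y = fst (snd (Z y))" and "W y = snd (snd (Z y))" for y
    have CW: "\<And>y. y \<in> L \<Longrightarrow> compact (C' y)" "\<And>y. y \<in> L \<Longrightarrow> compact (W y)"
      "\<And>y. y \<in> L \<Longrightarrow> open (O' y)" "\<And>y. y \<in> L \<Longrightarrow> y \<in> O' y" "\<And>y. y \<in> L \<Longrightarrow> O' y \<subseteq> W y"
      "\<And>y. y \<in> L \<Longrightarrow> W y \<subseteq> {z. C' y \<subseteq> ?T z U}" "\<And>y. y \<in> L \<Longrightarrow> q < measure M (C' y)"
      unfolding C'_def O'_def W_def using Z by blast+
    obtain F where F: "F \<subseteq> L" "finite F" "L \<subseteq> (\<Union>y\<in>F. O' y)"
      using compactE_image[OF L(1), of L O'] CW(3,4) by blast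
    define K where "K = (\<Union>y\<in>F. (\<lambda>(x, y). x + y) ` (C' y \<times> W y))"
    have K: "compact K" unfolding K_def using F CW by (intro compact_UN compact_set_add) auto
    have KU: "K \<subseteq> U" unfolding K_def using F CW(6) by fastforce
    have Kb: "K \<in> sets borel" using K by (simp add: compact_borel)
    \<comment> \<open>The translate of \<open>K\<close> by any \<open>z\<close> in \<open>L\<close>
      has measure above \<open>q\<close>, that of \<open>B\<close> at most \<open>q\<close>. As
      \<open>L\<close> has positive measure, this contradicts \<open>null\<close>.\<close>
    have big: "0 < measure M (?T z (K - B))" if z: "z \<in> L" for z
    proof -
      obtain y where y: "y \<in> F" "z \<in> O' y" using F z by blast
      then have yL: "y \<in> L" using F by blast
      then have "z \<in> W y" using y CW(5) by blast
      then have "C' y \<subseteq> ?T z K" using y by (force simp: K_def)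
      then have "measure M (C' y) \<le> measure M (?T z K)" using Kb M' by (intro M.finite_measure_mono) auto
      then have "measure M (?T z B) < measure M (?T z K)"
        using CW(7)[OF yL] z L(2) by (force simp: D_def)
      moreover have "measure M (?T z K) \<le> measure M (?T z B) + measure M (?T z (K - B))"
      proof -
        have "?T z K \<subseteq> ?T z B \<union> ?T z (K - B)" by auto
        then have "measure M (?T z K) \<le> measure M (?T z B \<union> ?T z (K - B))"
          using Kb Bb M' by (intro M.finite_measure_mono sets.Un) auto
        also have "\<dots> \<le> measure M (?T z B) + measure M (?T z (K - B))"
          using Kb Bb M' by (intro measure_Un_le) auto
        finally show ?thesis .
      qed
      ultimately show ?thesis by linarith
    qed
    have "(\<integral>\<^sup>+y. emeasure M (?T y (K - B)) \<partial>N) = 0"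
      using null[OF K KU] Kb Bb by (subst emeasure_mconv[symmetric]) (auto simp: R.emeasure_eq_measure)
    then have "AE y in N. emeasure M (?T y (K - B)) = 0"
      using mT[of "K - B"] Kb Bb by (subst (asm) nn_integral_0_iff_AE) auto
    then have "AE y in N. y \<notin> L"
    proof eventually_elim
      case (elim y)
      then show ?case using big[of y] by (auto simp: M.emeasure_eq_measure)
    qed
    then have "emeasure N L = 0" using Lb N' by (subst (asm) AE_iff_measurable[of L]) auto
    then show False using Lpos by (simp add: N.emeasure_eq_measure)
  qed
  then have UB: "measure ?R (U - B) = 0" by (simp add: R.emeasure_eq_measure)
  \<comment> \<open>\<open>B\<close> is only a countable union of compact sets; finite unions of
    them approximate it in measure.\<close>
  have "(\<lambda>n. measure ?R (\<Union>i<n. C i)) \<longlonglongrightarrow> measure ?R (\<Union>n. \<Union>i<n. C i)"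
  proof (rule R.finite_Lim_measure_incseq)
    show "incseq (\<lambda>n. \<Union>i<n. C i)" unfolding incseq_def by (intro allI impI UN_mono) auto
  qed (use Cb in auto)
  moreover have "(\<Union>n. \<Union>i<n. C i) = B" by (auto simp: B_def)
  ultimately have "\<forall>\<^sub>F n in sequentially. measure ?R B - e < measure ?R (\<Union>i<n. C i)"
    using e by (intro order_tendstoD(1)[of _ "measure ?R B"]) auto
  then obtain n where n: "measure ?R B - e < measure ?R (\<Union>i<n. C i)" by (auto simp: eventually_sequentially)
  let ?K = "\<Union>i<n. C i"
  have Kb: "?K \<in> sets borel" using Cb by auto
  have "measure ?R (U - ?K) = measure ?R U - measure ?R ?K"
    using Ub Kb C(2) by (intro R.finite_measure_Diff) auto
  moreover have "measure ?R U - measure ?R B = 0"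
    using UB Ub Bb BU by (subst (asm) R.finite_measure_Diff) auto
  ultimately have "measure ?R (U - ?K) < e" using n by linarith
  moreover have "compact ?K" "?K \<subseteq> U" using C by auto
  ultimately show "\<exists>K. compact K \<and> K \<subseteq> U \<and> measure ?R (U - K) < e" by blast
qed

end

section \<open>The weighted measure algebra\<close>

lemma nn_integral_mono_emeasure:
  assumes "sets M = sets borel" "sets P = sets borel"
    and "\<And>A. A \<in> sets borel \<Longrightarrow> emeasure P A \<le> emeasure M A"
  shows "(\<integral>\<^sup>+x. f x \<partial>P) \<le> (\<integral>\<^sup>+x. f x \<partial>M)"
proof -
  have "P \<le> M" using assms by (subst le_measure) auto
  then show ?thesis using assms by (intro nn_integral_mono_measure) auto
qed

lemma cdens_cong_AE:
  assumes "sets M = sets borel" "h \<in> borel_measurable M" "k \<in> borel_measurable M" "AE x in M. h x = k x"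
  shows "cdens M h = cdens M k"
proof
  fix E
  show "cdens M h E = cdens M k E"
    unfolding cdens_def using assms by (auto intro!: integral_cong_AE elim!: eventually_mono)
qed

text \<open>An image of the measure on a one-point space, so that its sigma-algebra is the Borel one
  and integrals reduce to evaluation.\<close>

definition point_measure_at :: "'a \<Rightarrow> 'a::topological_space measure" where
  "point_measure_at x = distr (count_space {()}) borel (\<lambda>_. x)"

lemma sets_point_measure_at [simp, measurable_cong]: "sets (point_measure_at x) = sets borel"
  and space_point_measure_at [simp]: "space (point_measure_at x) = UNIV"
  by (simp_all add: point_measure_at_def)

lemma nn_integral_point_measure_at:
  "f \<in> borel_measurable borel \<Longrightarrow> (\<integral>\<^sup>+z. f z \<partial>point_measure_at x) = f x"
  unfolding point_measure_at_def by (subst nn_integral_distr) (auto simp: nn_integral_count_space_finite)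

lemma integral_point_measure_at:
  fixes f :: "_ \<Rightarrow> 'b::{banach, second_countable_topology}"
  shows "f \<in> borel_measurable borel \<Longrightarrow> (\<integral>z. f z \<partial>point_measure_at x) = f x"
  unfolding point_measure_at_def by (subst integral_distr) (auto simp: lebesgue_integral_count_space_finite)

lemma emeasure_point_measure_at:
  "E \<in> sets borel \<Longrightarrow> emeasure (point_measure_at x) E = indicator E x"
  using nn_integral_point_measure_at[of "indicator E" x] by simp

lemma radon_point_measure_at: "radon (point_measure_at (x :: 'a::t2_space))"
proof -
  have fin: "finite_measure (point_measure_at x)"
    by (rule finite_measureI) (simp add: emeasure_point_measure_at)
  show ?thesis
    unfolding radon_def
  proof (intro conjI fin regular_measureI_approx)
  fix E :: "'a set" and e :: real assume "E \<in> sets borel" "0 < e"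
  show "\<exists>K U. compact K \<and> open U \<and> K \<subseteq> E \<and> E \<subseteq> U \<and> measure (point_measure_at x) (U - K) < e"
  proof (cases "x \<in> E")
    case True
    have "UNIV - {x} \<in> sets borel" by auto
    then have "measure (point_measure_at x) (UNIV - {x}) = 0"
      by (simp only: measure_def emeasure_point_measure_at) simp
    then show ?thesis using \<open>0 < e\<close> True
      by (intro exI[of _ "{x}"] exI[of _ UNIV]) simp
  next
    case False
    have "open (- {x})" by (simp add: open_Compl)
    moreover from this have "measure (point_measure_at x) (- {x} - {}) = 0"
      by (simp add: measure_def emeasure_point_measure_at)
    ultimately show ?thesis using False \<open>0 < e\<close>
      by (intro exI[of _ "{}"] exI[of _ "- {x}"]) auto
  qed
  qed simp_all
qed

section \<open>Restrictions and Dirac measures as elements of M(G,\<omega>)\<close>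

definition restr :: "'a set \<Rightarrow> ('a::topological_space set \<Rightarrow> complex) \<Rightarrow> 'a set \<Rightarrow> complex" where
  "restr B \<mu> = (\<lambda>E. if E \<in> sets borel then \<mu> (E \<inter> B) else 0)"

definition dirac :: "'a \<Rightarrow> 'a::topological_space set \<Rightarrow> complex" where
  "dirac x = (\<lambda>E. if E \<in> sets borel then indicator E x else 0)"

lemma dirac_eq_cdens: "dirac x = cdens (point_measure_at x) (\<lambda>_. 1)"
  by (auto simp: dirac_def cdens_def fun_eq_iff integral_point_measure_at indicator_def)

lemma restr_cdens:
  assumes "h \<in> borel_measurable borel" "B \<in> sets borel"
  shows "restr B (cdens M h) = cdens M (\<lambda>x. indicator B x * h x)"
  using assms by (auto simp: restr_def cdens_def fun_eq_iff indicator_def intro!: Bochner_Integration.integral_cong)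

context
  fixes \<omega> :: "'a::{topological_group_add, t2_space} \<Rightarrow> real"
  assumes W: "weight \<omega>"
begin

lemma weight_measurable [measurable]: "\<omega> \<in> borel_measurable borel"
  using W by (auto simp: weight_def intro: borel_measurable_continuous_onI)

lemma weight_ge_1: "1 \<le> \<omega> x" and weight_pos: "0 < \<omega> x" and weight_nonneg: "0 \<le> \<omega> x"
  and weight_0: "\<omega> 0 = 1" and weight_mult: "\<omega> (x + y) \<le> \<omega> x * \<omega> y"
proof -
  show 1: "1 \<le> \<omega> x" for x using W by (auto simp: weight_def)
  show "0 < \<omega> x" "0 \<le> \<omega> x" using 1[of x] by linarith+
  show "\<omega> 0 = 1" "\<omega> (x + y) \<le> \<omega> x * \<omega> y" using W by (auto simp: weight_def)
qed

lemma weight_integrable_iff: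
  assumes "sets M = sets borel"
  shows "integrable M \<omega> \<longleftrightarrow> (\<integral>\<^sup>+x. ennreal (\<omega> x) \<partial>M) < \<infinity>"
  using assms weight_nonneg by (simp add: integrable_iff_bounded cong: measurable_cong_sets)

lemma finite_measure_of_weight:
  assumes "integrable M \<omega>" "space M = UNIV"
  shows "finite_measure M"
proof (rule finite_measureI)
  have "emeasure M (space M) = (\<integral>\<^sup>+x. 1 \<partial>M)" by simp
  also have "\<dots> \<le> (\<integral>\<^sup>+x. ennreal (norm (\<omega> x)) \<partial>M)"
    using weight_ge_1 by (intro nn_integral_mono) (auto simp: ennreal_1[symmetric] abs_of_nonneg weight_nonneg simp del: ennreal_1 intro!: ennreal_leI)
  also have "\<dots> < \<infinity>" using assms by (simp add: integrable_iff_bounded)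
  finally show "emeasure M (space M) \<noteq> \<infinity>" by simp
qed

lemma wmeasD:
  assumes "\<mu> \<in> wmeas_space \<omega>"
  shows "complex_measure \<mu>" "radon (total_var \<mu>)" "integrable (total_var \<mu>) \<omega>"
    "finite_measure (total_var \<mu>)"
proof -
  show "complex_measure \<mu>" and i: "integrable (total_var \<mu>) \<omega>"
    using assms by (auto simp: wmeas_space_def meas_space_def)
  show f: "finite_measure (total_var \<mu>)" using i by (rule finite_measure_of_weight) simp
  show "radon (total_var \<mu>)"
    using assms f by (auto simp: wmeas_space_def meas_space_def radon_def)
qed

text \<open>The Radon-Nikodym density with respect to the total variation has modulus 1 almost
  everywhere, by \<open>total_var_cdens\<close> and uniqueness of densities.\<close>

lemma polar_decomposition:
  assumes \<mu>: "complex_measure \<mu>" and fin: "finite_measure (total_var \<mu>)"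
  obtains h where "h \<in> borel_measurable borel" "\<And>x. cmod (h x) = 1" "\<mu> = cdens (total_var \<mu>) h"
proof -
  interpret finite_measure "total_var \<mu>" by fact
  have "cmod (\<mu> A) \<le> measure (total_var \<mu>) A" for A
    using cmod_le_total_var[OF \<mu>, of A] by (simp add: emeasure_eq_measure)
  then obtain g where g: "integrable (total_var \<mu>) g" "\<mu> = cdens (total_var \<mu>) g"
    using complex_Radon_Nikodym[OF sets_total_var fin \<mu>] by blast
  have [measurable]: "g \<in> borel_measurable (total_var \<mu>)" using g by auto
  then have gm[measurable]: "g \<in> borel_measurable borel" by (simp cong: measurable_cong_sets)
  have "density (total_var \<mu>) (\<lambda>x. ennreal (cmod (g x))) = density (total_var \<mu>) (\<lambda>x. 1)"
    using total_var_cdens[OF sets_total_var fin g(1)] g(2) by (simp add: density_1)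
  then have "AE x in total_var \<mu>. ennreal (cmod (g x)) = 1"
    by (subst (asm) density_unique_iff) auto
  then have ae: "AE x in total_var \<mu>. cmod (g x) = 1"
    by eventually_elim (metis ennreal_1 ennreal_inj norm_ge_zero zero_le_one)
  \<comment> \<open>Altering \<open>g\<close> on a null set makes the modulus 1 everywhere, so later
    estimates hold pointwise.\<close>
  define h where "h x = (if cmod (g x) = 1 then g x else 1)" for x
  have h: "h \<in> borel_measurable borel" unfolding h_def by measurable
  moreover have "cmod (h x) = 1" for x by (simp add: h_def)
  moreover have "cdens (total_var \<mu>) g = cdens (total_var \<mu>) h"
    by (rule cdens_cong_AE) (use ae h in \<open>auto simp: h_def cong: measurable_cong_sets elim!: eventually_mono\<close>)
  ultimately show ?thesis using that g(2) by metis
qed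

text \<open>With a polar density \<open>h\<close>, the weighted measure has density h\<omega> with
  respect to the total variation, and the modulus of h\<omega> is \<omega>.\<close>

lemma total_var_times_measure:
  assumes \<mu>: "complex_measure \<mu>" and i: "integrable (total_var \<mu>) \<omega>"
  shows "complex_measure (times_measure \<omega> \<mu>)"
    "total_var (times_measure \<omega> \<mu>) = density (total_var \<mu>) (\<lambda>x. ennreal (\<omega> x))"
proof -
  let ?M = "total_var \<mu>"
  have fin: "finite_measure ?M" using i by (rule finite_measure_of_weight) simp
  obtain h where h: "h \<in> borel_measurable borel" "\<And>x. cmod (h x) = 1" "\<mu> = cdens ?M h"
    using polar_decomposition[OF \<mu> fin] by blast
  have [measurable]: "h \<in> borel_measurable borel" "h \<in> borel_measurable ?M"
    using h by (auto cong: measurable_cong_sets)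
  have ih: "integrable ?M h"
    using h by (intro finite_measure.integrable_const_bound[OF fin, of _ 1]) auto
  have ihw: "integrable ?M (\<lambda>x. h x * complex_of_real (\<omega> x))"
    by (rule Bochner_Integration.integrable_bound[OF i]) (use h in \<open>auto simp: norm_mult cong: measurable_cong_sets\<close>)
  have "times_measure \<omega> \<mu> = cdens ?M (\<lambda>x. h x * complex_of_real (\<omega> x))"
  proof
    fix E
    show "times_measure \<omega> \<mu> E = cdens ?M (\<lambda>x. h x * complex_of_real (\<omega> x)) E"
    proof (cases "E \<in> sets borel")
      case True
      have iE: "integrable ?M (\<lambda>x. h x * (indicator E x * complex_of_real (\<omega> x)))"
        by (rule Bochner_Integration.integrable_bound[OF ihw])
          (use True in \<open>auto simp: norm_mult indicator_def cong: measurable_cong_sets\<close>)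
      have "times_measure \<omega> \<mu> E = cmeas_integral (cdens ?M h) (\<lambda>x. indicator E x * complex_of_real (\<omega> x))"
        using True h(3) by (simp add: times_measure_def)
      also have "\<dots> = (\<integral>x. h x * (indicator E x * complex_of_real (\<omega> x)) \<partial>?M)"
        by (rule cmeas_integral_cdens[OF sets_total_var ih _ iE]) (use True in measurable)
      also have "\<dots> = cdens ?M (\<lambda>x. h x * complex_of_real (\<omega> x)) E"
        using True by (auto simp: cdens_def indicator_def intro!: Bochner_Integration.integral_cong)
      finally show ?thesis .
    qed (simp add: times_measure_def cdens_def)
  qed
  then show "complex_measure (times_measure \<omega> \<mu>)"
    "total_var (times_measure \<omega> \<mu>) = density ?M (\<lambda>x. ennreal (\<omega> x))"
    using complex_measure_cdens[OF sets_total_var ihw] total_var_cdens[OF sets_total_var fin ihw] h(2)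
    by (auto simp: norm_mult weight_nonneg)
qed

text \<open>The membership test for all constructions in M(G,\<omega>): regularity and integrability
  of \<omega> are inherited from a dominating positive measure.\<close>

lemma wmeasI_dominated:
  assumes \<mu>: "complex_measure \<mu>" and M: "radon M" and i: "integrable M \<omega>"
    and dom: "\<And>A. A \<in> sets borel \<Longrightarrow> ennreal (cmod (\<mu> A)) \<le> emeasure M A"
  shows "\<mu> \<in> wmeas_space \<omega>"
proof -
  note M' = radonD[OF M]
  have le: "emeasure (total_var \<mu>) E \<le> emeasure M E" for E
    by (rule total_var_le[OF \<mu> M'(1) dom])
  have R: "radon (total_var \<mu>)" by (rule radonI_dominated[OF M _ le]) simp
  have "(\<integral>\<^sup>+x. ennreal (\<omega> x) \<partial>total_var \<mu>) \<le> (\<integral>\<^sup>+x. ennreal (\<omega> x) \<partial>M)"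
    by (rule nn_integral_mono_emeasure[OF M'(1) sets_total_var le])
  then have i': "integrable (total_var \<mu>) \<omega>"
    using i M'(1) by (simp add: weight_integrable_iff less_le_trans le_less_trans)
  have "radon (total_var (times_measure \<omega> \<mu>))"
    unfolding total_var_times_measure(2)[OF \<mu> i'] by (rule radon_density[OF R i' weight_nonneg])
  then show ?thesis
    using \<mu> R i' total_var_times_measure(1)[OF \<mu> i'] by (auto simp: wmeas_space_def meas_space_def radon_def)
qed

lemma wmeas_norm_eq:
  assumes "\<mu> \<in> wmeas_space \<omega>"
  shows "ennreal (wmeas_norm \<omega> \<mu>) = (\<integral>\<^sup>+x. ennreal (\<omega> x) \<partial>total_var \<mu>)"
proof -
  note \<mu> = wmeasD[OF assms]
  have "ennreal (wmeas_norm \<omega> \<mu>) = ennreal (measure (density (total_var \<mu>) (\<lambda>x. ennreal (\<omega> x))) UNIV)"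
    by (simp add: wmeas_norm_def meas_norm_def total_var_times_measure(2)[OF \<mu>(1,3)])
  also have "\<dots> = emeasure (density (total_var \<mu>) (\<lambda>x. ennreal (\<omega> x))) UNIV"
    using radonD(2)[OF radon_density[OF \<mu>(2,3) weight_nonneg]]
    by (simp add: finite_measure.emeasure_eq_measure)
  also have "\<dots> = (\<integral>\<^sup>+x. ennreal (\<omega> x) \<partial>total_var \<mu>)"
    by (subst emeasure_density) (auto cong: measurable_cong_sets)
  finally show ?thesis .
qed

lemma wmeas_norm_nonneg: "0 \<le> wmeas_norm \<omega> \<mu>"
  by (simp add: wmeas_norm_def meas_norm_def)

lemma wmeas_norm_le:
  assumes "\<mu> \<in> wmeas_space \<omega>" "(\<integral>\<^sup>+x. ennreal (\<omega> x) \<partial>total_var \<mu>) \<le> ennreal c" "0 \<le> c"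
  shows "wmeas_norm \<omega> \<mu> \<le> c"
  using assms wmeas_norm_eq[OF assms(1)] by (metis ennreal_le_iff)

lemma wmeas_cdens:
  assumes M: "radon M" and h[measurable]: "h \<in> borel_measurable borel"
    and i: "(\<integral>\<^sup>+x. ennreal (cmod (h x) * \<omega> x) \<partial>M) < \<infinity>"
  shows "cdens M h \<in> wmeas_space \<omega>"
    "total_var (cdens M h) = density M (\<lambda>x. ennreal (cmod (h x)))"
    "ennreal (wmeas_norm \<omega> (cdens M h)) = (\<integral>\<^sup>+x. ennreal (cmod (h x) * \<omega> x) \<partial>M)"
proof -
  note M' = radonD[OF M]
  have hM[measurable]: "h \<in> borel_measurable M" "\<omega> \<in> borel_measurable M"
    using h M'(1) weight_measurable by (auto cong: measurable_cong_sets)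
  have "(\<integral>\<^sup>+x. ennreal (cmod (h x)) \<partial>M) \<le> (\<integral>\<^sup>+x. ennreal (cmod (h x) * \<omega> x) \<partial>M)"
    using weight_ge_1 by (intro nn_integral_mono ennreal_leI) (metis mult.right_neutral mult_left_mono norm_ge_zero)
  then have ih: "integrable M h"
    using i by (intro integrableI_bounded hM) auto
  show tv: "total_var (cdens M h) = density M (\<lambda>x. ennreal (cmod (h x)))"
    by (rule total_var_cdens[OF M'(1,2) ih])
  have R: "radon (density M (\<lambda>x. ennreal (cmod (h x))))"
    by (rule radon_density[OF M]) (use ih in auto)
  have I: "(\<integral>\<^sup>+x. ennreal (\<omega> x) \<partial>density M (\<lambda>x. ennreal (cmod (h x)))) = (\<integral>\<^sup>+x. ennreal (cmod (h x) * \<omega> x) \<partial>M)"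
    by (subst nn_integral_density) (auto simp: ennreal_mult weight_nonneg)
  have "integrable (density M (\<lambda>x. ennreal (cmod (h x)))) \<omega>"
    using M'(1) I i by (subst weight_integrable_iff) auto
  then show mem: "cdens M h \<in> wmeas_space \<omega>"
    using cmod_cdens_le[OF M'(1) ih]
    by (intro wmeasI_dominated[OF complex_measure_cdens[OF M'(1) ih] R]) auto
  show "ennreal (wmeas_norm \<omega> (cdens M h)) = (\<integral>\<^sup>+x. ennreal (cmod (h x) * \<omega> x) \<partial>M)"
    unfolding wmeas_norm_eq[OF mem] tv by (rule I)
qed

lemma wmeas_polar:
  assumes "\<mu> \<in> wmeas_space \<omega>"
  obtains h where "h \<in> borel_measurable borel" "\<And>x. cmod (h x) = 1" "\<mu> = cdens (total_var \<mu>) h"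
  using polar_decomposition[OF wmeasD(1,4)[OF assms]] by blast

lemma nn_integral_weight_finite:
  assumes "\<mu> \<in> wmeas_space \<omega>"
  shows "(\<integral>\<^sup>+x. ennreal (\<omega> x) \<partial>total_var \<mu>) < \<infinity>"
  using wmeas_norm_eq[OF assms, symmetric] by simp

lemma wmeas_zero: "(\<lambda>E. 0) \<in> wmeas_space \<omega>"
proof -
  have z: "cdens (point_measure_at 0) (\<lambda>_. 0) = (\<lambda>E::'a set. 0)" by (auto simp: cdens_def fun_eq_iff)
  show ?thesis
    using wmeas_cdens(1)[OF radon_point_measure_at[of 0], of "\<lambda>_. 0"] unfolding z by simp
qed

lemma wmeas_add:
  assumes \<mu>: "\<mu> \<in> wmeas_space \<omega>" and \<nu>: "\<nu> \<in> wmeas_space \<omega>"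
  shows "(\<lambda>E. \<mu> E + \<nu> E) \<in> wmeas_space \<omega>"
proof -
  note \<mu>' = wmeasD[OF \<mu>] and \<nu>' = wmeasD[OF \<nu>]
  obtain Q where Q: "radon Q" "\<And>A. emeasure Q A = emeasure (total_var \<mu>) A + emeasure (total_var \<nu>) A"
    "\<And>f. f \<in> borel_measurable borel \<Longrightarrow> (\<integral>\<^sup>+x. f x \<partial>Q) = (\<integral>\<^sup>+x. f x \<partial>total_var \<mu>) + (\<integral>\<^sup>+x. f x \<partial>total_var \<nu>)"
    using radon_add[OF \<mu>'(2) \<nu>'(2)] by metis
  show ?thesis
  proof (rule wmeasI_dominated[OF _ Q(1)])
    show "complex_measure (\<lambda>E. \<mu> E + \<nu> E)"
      using \<mu>'(1) \<nu>'(1) by (auto simp: complex_measure_def intro!: sums_add)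
    show "integrable Q \<omega>"
      using nn_integral_weight_finite[OF \<mu>] nn_integral_weight_finite[OF \<nu>] radonD(1)[OF Q(1)]
      by (subst weight_integrable_iff) (auto simp: Q(3) less_top)
    show "ennreal (cmod (\<mu> A + \<nu> A)) \<le> emeasure Q A" for A
    proof -
      have "ennreal (cmod (\<mu> A + \<nu> A)) \<le> ennreal (cmod (\<mu> A) + cmod (\<nu> A))"
        by (intro ennreal_leI norm_triangle_ineq)
      also have "\<dots> = ennreal (cmod (\<mu> A)) + ennreal (cmod (\<nu> A))" by simp
      also have "\<dots> \<le> emeasure Q A"
        unfolding Q(2) by (intro add_mono cmod_le_total_var \<mu>' \<nu>')
      finally show ?thesis .
    qed
  qed
qed

lemma wmeas_scale:
  assumes \<mu>: "\<mu> \<in> wmeas_space \<omega>"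
  shows "(\<lambda>E. c * \<mu> E) \<in> wmeas_space \<omega>" "wmeas_norm \<omega> (\<lambda>E. c * \<mu> E) = cmod c * wmeas_norm \<omega> \<mu>"
proof -
  note \<mu>' = wmeasD[OF \<mu>]
  obtain h where h: "h \<in> borel_measurable borel" "\<And>x. cmod (h x) = 1" "\<mu> = cdens (total_var \<mu>) h"
    using wmeas_polar[OF \<mu>] by blast
  have eq: "(\<lambda>E. c * \<mu> E) = cdens (total_var \<mu>) (\<lambda>x. c * h x)"
    by (subst h(3)) (auto simp: cdens_def fun_eq_iff mult_scaleR_right[symmetric] simp del: mult_scaleR_right)
  have I: "(\<integral>\<^sup>+x. ennreal (cmod (c * h x) * \<omega> x) \<partial>total_var \<mu>) = ennreal (cmod c) * (\<integral>\<^sup>+x. ennreal (\<omega> x) \<partial>total_var \<mu>)"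
    using h(2) by (subst nn_integral_cmult[symmetric]) (auto simp: norm_mult ennreal_mult weight_nonneg cong: measurable_cong_sets)
  note D = wmeas_cdens[OF \<mu>'(2), of "\<lambda>x. c * h x"]
  have fin: "(\<integral>\<^sup>+x. ennreal (cmod (c * h x) * \<omega> x) \<partial>total_var \<mu>) < \<infinity>"
    unfolding I using nn_integral_weight_finite[OF \<mu>] by (simp add: ennreal_mult_less_top)
  have m: "(\<lambda>x. c * h x) \<in> borel_measurable borel" using h by measurable
  show "(\<lambda>E. c * \<mu> E) \<in> wmeas_space \<omega>" unfolding eq by (rule D(1)[OF m fin])
  have "ennreal (wmeas_norm \<omega> (\<lambda>E. c * \<mu> E)) = ennreal (cmod c * wmeas_norm \<omega> \<mu>)"
    unfolding eq D(3)[OF m fin] I by (simp add: wmeas_norm_eq[OF \<mu>] ennreal_mult wmeas_norm_nonneg)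
  then show "wmeas_norm \<omega> (\<lambda>E. c * \<mu> E) = cmod c * wmeas_norm \<omega> \<mu>"
    by (simp add: wmeas_norm_nonneg)
qed

lemma wmeas_restr:
  assumes \<mu>: "\<mu> \<in> wmeas_space \<omega>" and B: "B \<in> sets borel"
  shows "restr B \<mu> \<in> wmeas_space \<omega>"
    "total_var (restr B \<mu>) = density (total_var \<mu>) (indicator B)"
    "ennreal (wmeas_norm \<omega> (restr B \<mu>)) = (\<integral>\<^sup>+x. indicator B x * ennreal (\<omega> x) \<partial>total_var \<mu>)"
proof -
  note \<mu>' = wmeasD[OF \<mu>]
  obtain h where h: "h \<in> borel_measurable borel" "\<And>x. cmod (h x) = 1" "\<mu> = cdens (total_var \<mu>) h"
    using wmeas_polar[OF \<mu>] by blast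
  have eq: "restr B \<mu> = cdens (total_var \<mu>) (\<lambda>x. indicator B x * h x)"
    by (subst h(3), subst restr_cdens[OF h(1) B]) simp
  have c: "ennreal (cmod (indicator B x * h x) * \<omega> x) = indicator B x * ennreal (\<omega> x)" 
    "ennreal (cmod (indicator B x * h x)) = indicator B x" for x
    using h(2) by (auto simp: indicator_def)
  have m: "(\<lambda>x. indicator B x * h x) \<in> borel_measurable borel" using h B by measurable
  note D = wmeas_cdens[OF \<mu>'(2) m, unfolded c]
  have "(\<integral>\<^sup>+x. indicator B x * ennreal (\<omega> x) \<partial>total_var \<mu>) \<le> (\<integral>\<^sup>+x. ennreal (\<omega> x) \<partial>total_var \<mu>)"
    by (intro nn_integral_mono) (auto simp: indicator_def)
  then have fin: "(\<integral>\<^sup>+x. indicator B x * ennreal (\<omega> x) \<partial>total_var \<mu>) < \<infinity>"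
    using nn_integral_weight_finite[OF \<mu>] by (rule le_less_trans)
  show "restr B \<mu> \<in> wmeas_space \<omega>"
    "total_var (restr B \<mu>) = density (total_var \<mu>) (indicator B)"
    "ennreal (wmeas_norm \<omega> (restr B \<mu>)) = (\<integral>\<^sup>+x. indicator B x * ennreal (\<omega> x) \<partial>total_var \<mu>)"
    unfolding eq using D[OF fin] by auto
qed

lemma emeasure_total_var_restr:
  assumes "\<mu> \<in> wmeas_space \<omega>" "B \<in> sets borel" "E \<in> sets borel"
  shows "emeasure (total_var (restr B \<mu>)) E = emeasure (total_var \<mu>) (B \<inter> E)"
  unfolding wmeas_restr(2)[OF assms(1,2)] using assms
  by (subst emeasure_density) (auto simp: indicator_inter_arith[symmetric] cong: measurable_cong_sets)

lemma restr_split: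
  assumes "\<mu> \<in> wmeas_space \<omega>" "B \<in> sets borel"
  shows "(\<lambda>E. restr B \<mu> E + restr (- B) \<mu> E) = \<mu>"
proof
  fix E
  note \<mu> = wmeasD(1)[OF assms(1)]
  show "restr B \<mu> E + restr (- B) \<mu> E = \<mu> E"
  proof (cases "E \<in> sets borel")
    case True
    have "\<mu> ((E \<inter> B) \<union> (E \<inter> - B)) = \<mu> (E \<inter> B) + \<mu> (E \<inter> - B)"
      by (rule complex_measure_Un[OF \<mu>]) (use True assms in auto)
    moreover have "(E \<inter> B) \<union> (E \<inter> - B) = E" by blast
    ultimately show ?thesis using True by (simp add: restr_def)
  next
    case False
    then show ?thesis using \<mu> by (simp add: restr_def complex_measure_def)
  qed
qed

text \<open>The norm is that of an L1 space. This additivity is what lets functionals with disjoint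
  supports be added without increasing the norm.\<close>

lemma wmeas_norm_split:
  assumes "\<mu> \<in> wmeas_space \<omega>" "B \<in> sets borel"
  shows "wmeas_norm \<omega> (restr B \<mu>) + wmeas_norm \<omega> (restr (- B) \<mu>) = wmeas_norm \<omega> \<mu>"
proof -
  have "ennreal (wmeas_norm \<omega> (restr B \<mu>) + wmeas_norm \<omega> (restr (- B) \<mu>))
      = (\<integral>\<^sup>+x. indicator B x * ennreal (\<omega> x) + indicator (- B) x * ennreal (\<omega> x) \<partial>total_var \<mu>)"
    using assms by (subst nn_integral_add)
      (auto simp: wmeas_restr(3)[symmetric] wmeas_norm_nonneg cong: measurable_cong_sets)
  also have "\<dots> = ennreal (wmeas_norm \<omega> \<mu>)"
    unfolding wmeas_norm_eq[OF assms(1)] by (intro nn_integral_cong) (auto simp: indicator_def)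
  finally show ?thesis by (metis ennreal_inj add_nonneg_nonneg wmeas_norm_nonneg)
qed

lemma wmeas_norm_restr_le:
  assumes "\<mu> \<in> wmeas_space \<omega>" "B \<in> sets borel"
  shows "wmeas_norm \<omega> (restr B \<mu>) \<le> wmeas_norm \<omega> \<mu>"
  using wmeas_norm_split[OF assms] wmeas_norm_nonneg[of "restr (- B) \<mu>"] by linarith

text \<open>Inner regularity of the weighted total variation at the whole space: the outer set of
  the sandwich must be \<open>UNIV\<close>.\<close>

lemma wmeas_tight:
  assumes \<mu>: "\<mu> \<in> wmeas_space \<omega>" and e: "0 < e"
  obtains K where "compact K" "wmeas_norm \<omega> (restr (- K) \<mu>) < e"
proof -
  note \<mu>' = wmeasD[OF \<mu>]
  have R: "radon (density (total_var \<mu>) (\<lambda>x. ennreal (\<omega> x)))"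
    by (rule radon_density[OF \<mu>'(2,3) weight_nonneg])
  obtain K U where KU: "compact K" "open U" "K \<subseteq> UNIV" "UNIV \<subseteq> U"
      "measure (density (total_var \<mu>) (\<lambda>x. ennreal (\<omega> x))) (U - K) < e"
    using radon_approx[OF R _ e, of UNIV] by auto
  have Kb: "- K \<in> sets borel" using compact_borel[OF KU(1)] by simp
  have "U - K = - K" using KU by auto
  have "ennreal (wmeas_norm \<omega> (restr (- K) \<mu>)) = emeasure (density (total_var \<mu>) (\<lambda>x. ennreal (\<omega> x))) (- K)"
    unfolding wmeas_restr(3)[OF \<mu> Kb] using Kb
    by (subst emeasure_density) (auto simp: mult.commute cong: measurable_cong_sets)
  also have "\<dots> = ennreal (measure (density (total_var \<mu>) (\<lambda>x. ennreal (\<omega> x))) (U - K))"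
    unfolding \<open>U - K = - K\<close> using radonD(2)[OF R] by (rule finite_measure.emeasure_eq_measure)
  also have "\<dots> < ennreal e" using KU by (simp add: ennreal_lessI e)
  finally have "wmeas_norm \<omega> (restr (- K) \<mu>) < e" by (simp add: ennreal_less_iff wmeas_norm_nonneg)
  then show ?thesis using that KU(1) by blast
qed

lemma wmeas_dirac:
  "dirac x \<in> wmeas_space \<omega>" "wmeas_norm \<omega> (dirac x) = \<omega> x"
  "total_var (dirac x) = point_measure_at (x::'a)"
proof -
  note D = wmeas_cdens[OF radon_point_measure_at[of x], of "\<lambda>_. 1"]
  have I: "(\<integral>\<^sup>+z. ennreal (cmod 1 * \<omega> z) \<partial>point_measure_at x) = ennreal (\<omega> x)"
    by (subst nn_integral_point_measure_at) auto
  show "dirac x \<in> wmeas_space \<omega>" unfolding dirac_eq_cdens using D(1) I by simp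
  show "total_var (dirac x) = point_measure_at x" unfolding dirac_eq_cdens using D(2) I by (simp add: density_1)
  show "wmeas_norm \<omega> (dirac x) = \<omega> x"
    unfolding dirac_eq_cdens using D(3) I by (simp add: wmeas_norm_nonneg weight_nonneg)
qed

end

section \<open>Convolution of complex measures\<close>

text \<open>The result for positive measures is applied to Re \<mu> + M and to \<open>M\<close>, and
  the two are subtracted.\<close>

lemma measurable_Re_translate:
  fixes M :: "'a::{topological_monoid_add, t2_space} measure"
  assumes M: "radon M" and \<mu>: "complex_measure \<mu>"
    and dom: "\<And>A. A \<in> sets borel \<Longrightarrow> cmod (\<mu> A) \<le> measure M A" and E: "E \<in> sets borel"
  shows "(\<lambda>y. Re (\<mu> ((\<lambda>x. x + y) -` E))) \<in> borel_measurable borel"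
proof -
  note M' = radonD[OF M]
  interpret finite_measure M by (rule M')
  obtain Q where Q: "sets Q = sets borel" "finite_measure Q"
    "\<And>E. E \<in> sets borel \<Longrightarrow> measure Q E = Re (\<mu> E) + measure M E"
    "\<And>E. E \<in> sets borel \<Longrightarrow> emeasure Q E = ennreal (Re (\<mu> E) + measure M E)"
    using shifted_measure[OF M'(1,2) \<mu> dom] by blast
  \<comment> \<open>\<open>P\<close> is twice \<open>M\<close>; it dominates \<open>Q\<close> and
    thereby makes it regular.\<close>
  obtain P where P: "radon P" "\<And>A. emeasure P A = emeasure M A + emeasure M A"
    using radon_add[OF M M] by metis
  have "radon Q"
  proof (rule radonI_dominated[OF P(1) Q(1)])
    fix A :: "'a set" assume A: "A \<in> sets borel"
    have "emeasure Q A \<le> ennreal (measure M A + measure M A)"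
      unfolding Q(4)[OF A] using dom[OF A] complex_Re_le_cmod[of "\<mu> A"] by (intro ennreal_leI) linarith
    also have "\<dots> = emeasure P A" by (subst ennreal_plus) (simp_all add: P(2) emeasure_eq_measure)
    finally show "emeasure Q A \<le> emeasure P A" .
  qed
  then have "(\<lambda>y. measure Q ((\<lambda>x. x + y) -` E)) \<in> borel_measurable borel"
    unfolding measure_def using measurable_translate_measure[OF _ E] by measurable
  moreover have "(\<lambda>y. measure M ((\<lambda>x. x + y) -` E)) \<in> borel_measurable borel"
    unfolding measure_def using measurable_translate_measure[OF M E] by measurable
  ultimately have "(\<lambda>y. measure Q ((\<lambda>x. x + y) -` E) - measure M ((\<lambda>x. x + y) -` E)) \<in> borel_measurable borel"
    by measurable
  then show ?thesis by (simp add: Q(3) E)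
qed

context
  fixes \<omega> :: "'a::{topological_group_add, t2_space} \<Rightarrow> real"
  assumes W: "weight \<omega>"
begin

lemma measurable_translate_wmeas:
  assumes \<mu>: "\<mu> \<in> wmeas_space \<omega>" and E: "E \<in> sets borel"
  shows "(\<lambda>y. \<mu> ((\<lambda>x. x + y) -` E)) \<in> borel_measurable borel"
proof -
  note \<mu>' = wmeasD[OF W \<mu>]
  have dom: "cmod (\<mu> A) \<le> measure (total_var \<mu>) A" for A
    using cmod_le_total_var[OF \<mu>'(1), of A] by (simp add: finite_measure.emeasure_eq_measure[OF \<mu>'(4)])
  have "complex_measure (\<lambda>E. - \<i> * \<mu> E)"
    using \<mu>'(1) unfolding complex_measure_def by (auto intro!: sums_mult sums_minus)
  then have "(\<lambda>y. Re (- \<i> * \<mu> ((\<lambda>x. x + y) -` E))) \<in> borel_measurable borel"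
    by (rule measurable_Re_translate[OF \<mu>'(2) _ _ E]) (use dom in \<open>simp add: norm_mult\<close>)
  then have "(\<lambda>y. Im (\<mu> ((\<lambda>x. x + y) -` E))) \<in> borel_measurable borel" by simp
  moreover have "(\<lambda>y. Re (\<mu> ((\<lambda>x. x + y) -` E))) \<in> borel_measurable borel"
    by (rule measurable_Re_translate[OF \<mu>'(2,1) dom E])
  ultimately show ?thesis by (simp add: borel_measurable_complex_iff)
qed

lemma cmod_wmeas_le:
  assumes \<mu>: "\<mu> \<in> wmeas_space \<omega>"
  shows "cmod (\<mu> A) \<le> measure (total_var \<mu>) UNIV"
proof -
  note \<mu>' = wmeasD[OF W \<mu>]
  have "cmod (\<mu> A) \<le> measure (total_var \<mu>) A"
    using cmod_le_total_var[OF \<mu>'(1), of A] by (simp add: finite_measure.emeasure_eq_measure[OF \<mu>'(4)])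
  also have "\<dots> \<le> measure (total_var \<mu>) (space (total_var \<mu>))"
    by (rule finite_measure.bounded_measure[OF \<mu>'(4)])
  finally show ?thesis by simp
qed

lemma integrable_mult_bounded:
  fixes f h :: "'a \<Rightarrow> complex"
  assumes M: "sets M = sets borel" and h: "integrable M h"
    and f: "f \<in> borel_measurable borel" "\<And>x. cmod (f x) \<le> B"
  shows "integrable M (\<lambda>x. h x * f x)"
proof (rule Bochner_Integration.integrable_bound[of M "\<lambda>x. B * h x"])
  have [measurable]: "h \<in> borel_measurable M" "f \<in> borel_measurable M"
    using h f M by (auto cong: measurable_cong_sets)
  show "(\<lambda>x. h x * f x) \<in> borel_measurable M" by measurable
  have "0 \<le> B" using f(2)[of undefined] norm_ge_zero order_trans by blast
  then show "AE x in M. cmod (h x * f x) \<le> cmod (B * h x)"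
    using f(2) by (auto simp: norm_mult mult.commute intro!: mult_right_mono)
qed (use h in auto)

section \<open>Integration against members of M(G,\<omega>) through polar densities\<close>

definition polar :: "('a set \<Rightarrow> complex) \<Rightarrow> ('a \<Rightarrow> complex) \<Rightarrow> bool" where
  "polar \<mu> h \<longleftrightarrow> h \<in> borel_measurable borel \<and> (\<forall>x. cmod (h x) = 1) \<and> \<mu> = cdens (total_var \<mu>) h"

lemma polarD:
  assumes "polar \<mu> h"
  shows "h \<in> borel_measurable borel" "cmod (h x) = 1" "\<mu> = cdens (total_var \<mu>) h"
  using assms by (auto simp: polar_def)

lemma polar_integral:
  assumes \<mu>: "\<mu> \<in> wmeas_space \<omega>" and p: "polar \<mu> h"
    and f: "f \<in> borel_measurable borel" "\<And>x. cmod (f x) \<le> B"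
  shows "integrable (total_var \<mu>) (\<lambda>x. h x * f x)"
    "cmeas_integral \<mu> f = (\<integral>x. h x * f x \<partial>total_var \<mu>)"
proof -
  note \<mu>' = wmeasD[OF W \<mu>] and h = polarD[OF p]
  have ih: "integrable (total_var \<mu>) h"
    using h by (intro finite_measure.integrable_const_bound[OF \<mu>'(4), of _ 1]) (auto cong: measurable_cong_sets)
  show I: "integrable (total_var \<mu>) (\<lambda>x. h x * f x)"
    by (rule integrable_mult_bounded[OF sets_total_var ih f])
  show "cmeas_integral \<mu> f = (\<integral>x. h x * f x \<partial>total_var \<mu>)"
    by (subst h(3)) (rule cmeas_integral_cdens[OF sets_total_var ih f(1) I])
qed

lemma polar_exists:
  assumes \<mu>: "\<mu> \<in> wmeas_space \<omega>"
  obtains h where "polar \<mu> h"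
  using wmeas_polar[OF W \<mu>] by (metis polar_def)

lemma cmeas_integral_add_fun:
  assumes \<mu>: "\<mu> \<in> wmeas_space \<omega>"
    and "f \<in> borel_measurable borel" "\<And>x. cmod (f x) \<le> B" "g \<in> borel_measurable borel" "\<And>x. cmod (g x) \<le> C"
  shows "cmeas_integral \<mu> (\<lambda>x. f x + g x) = cmeas_integral \<mu> f + cmeas_integral \<mu> g"
proof -
  obtain h where p: "polar \<mu> h" by (rule polar_exists[OF \<mu>])
  note h = polarD[OF p] polar_integral[OF \<mu> p]
  have m: "(\<lambda>x. f x + g x) \<in> borel_measurable borel" using assms by measurable
  have b: "cmod (f x + g x) \<le> B + C" for x
    using assms(3)[of x] assms(5)[of x] norm_triangle_ineq[of "f x" "g x"] by linarith
  show ?thesis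
    unfolding h(5)[OF m b] h(5)[OF assms(2,3)] h(5)[OF assms(4,5)] distrib_left
    using h(4)[OF assms(2,3)] h(4)[OF assms(4,5)] by (rule Bochner_Integration.integral_add)
qed

lemma cmeas_integral_scale_fun:
  assumes \<mu>: "\<mu> \<in> wmeas_space \<omega>"
    and "f \<in> borel_measurable borel" "\<And>x. cmod (f x) \<le> B"
  shows "cmeas_integral \<mu> (\<lambda>x. c * f x) = c * cmeas_integral \<mu> f"
proof -
  obtain h where p: "polar \<mu> h" by (rule polar_exists[OF \<mu>])
  note h = polarD[OF p] polar_integral[OF \<mu> p]
  have m: "(\<lambda>x. c * f x) \<in> borel_measurable borel" using assms by measurable
  have b: "cmod (c * f x) \<le> cmod c * B" for x
    using assms(3)[of x] by (simp add: norm_mult mult_left_mono)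
  show ?thesis
    unfolding h(5)[OF m b] h(5)[OF assms(2,3)]
    by (simp add: mult.left_commute[of _ c])
qed

text \<open>Polar densities of the two measures refer to different total variations. Over the common
  dominating measure \<open>Q\<close> their densities simply add.\<close>

lemma cmeas_integral_add_measure:
  assumes \<mu>: "\<mu> \<in> wmeas_space \<omega>" and \<nu>: "\<nu> \<in> wmeas_space \<omega>"
    and f: "f \<in> borel_measurable borel" "\<And>x. cmod (f x) \<le> B"
  shows "cmeas_integral (\<lambda>E. \<mu> E + \<nu> E) f = cmeas_integral \<mu> f + cmeas_integral \<nu> f"
proof -
  note \<mu>' = wmeasD[OF W \<mu>] and \<nu>' = wmeasD[OF W \<nu>]
  obtain Q where Q: "radon Q" "\<And>A. emeasure Q A = emeasure (total_var \<mu>) A + emeasure (total_var \<nu>) A"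
    using radon_add[OF \<mu>'(2) \<nu>'(2)] by metis
  note Q' = radonD[OF Q(1)]
  interpret Q: finite_measure Q by (rule Q')
  have "ennreal (cmod (\<mu> A)) \<le> emeasure Q A" "ennreal (cmod (\<nu> A)) \<le> emeasure Q A" for A
    unfolding Q(2) using cmod_le_total_var[OF \<mu>'(1), of A] cmod_le_total_var[OF \<nu>'(1), of A]
    by (auto intro: order_trans add_increasing add_increasing2)
  then have d: "cmod (\<mu> A) \<le> measure Q A" "cmod (\<nu> A) \<le> measure Q A" for A
    by (simp_all add: Q.emeasure_eq_measure)
  obtain h where h: "integrable Q h" "\<mu> = cdens Q h"
    using complex_Radon_Nikodym[OF Q'(1,2) \<mu>'(1) d(1)] by blast
  obtain k where k: "integrable Q k" "\<nu> = cdens Q k"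
    using complex_Radon_Nikodym[OF Q'(1,2) \<nu>'(1) d(2)] by blast
  have hk: "integrable Q (\<lambda>x. h x + k x)" using h k by simp
  have s: "(\<lambda>E. \<mu> E + \<nu> E) = cdens Q (\<lambda>x. h x + k x)"
    unfolding h(2) k(2) cdens_def using integrable_indicator_scaleR[OF Q'(1) h(1)] integrable_indicator_scaleR[OF Q'(1) k(1)]
    by (auto simp: fun_eq_iff scaleR_right_distrib)
  note ib = integrable_mult_bounded[OF Q'(1) _ f]
  show ?thesis
    unfolding s unfolding h(2) k(2)
    using cmeas_integral_cdens[OF Q'(1) hk f(1) ib[OF hk]] cmeas_integral_cdens[OF Q'(1) h(1) f(1) ib[OF h(1)]]
      cmeas_integral_cdens[OF Q'(1) k(1) f(1) ib[OF k(1)]] ib[OF h(1)] ib[OF k(1)]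
    by (simp add: distrib_right)
qed

lemma cmeas_integral_scale_measure:
  assumes \<mu>: "\<mu> \<in> wmeas_space \<omega>" and f: "f \<in> borel_measurable borel" "\<And>x. cmod (f x) \<le> B"
  shows "cmeas_integral (\<lambda>E. c * \<mu> E) f = c * cmeas_integral \<mu> f"
proof -
  note \<mu>' = wmeasD[OF W \<mu>]
  obtain h where p: "polar \<mu> h" by (rule polar_exists[OF \<mu>])
  note h = polarD[OF p] polar_integral[OF \<mu> p]
  have ih: "integrable (total_var \<mu>) (\<lambda>x. c * h x)" using h(4)[of "\<lambda>_. 1" 1] by simp
  have eq: "(\<lambda>E. c * \<mu> E) = cdens (total_var \<mu>) (\<lambda>x. c * h x)"
    by (subst h(3)) (auto simp: cdens_def fun_eq_iff mult_scaleR_right[symmetric] simp del: mult_scaleR_right)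
  show ?thesis
    unfolding eq h(5)[OF f]
    using cmeas_integral_cdens[OF sets_total_var ih f(1) integrable_mult_bounded[OF sets_total_var ih f]]
    by (simp add: mult.assoc)
qed

lemma cmod_cmeas_integral_le:
  assumes \<mu>: "\<mu> \<in> wmeas_space \<omega>" and f: "f \<in> borel_measurable borel" "\<And>x. cmod (f x) \<le> B"
  shows "ennreal (cmod (cmeas_integral \<mu> f)) \<le> (\<integral>\<^sup>+x. ennreal (cmod (f x)) \<partial>total_var \<mu>)"
proof -
  obtain h where p: "polar \<mu> h" by (rule polar_exists[OF \<mu>])
  note h = polarD[OF p] polar_integral[OF \<mu> p]
  show ?thesis
    unfolding h(5)[OF f] using integral_norm_bound_ennreal[OF h(4)[OF f]] by (simp add: norm_mult h(2))
qed

lemma conv_meas_eq: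
  assumes \<mu>: "\<mu> \<in> wmeas_space \<omega>" and E: "E \<in> sets borel"
  shows "conv_meas \<mu> \<nu> E = cmeas_integral \<nu> (\<lambda>y. \<mu> ((\<lambda>x. x + y) -` E))"
proof -
  obtain h where p: "polar \<mu> h" by (rule polar_exists[OF \<mu>])
  note h = polarD[OF p] polar_integral[OF \<mu> p]
  have "cmeas_integral \<mu> (\<lambda>x. indicator E (x + y)) = \<mu> ((\<lambda>x. x + y) -` E)" for y
  proof -
    have m: "(\<lambda>x. indicator E (x + y)) \<in> borel_measurable borel"
      by (rule measurable_compose[OF add_left_measurable]) (use E in simp)
    have "cmeas_integral \<mu> (\<lambda>x. indicator E (x + y)) = (\<integral>x. h x * indicator E (x + y) \<partial>total_var \<mu>)"
      by (rule h(5)[OF m, of 1]) (auto simp: indicator_def)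
    also have "\<dots> = cdens (total_var \<mu>) h ((\<lambda>x. x + y) -` E)"
      unfolding cdens_def using E by (auto simp: indicator_def intro!: Bochner_Integration.integral_cong)
    finally show ?thesis using h(3) by simp
  qed
  then show ?thesis using E by (simp add: conv_meas_def)
qed

lemma conv_meas_not_borel: "E \<notin> sets borel \<Longrightarrow> conv_meas \<mu> \<nu> E = 0"
  by (simp add: conv_meas_def)

text \<open>Convolution is dominated by the convolution of the total variations, which carries
  regularity and weight integrals over to complex measures.\<close>

lemma cmod_conv_meas_le:
  assumes \<mu>: "\<mu> \<in> wmeas_space \<omega>" and \<nu>: "\<nu> \<in> wmeas_space \<omega>" and E: "E \<in> sets borel"
  shows "ennreal (cmod (conv_meas \<mu> \<nu> E)) \<le> emeasure (mconv (total_var \<mu>) (total_var \<nu>)) E"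
proof -
  note \<mu>' = wmeasD[OF W \<mu>] and \<nu>' = wmeasD[OF W \<nu>]
  have "ennreal (cmod (conv_meas \<mu> \<nu> E)) \<le> (\<integral>\<^sup>+y. ennreal (cmod (\<mu> ((\<lambda>x. x + y) -` E))) \<partial>total_var \<nu>)"
    unfolding conv_meas_eq[OF \<mu> E]
    by (rule cmod_cmeas_integral_le[OF \<nu> measurable_translate_wmeas[OF \<mu> E] cmod_wmeas_le[OF \<mu>]])
  also have "\<dots> \<le> (\<integral>\<^sup>+y. emeasure (total_var \<mu>) ((\<lambda>x. x + y) -` E) \<partial>total_var \<nu>)"
    by (intro nn_integral_mono cmod_le_total_var \<mu>')
  also have "\<dots> = emeasure (mconv (total_var \<mu>) (total_var \<nu>)) E"
    by (rule emeasure_mconv[OF \<mu>'(2) \<nu>'(2) E, symmetric])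
  finally show ?thesis .
qed

lemma conv_meas_add_left:
  assumes "\<mu> \<in> wmeas_space \<omega>" "\<mu>' \<in> wmeas_space \<omega>" "\<nu> \<in> wmeas_space \<omega>"
  shows "conv_meas (\<lambda>E. \<mu> E + \<mu>' E) \<nu> = (\<lambda>E. conv_meas \<mu> \<nu> E + conv_meas \<mu>' \<nu> E)"
proof
  fix E
  show "conv_meas (\<lambda>E. \<mu> E + \<mu>' E) \<nu> E = conv_meas \<mu> \<nu> E + conv_meas \<mu>' \<nu> E"
  proof (cases "E \<in> sets borel")
    case True
    show ?thesis
      unfolding conv_meas_eq[OF wmeas_add[OF W assms(1,2)] True] conv_meas_eq[OF assms(1) True] conv_meas_eq[OF assms(2) True]
      by (rule cmeas_integral_add_fun[OF assms(3) measurable_translate_wmeas[OF assms(1) True] cmod_wmeas_le[OF assms(1)]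
          measurable_translate_wmeas[OF assms(2) True] cmod_wmeas_le[OF assms(2)]])
  qed (simp add: conv_meas_not_borel)
qed

lemma conv_meas_scale_left:
  assumes "\<mu> \<in> wmeas_space \<omega>" "\<nu> \<in> wmeas_space \<omega>"
  shows "conv_meas (\<lambda>E. c * \<mu> E) \<nu> = (\<lambda>E. c * conv_meas \<mu> \<nu> E)"
proof
  fix E
  show "conv_meas (\<lambda>E. c * \<mu> E) \<nu> E = c * conv_meas \<mu> \<nu> E"
  proof (cases "E \<in> sets borel")
    case True
    show ?thesis
      unfolding conv_meas_eq[OF wmeas_scale(1)[OF W assms(1)] True] conv_meas_eq[OF assms(1) True]
      by (rule cmeas_integral_scale_fun[OF assms(2) measurable_translate_wmeas[OF assms(1) True] cmod_wmeas_le[OF assms(1)]])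
  qed (simp add: conv_meas_not_borel)
qed

lemma conv_meas_add_right:
  assumes "\<mu> \<in> wmeas_space \<omega>" "\<nu> \<in> wmeas_space \<omega>" "\<nu>' \<in> wmeas_space \<omega>"
  shows "conv_meas \<mu> (\<lambda>E. \<nu> E + \<nu>' E) = (\<lambda>E. conv_meas \<mu> \<nu> E + conv_meas \<mu> \<nu>' E)"
proof
  fix E
  show "conv_meas \<mu> (\<lambda>E. \<nu> E + \<nu>' E) E = conv_meas \<mu> \<nu> E + conv_meas \<mu> \<nu>' E"
  proof (cases "E \<in> sets borel")
    case True
    show ?thesis
      unfolding conv_meas_eq[OF assms(1) True]
      by (rule cmeas_integral_add_measure[OF assms(2,3) measurable_translate_wmeas[OF assms(1) True] cmod_wmeas_le[OF assms(1)]])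
  qed (simp add: conv_meas_not_borel)
qed

lemma conv_meas_scale_right:
  assumes "\<mu> \<in> wmeas_space \<omega>" "\<nu> \<in> wmeas_space \<omega>"
  shows "conv_meas \<mu> (\<lambda>E. c * \<nu> E) = (\<lambda>E. c * conv_meas \<mu> \<nu> E)"
proof
  fix E
  show "conv_meas \<mu> (\<lambda>E. c * \<nu> E) E = c * conv_meas \<mu> \<nu> E"
  proof (cases "E \<in> sets borel")
    case True
    show ?thesis
      unfolding conv_meas_eq[OF assms(1) True]
      by (rule cmeas_integral_scale_measure[OF assms(2) measurable_translate_wmeas[OF assms(1) True] cmod_wmeas_le[OF assms(1)]])
  qed (simp add: conv_meas_not_borel)
qed

lemma conv_meas_dirac: "conv_meas (dirac x) (dirac y) = dirac (x + y :: 'a)"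
proof
  fix E
  show "conv_meas (dirac x) (dirac y) E = dirac (x + y) E"
  proof (cases "E \<in> sets borel")
    case True
    have cd: "dirac y = cdens (point_measure_at y) (\<lambda>_. 1)" by (rule dirac_eq_cdens)
    have m: "(\<lambda>y. dirac x ((\<lambda>x. x + y) -` E)) \<in> borel_measurable borel"
      by (rule measurable_translate_wmeas[OF wmeas_dirac(1)[OF W] True])
    have one: "integrable (point_measure_at y) (\<lambda>_. 1 :: complex)"
      by (rule finite_measure.integrable_const[OF radonD(2)[OF radon_point_measure_at]])
    have "integrable (point_measure_at y) (\<lambda>z. 1 * dirac x ((\<lambda>x. x + z) -` E))"
      by (rule integrable_mult_bounded[OF sets_point_measure_at one m, of 1]) (auto simp: dirac_def indicator_def)
    then have "conv_meas (dirac x) (dirac y) E = (\<integral>z. 1 * dirac x ((\<lambda>x. x + z) -` E) \<partial>point_measure_at y)"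
      unfolding conv_meas_eq[OF wmeas_dirac(1)[OF W] True] cd
      by (rule cmeas_integral_cdens[OF sets_point_measure_at one m])
    also have "\<dots> = dirac x ((\<lambda>x. x + y) -` E)"
      using m by (simp add: integral_point_measure_at)
    also have "\<dots> = dirac (x + y) E" using True by (simp add: dirac_def indicator_def)
    finally show ?thesis .
  qed (simp add: conv_meas_not_borel dirac_def)
qed

context
  assumes LC: "locally_compact_space (euclidean :: 'a topology)"
begin

text \<open>One estimate for two uses: \<open>c = 1\<close> on the whole group gives
  submultiplicativity of the norm, and a small \<open>c\<close> off a finite set gives the smallness
  behind Arens regularity.\<close>

lemma nn_integral_mconv_weight_le:
  assumes \<mu>: "\<mu> \<in> wmeas_space \<omega>" and \<nu>: "\<nu> \<in> wmeas_space \<omega>" and c: "0 \<le> c"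
    and A: "A \<in> sets borel" "B \<in> sets borel" and le: "\<And>x y. x \<in> A \<Longrightarrow> y \<in> B \<Longrightarrow> \<omega> (x + y) \<le> c * (\<omega> x * \<omega> y)"
  shows "(\<integral>\<^sup>+z. ennreal (\<omega> z) \<partial>mconv (total_var (restr A \<mu>)) (total_var (restr B \<nu>)))
    \<le> ennreal (c * (wmeas_norm \<omega> \<mu> * wmeas_norm \<omega> \<nu>))"
proof -
  note \<mu>' = wmeasD[OF W wmeas_restr(1)[OF W \<mu> A(1)]] and \<nu>' = wmeasD[OF W wmeas_restr(1)[OF W \<nu> A(2)]]
  have [measurable]: "\<omega> \<in> borel_measurable borel" by (rule weight_measurable[OF W])
  have tr: "(\<lambda>x. ennreal (\<omega> (x + y))) \<in> borel_measurable borel" for y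
    by (rule measurable_compose[OF add_left_measurable]) measurable
  have I: "(\<lambda>y. \<integral>\<^sup>+x. ennreal (\<omega> (x + y)) \<partial>total_var (restr A \<mu>)) \<in> borel_measurable borel"
    "(\<integral>\<^sup>+z. ennreal (\<omega> z) \<partial>mconv (total_var (restr A \<mu>)) (total_var (restr B \<nu>)))
     = (\<integral>\<^sup>+y. \<integral>\<^sup>+x. ennreal (\<omega> (x + y)) \<partial>total_var (restr A \<mu>) \<partial>total_var (restr B \<nu>))"
    using nn_integral_mconv[OF \<mu>'(2) \<nu>'(2), of "\<lambda>z. ennreal (\<omega> z)"] by auto
  have "(\<integral>\<^sup>+y. \<integral>\<^sup>+x. ennreal (\<omega> (x + y)) \<partial>total_var (restr A \<mu>) \<partial>total_var (restr B \<nu>))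
      = (\<integral>\<^sup>+y. indicator B y * (\<integral>\<^sup>+x. ennreal (\<omega> (x + y)) \<partial>total_var (restr A \<mu>)) \<partial>total_var \<nu>)"
    unfolding wmeas_restr(2)[OF W \<nu> A(2)] using I(1) A(2)
    by (subst nn_integral_density) (auto cong: measurable_cong_sets)
  also have "\<dots> \<le> (\<integral>\<^sup>+y. ennreal (c * wmeas_norm \<omega> \<mu>) * ennreal (\<omega> y) \<partial>total_var \<nu>)"
  proof (intro nn_integral_mono)
    fix y
    show "indicator B y * (\<integral>\<^sup>+x. ennreal (\<omega> (x + y)) \<partial>total_var (restr A \<mu>)) \<le> ennreal (c * wmeas_norm \<omega> \<mu>) * ennreal (\<omega> y)"
    proof (cases "y \<in> B")
      case True
      have "(\<integral>\<^sup>+x. ennreal (\<omega> (x + y)) \<partial>total_var (restr A \<mu>)) = (\<integral>\<^sup>+x. indicator A x * ennreal (\<omega> (x + y)) \<partial>total_var \<mu>)"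
        unfolding wmeas_restr(2)[OF W \<mu> A(1)] using tr[of y] A(1)
        by (subst nn_integral_density) (auto cong: measurable_cong_sets)
      also have "\<dots> \<le> (\<integral>\<^sup>+x. ennreal (c * \<omega> y) * ennreal (\<omega> x) \<partial>total_var \<mu>)"
      proof (intro nn_integral_mono)
        fix x
        show "indicator A x * ennreal (\<omega> (x + y)) \<le> ennreal (c * \<omega> y) * ennreal (\<omega> x)"
          using le[OF _ True, of x] c weight_nonneg[OF W]
          by (cases "x \<in> A") (auto simp: ennreal_mult[symmetric] mult_ac intro!: ennreal_leI)
      qed
      also have "\<dots> = ennreal (c * \<omega> y) * ennreal (wmeas_norm \<omega> \<mu>)"
        unfolding wmeas_norm_eq[OF W \<mu>] by (rule nn_integral_cmult) (auto cong: measurable_cong_sets)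
      also have "\<dots> = ennreal (c * wmeas_norm \<omega> \<mu>) * ennreal (\<omega> y)"
        using c weight_nonneg[OF W] wmeas_norm_nonneg[OF W] by (simp add: ennreal_mult[symmetric] mult_ac)
      finally show ?thesis using True by simp
    qed simp
  qed
  also have "\<dots> = ennreal (c * wmeas_norm \<omega> \<mu>) * ennreal (wmeas_norm \<omega> \<nu>)"
    unfolding wmeas_norm_eq[OF W \<nu>] by (rule nn_integral_cmult) (auto cong: measurable_cong_sets)
  also have "\<dots> = ennreal (c * (wmeas_norm \<omega> \<mu> * wmeas_norm \<omega> \<nu>))"
    using c wmeas_norm_nonneg[OF W] by (simp add: ennreal_mult[symmetric] mult_ac)
  finally show ?thesis unfolding I(2) .
qed

lemma restr_UNIV: "\<mu> \<in> wmeas_space \<omega> \<Longrightarrow> restr UNIV \<mu> = \<mu>"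
  using wmeasD(1)[OF W, of \<mu>] by (auto simp: restr_def complex_measure_def fun_eq_iff)

text \<open>Local compactness enters here, through regularity of the dominating measure
  \<open>mconv\<close>.\<close>

lemma wmeas_conv:
  assumes \<mu>: "\<mu> \<in> wmeas_space \<omega>" and \<nu>: "\<nu> \<in> wmeas_space \<omega>"
  shows "conv_meas \<mu> \<nu> \<in> wmeas_space \<omega>"
    "\<And>E. emeasure (total_var (conv_meas \<mu> \<nu>)) E \<le> emeasure (mconv (total_var \<mu>) (total_var \<nu>)) E"
proof -
  note \<mu>' = wmeasD[OF W \<mu>] and \<nu>' = wmeasD[OF W \<nu>]
  let ?R = "mconv (total_var \<mu>) (total_var \<nu>)"
  have R: "radon ?R" by (rule radon_mconv[OF \<mu>'(2) \<nu>'(2) LC])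
  have dom: "ennreal (cmod (conv_meas \<mu> \<nu> A)) \<le> emeasure ?R A" if "A \<in> sets borel" for A
    by (rule cmod_conv_meas_le[OF \<mu> \<nu> that])
  have cm: "complex_measure (conv_meas \<mu> \<nu>)"
  proof (rule complex_measure_of_dominated[OF radonD(2,1)[OF R]])
    fix A B :: "'a set" assume A: "A \<in> sets borel" "B \<in> sets borel" "A \<inter> B = {}"
    have AB: "A \<union> B \<in> sets borel" using A by auto
    have "\<mu> ((\<lambda>x. x + y) -` (A \<union> B)) = \<mu> ((\<lambda>x. x + y) -` A) + \<mu> ((\<lambda>x. x + y) -` B)" for y
      unfolding vimage_Un using A by (intro complex_measure_Un[OF \<mu>'(1)]) auto
    then show "conv_meas \<mu> \<nu> (A \<union> B) = conv_meas \<mu> \<nu> A + conv_meas \<mu> \<nu> B"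
      unfolding conv_meas_eq[OF \<mu> A(1)] conv_meas_eq[OF \<mu> A(2)] conv_meas_eq[OF \<mu> AB]
      using cmeas_integral_add_fun[OF \<nu> measurable_translate_wmeas[OF \<mu> A(1)] cmod_wmeas_le[OF \<mu>]
          measurable_translate_wmeas[OF \<mu> A(2)] cmod_wmeas_le[OF \<mu>]] by simp
  next
    fix A :: "'a set" assume "A \<in> sets borel"
    then show "cmod (conv_meas \<mu> \<nu> A) \<le> measure ?R A"
      using dom by (simp add: finite_measure.emeasure_eq_measure[OF radonD(2)[OF R]])
  qed (simp add: conv_meas_not_borel)
  show "emeasure (total_var (conv_meas \<mu> \<nu>)) E \<le> emeasure ?R E" for E
    by (rule total_var_le[OF cm sets_mconv dom])
  have "(\<integral>\<^sup>+z. ennreal (\<omega> z) \<partial>?R) \<le> ennreal (1 * (wmeas_norm \<omega> \<mu> * wmeas_norm \<omega> \<nu>))"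
    using nn_integral_mconv_weight_le[OF \<mu> \<nu>, of 1 UNIV UNIV] weight_mult[OF W] by (simp add: restr_UNIV \<mu> \<nu>)
  then have "integrable ?R \<omega>"
    by (subst weight_integrable_iff[OF W sets_mconv]) (auto intro: le_less_trans)
  then show "conv_meas \<mu> \<nu> \<in> wmeas_space \<omega>"
    by (rule wmeasI_dominated[OF W cm R _ dom])
qed

lemma wmeas_norm_conv_restr_le:
  assumes \<mu>: "\<mu> \<in> wmeas_space \<omega>" and \<nu>: "\<nu> \<in> wmeas_space \<omega>" and c: "0 \<le> c"
    and A: "A \<in> sets borel" "B \<in> sets borel" and le: "\<And>x y. x \<in> A \<Longrightarrow> y \<in> B \<Longrightarrow> \<omega> (x + y) \<le> c * (\<omega> x * \<omega> y)"
  shows "wmeas_norm \<omega> (conv_meas (restr A \<mu>) (restr B \<nu>)) \<le> c * (wmeas_norm \<omega> \<mu> * wmeas_norm \<omega> \<nu>)"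
proof -
  note C = wmeas_conv[OF wmeas_restr(1)[OF W \<mu> A(1)] wmeas_restr(1)[OF W \<nu> A(2)]]
  show ?thesis
  proof (rule wmeas_norm_le[OF W C(1)])
    have "(\<integral>\<^sup>+z. ennreal (\<omega> z) \<partial>total_var (conv_meas (restr A \<mu>) (restr B \<nu>)))
        \<le> (\<integral>\<^sup>+z. ennreal (\<omega> z) \<partial>mconv (total_var (restr A \<mu>)) (total_var (restr B \<nu>)))"
      by (rule nn_integral_mono_emeasure[OF sets_mconv sets_total_var C(2)])
    also have "\<dots> \<le> ennreal (c * (wmeas_norm \<omega> \<mu> * wmeas_norm \<omega> \<nu>))"
      by (rule nn_integral_mconv_weight_le[OF assms])
    finally show "(\<integral>\<^sup>+z. ennreal (\<omega> z) \<partial>total_var (conv_meas (restr A \<mu>) (restr B \<nu>)))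
      \<le> ennreal (c * (wmeas_norm \<omega> \<mu> * wmeas_norm \<omega> \<nu>))" .
  qed (use c wmeas_norm_nonneg[OF W] in auto)
qed

lemma wmeas_norm_conv_le:
  assumes "\<mu> \<in> wmeas_space \<omega>" "\<nu> \<in> wmeas_space \<omega>"
  shows "wmeas_norm \<omega> (conv_meas \<mu> \<nu>) \<le> wmeas_norm \<omega> \<mu> * wmeas_norm \<omega> \<nu>"
  using wmeas_norm_conv_restr_le[OF assms, of 1 UNIV UNIV] weight_mult[OF W] assms by (simp add: restr_UNIV)

text \<open>If \<open>y\<close> is in \<open>K1\<close> and \<open>x + y\<close> in
  \<open>K0\<close>, then \<open>x\<close> is in the compact difference set. So a measure that
  misses this set misses \<open>K0\<close> after convolution; this produces compact sets for
  functionals vanishing at infinity.\<close>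

lemma total_var_conv_null_left:
  assumes \<mu>: "\<mu> \<in> wmeas_space \<omega>" and \<nu>: "\<nu> \<in> wmeas_space \<omega>" and K: "compact K0" "compact K1"
    and null: "emeasure (total_var \<mu>) ((\<lambda>(a, b). a - b) ` (K0 \<times> K1)) = 0"
  shows "emeasure (total_var (conv_meas \<mu> (restr K1 \<nu>))) K0 = 0"
proof -
  note Kb = compact_borel[OF K(1)] compact_borel[OF K(2)]
  note r = wmeas_restr[OF W \<nu> Kb(2)]
  note \<mu>' = wmeasD[OF W \<mu>]
  have cD: "compact ((\<lambda>(a, b). a - b) ` (K0 \<times> K1))"
    using K by (intro compact_continuous_image compact_Times)
      (auto intro!: continuous_intros simp: split_beta diff_conv_add_uminus simp del: add_uminus_conv_diff)
  have m: "(\<lambda>y. emeasure (total_var \<mu>) ((\<lambda>x. x + y) -` K0)) \<in> borel_measurable borel"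
    by (rule measurable_translate_measure[OF \<mu>'(2) Kb(1)])
  have "emeasure (total_var (conv_meas \<mu> (restr K1 \<nu>))) K0
      \<le> (\<integral>\<^sup>+y. emeasure (total_var \<mu>) ((\<lambda>x. x + y) -` K0) \<partial>total_var (restr K1 \<nu>))"
    using wmeas_conv(2)[OF \<mu> r(1), of K0] emeasure_mconv[OF \<mu>'(2) wmeasD(2)[OF W r(1)] Kb(1)] by simp
  also have "\<dots> = (\<integral>\<^sup>+y. indicator K1 y * emeasure (total_var \<mu>) ((\<lambda>x. x + y) -` K0) \<partial>total_var \<nu>)"
    unfolding r(2) using m Kb by (subst nn_integral_density) (auto cong: measurable_cong_sets)
  also have "\<dots> = (\<integral>\<^sup>+y. 0 \<partial>total_var \<nu>)"
  proof (intro nn_integral_cong)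
    fix y
    have "emeasure (total_var \<mu>) ((\<lambda>x. x + y) -` K0) = 0" if "y \<in> K1"
    proof -
      have "(\<lambda>x. x + y) -` K0 \<subseteq> (\<lambda>(a, b). a - b) ` (K0 \<times> K1)"
      proof
        fix x assume "x \<in> (\<lambda>x. x + y) -` K0"
        then have "(x + y, y) \<in> K0 \<times> K1" using that by simp
        moreover have "x = (x + y) - y" by simp
        ultimately show "x \<in> (\<lambda>(a, b). a - b) ` (K0 \<times> K1)" by (metis (no_types, lifting) case_prod_conv image_eqI)
      qed
      then have "emeasure (total_var \<mu>) ((\<lambda>x. x + y) -` K0) \<le> emeasure (total_var \<mu>) ((\<lambda>(a, b). a - b) ` (K0 \<times> K1))"
        using compact_borel[OF cD] by (intro emeasure_mono) auto
      then show ?thesis using null by simp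
    qed
    then show "indicator K1 y * emeasure (total_var \<mu>) ((\<lambda>x. x + y) -` K0) = 0" by (auto simp: indicator_def)
  qed
  finally show ?thesis by simp
qed

text \<open>The mirror image, in which the left factor is confined to \<open>K1\<close>. The group
  need not be commutative, so the compact set now consists of the elements -b + a.\<close>

lemma total_var_conv_null_right:
  assumes \<mu>: "\<mu> \<in> wmeas_space \<omega>" and \<nu>: "\<nu> \<in> wmeas_space \<omega>" and K: "compact K0" "compact K1"
    and null: "emeasure (total_var \<nu>) ((\<lambda>(a, b). - b + a) ` (K0 \<times> K1)) = 0"
  shows "emeasure (total_var (conv_meas (restr K1 \<mu>) \<nu>)) K0 = 0"
proof -
  note Kb = compact_borel[OF K(1)] compact_borel[OF K(2)]
  note r = wmeas_restr[OF W \<mu> Kb(2)]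
  note \<nu>' = wmeasD[OF W \<nu>]
  let ?D = "(\<lambda>(a, b). - b + a) ` (K0 \<times> K1)"
  have cD: "compact ?D"
    using K by (intro compact_continuous_image compact_Times)
      (auto intro!: continuous_intros simp: split_beta)
  have "emeasure (total_var (conv_meas (restr K1 \<mu>) \<nu>)) K0
      \<le> (\<integral>\<^sup>+y. emeasure (total_var (restr K1 \<mu>)) ((\<lambda>x. x + y) -` K0) \<partial>total_var \<nu>)"
    using wmeas_conv(2)[OF r(1) \<nu>, of K0] emeasure_mconv[OF wmeasD(2)[OF W r(1)] \<nu>'(2) Kb(1)] by simp
  also have "\<dots> = (\<integral>\<^sup>+y. 0 \<partial>total_var \<nu>)"
  proof (rule nn_integral_cong_AE)
    have "?D \<in> null_sets (total_var \<nu>)" using null compact_borel[OF cD] by (simp add: null_sets_def)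
    then have "AE y in total_var \<nu>. y \<notin> ?D" by (rule AE_not_in)
    then show "AE y in total_var \<nu>. emeasure (total_var (restr K1 \<mu>)) ((\<lambda>x. x + y) -` K0) = 0"
    proof eventually_elim
      case (elim y)
      have "K1 \<inter> (\<lambda>x. x + y) -` K0 = {}"
      proof (rule ccontr)
        assume "\<not> ?thesis"
        then obtain b where "b \<in> K1" "b + y \<in> K0" by auto
        then have "- b + (b + y) \<in> ?D" by (intro image_eqI[of _ _ "(b + y, b)"]) auto
        then show False using elim by (simp add: add.assoc[symmetric])
      qed
      then show ?case using emeasure_total_var_restr[OF W \<mu> Kb(2) translate_borel[OF Kb(1)], of y] by simp
    qed
  qed
  finally show ?thesis by simp
qed

end

end

section \<open>Duals of normed spaces of functions\<close>

lemma dual_spaceD: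
  assumes "f \<in> dual_space X N"
  shows "x \<in> X \<Longrightarrow> y \<in> X \<Longrightarrow> f (\<lambda>i. x i + y i) = f x + f y"
    "x \<in> X \<Longrightarrow> f (\<lambda>i. c * x i) = c * f x"
    "x \<notin> X \<Longrightarrow> f x = 0"
  using assms by (auto simp: dual_space_def)

lemma dual_spaceI:
  assumes "\<And>x y. x \<in> X \<Longrightarrow> y \<in> X \<Longrightarrow> f (\<lambda>i. x i + y i) = f x + f y"
    "\<And>c x. x \<in> X \<Longrightarrow> f (\<lambda>i. c * x i) = c * f x"
    "\<And>x. x \<in> X \<Longrightarrow> cmod (f x) \<le> B * N x"
    "\<And>x. x \<notin> X \<Longrightarrow> f x = 0"
  shows "f \<in> dual_space X N"
  using assms unfolding dual_space_def by blast

text \<open>The axioms pass to the dual (\<open>dual_nspace\<close>), so one theory serves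
  M(G,\<omega>), M_*(G,\<omega>), its dual and the duals beyond it.\<close>

locale nspace =
  fixes X :: "('i \<Rightarrow> complex) set" and N :: "('i \<Rightarrow> complex) \<Rightarrow> real"
  assumes zero: "(\<lambda>i. 0) \<in> X"
    and add: "\<And>x y. x \<in> X \<Longrightarrow> y \<in> X \<Longrightarrow> (\<lambda>i. x i + y i) \<in> X"
    and scale: "\<And>c x. x \<in> X \<Longrightarrow> (\<lambda>i. c * x i) \<in> X"
    and norm_nonneg: "\<And>x. x \<in> X \<Longrightarrow> 0 \<le> N x"
    and norm_scale: "\<And>c x. x \<in> X \<Longrightarrow> N (\<lambda>i. c * x i) = cmod c * N x"
begin

abbreviation "D \<equiv> dual_space X N"
abbreviation "dn \<equiv> dual_norm X N"

lemma norm_zero: "N (\<lambda>i. 0) = 0"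
  using norm_scale[OF zero, of 0] by simp

lemma subspace:
  assumes "Y \<subseteq> X" "(\<lambda>i. 0) \<in> Y" "\<And>x y. x \<in> Y \<Longrightarrow> y \<in> Y \<Longrightarrow> (\<lambda>i. x i + y i) \<in> Y"
    "\<And>c x. x \<in> Y \<Longrightarrow> (\<lambda>i. c * x i) \<in> Y"
  shows "nspace Y N"
  using assms norm_nonneg norm_scale by unfold_locales auto

lemma dual_zero: "f \<in> D \<Longrightarrow> f (\<lambda>i. 0) = 0"
  using dual_spaceD(2)[OF _ zero, of f N 0] by simp

lemma dual_bdd:
  assumes f: "f \<in> D"
  shows "bdd_above ((\<lambda>x. cmod (f x)) ` {x \<in> X. N x \<le> 1})"
proof -
  obtain B where "\<forall>x\<in>X. cmod (f x) \<le> B * N x" using f by (auto simp: dual_space_def)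
  then have B: "\<And>x. x \<in> X \<Longrightarrow> cmod (f x) \<le> B * N x" by blast
  have "cmod (f x) \<le> \<bar>B\<bar>" if "x \<in> X" "N x \<le> 1" for x
  proof -
    have "B * N x \<le> \<bar>B\<bar> * N x" using norm_nonneg[OF that(1)] by (intro mult_right_mono) auto
    also have "\<dots> \<le> \<bar>B\<bar> * 1" using that by (intro mult_left_mono) auto
    finally show ?thesis using B[OF that(1)] by simp
  qed
  then show ?thesis by (auto intro!: bdd_aboveI)
qed

text \<open>A vector is scaled to norm 1, where the supremum applies. If its norm is 0, any bound
  from \<open>dual_space\<close> forces the value 0.\<close>

lemma dual_bound:
  assumes f: "f \<in> D" and x: "x \<in> X"
  shows "cmod (f x) \<le> dn f * N x"
proof (cases "N x = 0")
  case True
  obtain B where "\<forall>x\<in>X. cmod (f x) \<le> B * N x" using f by (auto simp: dual_space_def)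
  then have "cmod (f x) \<le> B * N x" using x by blast
  then show ?thesis using True by simp
next
  case False
  then have pos: "0 < N x" using norm_nonneg[OF x] by simp
  define c where "c = complex_of_real (1 / N x)"
  have nc: "cmod c = 1 / N x" using pos by (simp add: c_def norm_divide)
  then have "N (\<lambda>i. c * x i) = 1" using pos norm_scale[OF x, of c] by simp
  then have "cmod (f (\<lambda>i. c * x i)) \<le> dn f"
    unfolding dual_norm_def using scale[OF x] by (intro cSUP_upper[OF _ dual_bdd[OF f]]) auto
  then have "cmod (f x) / N x \<le> dn f"
    by (simp add: dual_spaceD(2)[OF f x] norm_mult nc)
  then show ?thesis using pos by (simp add: pos_divide_le_eq)
qed

lemma dual_norm_le:
  assumes "0 \<le> B" "\<And>x. x \<in> X \<Longrightarrow> cmod (f x) \<le> B * N x"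
  shows "dn f \<le> B"
  unfolding dual_norm_def
proof (rule cSUP_least)
  show "{x \<in> X. N x \<le> 1} \<noteq> {}" using zero norm_zero by auto
  fix x assume x: "x \<in> {x \<in> X. N x \<le> 1}"
  then have "cmod (f x) \<le> B * N x" using assms by auto
  also have "\<dots> \<le> B * 1" using x assms(1) by (intro mult_left_mono) auto
  finally show "cmod (f x) \<le> B" by simp
qed

lemma dual_norm_nonneg: "f \<in> D \<Longrightarrow> 0 \<le> dn f"
  unfolding dual_norm_def using zero norm_zero dual_zero
  by (intro cSUP_upper2[of _ _ "\<lambda>i. 0"] dual_bdd) auto

lemma dual_add: "f \<in> D \<Longrightarrow> g \<in> D \<Longrightarrow> (\<lambda>x. f x + g x) \<in> D"
proof (rule dual_spaceI[where B = "dn f + dn g"])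
  fix x assume "f \<in> D" "g \<in> D" "x \<in> X"
  then show "cmod (f x + g x) \<le> (dn f + dn g) * N x"
    using dual_bound[of f x] dual_bound[of g x] norm_triangle_ineq[of "f x" "g x"] by (simp add: distrib_right)
qed (auto simp: dual_spaceD algebra_simps)

lemma dual_scale: "f \<in> D \<Longrightarrow> (\<lambda>x. c * f x) \<in> D"
proof (rule dual_spaceI[where B = "cmod c * dn f"])
  fix x assume "f \<in> D" "x \<in> X"
  then show "cmod (c * f x) \<le> cmod c * dn f * N x"
    using dual_bound[of f x] by (simp add: norm_mult mult.assoc mult_left_mono)
qed (auto simp: dual_spaceD algebra_simps)

lemma dual_norm_scale_le: "f \<in> D \<Longrightarrow> dn (\<lambda>x. c * f x) \<le> cmod c * dn f"
  using dual_bound[of f] dual_norm_nonneg[of f]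
  by (intro dual_norm_le) (auto simp: norm_mult mult.assoc mult_left_mono)

lemma dual_nspace: "nspace D dn"
proof
  show "(\<lambda>i. 0) \<in> D" by (rule dual_spaceI[where B = 0]) auto
  show "dn (\<lambda>x. c * f x) = cmod c * dn f" if f: "f \<in> D" for c f
  proof (cases "c = 0")
    case True
    have "dn (\<lambda>x. 0) \<le> 0" by (rule dual_norm_le) auto
    moreover have "0 \<le> dn (\<lambda>x. 0)" by (rule dual_norm_nonneg) (rule dual_spaceI[where B = 0], auto)
    ultimately show ?thesis using True by simp
  next
    case False
    \<comment> \<open>The reverse inequality is the one already known, applied to the factor
      1/c.\<close>
    have "dn (\<lambda>x. (1 / c) * (c * f x)) \<le> cmod (1 / c) * dn (\<lambda>x. c * f x)"
      by (rule dual_norm_scale_le[OF dual_scale[OF f]])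
    then have "cmod c * dn f \<le> dn (\<lambda>x. c * f x)"
      using False by (simp add: norm_divide pos_le_divide_eq mult.commute)
    then show ?thesis using dual_norm_scale_le[OF f, of c] by simp
  qed
qed (use dual_add dual_scale dual_norm_nonneg in auto)

lemma sum_closed:
  assumes "finite F" "\<And>k. k \<in> F \<Longrightarrow> x k \<in> X"
  shows "(\<lambda>i. \<Sum>k\<in>F. c k * x k i) \<in> X"
  using assms by (induction F rule: finite_induct) (auto simp: zero intro!: add scale)

lemma dual_sum:
  assumes f: "f \<in> D" and "finite F" "\<And>k. k \<in> F \<Longrightarrow> x k \<in> X"
  shows "f (\<lambda>i. \<Sum>k\<in>F. c k * x k i) = (\<Sum>k\<in>F. c k * f (x k))"
  using assms(2,3)
proof (induction F rule: finite_induct)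
  case (insert a F)
  have "f (\<lambda>i. c a * x a i + (\<Sum>k\<in>F. c k * x k i)) = f (\<lambda>i. c a * x a i) + f (\<lambda>i. \<Sum>k\<in>F. c k * x k i)"
    by (rule dual_spaceD(1)[OF f scale[OF insert.prems] sum_closed[OF insert.hyps(1) insert.prems]]) auto
  then show ?case using insert by (simp add: dual_spaceD(2)[OF f])
qed (simp add: dual_zero[OF f])

lemma diff_closed: "x \<in> X \<Longrightarrow> y \<in> X \<Longrightarrow> (\<lambda>i. x i - y i) \<in> X"
  using add[of x "\<lambda>i. (- 1) * y i"] scale[of y "- 1"] by simp

lemma dual_diff:
  assumes f: "f \<in> D" and "x \<in> X" "y \<in> X"
  shows "f (\<lambda>i. x i - y i) = f x - f y"
  using dual_spaceD(1)[OF f assms(2) scale[OF assms(3), of "- 1"]] dual_spaceD(2)[OF f assms(3), of "- 1"] by simp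

text \<open>The canonical embedding into the bidual, set to 0 off \<open>D\<close> as
  \<open>dual_space\<close> demands.\<close>

definition eval :: "('i \<Rightarrow> complex) \<Rightarrow> (('i \<Rightarrow> complex) \<Rightarrow> complex) \<Rightarrow> complex" where
  "eval x = (\<lambda>g. if g \<in> D then g x else 0)"

lemma eval_bidual: "x \<in> X \<Longrightarrow> eval x \<in> dual_space D dn"
  unfolding eval_def
  by (rule dual_spaceI[where B = "N x"]) (use dual_bound dual_add dual_scale in \<open>auto simp: mult.commute\<close>)

lemma topspace_weak_star: "topspace (weak_star X N) = D"
  unfolding weak_star_def topology_generated_by_topspace using zero open_UNIV by blast

text \<open>Banach-Alaoglu for a bounded sequence: its evaluations lie in a product of discs, which
  is compact. \<open>closed\<close> refers to the product topology on all functions, so the cluster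
  point inherits every closed condition that holds eventually.\<close>

lemma bidual_cluster_point:
  assumes u: "\<And>n :: nat. u n \<in> X" "\<And>n. N (u n) \<le> C"
  obtains \<Phi> where "\<Phi> \<in> dual_space D dn"
    "\<And>S. closed S \<Longrightarrow> eventually (\<lambda>n. eval (u n) \<in> S) sequentially \<Longrightarrow> \<Phi> \<in> S"
proof -
  interpret DD: nspace D dn by (rule dual_nspace)
  \<comment> \<open>Radius 0 off \<open>D\<close>, where the evaluations vanish.\<close>
  define B where "B g = (if g \<in> D then dn g * C else 0)" for g
  define K where "K = PiE UNIV (\<lambda>g. cball (0::complex) (B g))"
  have "compactin (product_topology (\<lambda>g. euclidean) UNIV) K"
    unfolding K_def by (subst compactin_PiE) simp
  then have K: "compact K" by (simp add: euclidean_product_topology)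
  have inK: "eval (u n) \<in> K" for n
  proof -
    have "cmod (g (u n)) \<le> dn g * C" if "g \<in> D" for g
      using dual_bound[OF that u(1)] mult_left_mono[OF u(2) dual_norm_nonneg[OF that]] by (rule order_trans)
    then show ?thesis by (auto simp: K_def B_def eval_def)
  qed
  let ?F = "filtermap (\<lambda>n. eval (u n)) sequentially"
  have "?F \<noteq> bot" by (simp add: filtermap_bot_iff)
  moreover have "eventually (\<lambda>x. x \<in> K) ?F" using inK by (simp add: eventually_filtermap)
  ultimately obtain \<Phi> where \<Phi>: "inf (nhds \<Phi>) ?F \<noteq> bot"
    using K unfolding compact_filter by blast
  have cl: "\<Phi> \<in> S" if "closed S" "eventually (\<lambda>n. eval (u n) \<in> S) sequentially" for S
  proof (rule ccontr)
    assume "\<Phi> \<notin> S"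
    then have "eventually (\<lambda>x. x \<in> - S) (nhds \<Phi>)"
      using \<open>closed S\<close> by (intro eventually_nhds_in_open) (auto simp: open_Compl)
    moreover have "eventually (\<lambda>x. x \<in> S) ?F" using that by (simp add: eventually_filtermap)
    ultimately have "eventually (\<lambda>x. False) (inf (nhds \<Phi>) ?F)"
      unfolding eventually_inf by (intro exI[of _ "\<lambda>x. x \<in> - S"] exI[of _ "\<lambda>x. x \<in> S"]) auto
    then show False using \<Phi> by (simp add: trivial_limit_def)
  qed
  have ev: "continuous_on UNIV (\<lambda>\<Psi> :: (('i \<Rightarrow> complex) \<Rightarrow> complex) \<Rightarrow> complex. \<Psi> g)" for g
    by (rule continuous_on_product_coordinates)
  \<comment> \<open>Linearity, the norm bound and vanishing off \<open>D\<close> are each an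
    intersection of such closed conditions.\<close>
  have all: "\<Phi> \<in> S" if "closed S" "\<And>n. eval (u n) \<in> S" for S using cl that by simp
  have "\<Phi> \<in> dual_space D dn"
  proof (rule dual_spaceI[where B = C])
    fix g h assume gh: "g \<in> D" "h \<in> D"
    have "\<Phi> \<in> {\<Psi>. \<Psi> (\<lambda>i. g i + h i) = \<Psi> g + \<Psi> h}"
      by (rule all) (intro closed_Collect_eq continuous_intros ev, use dual_spaceD(1)[OF eval_bidual[OF u(1)] gh] in auto)
    then show "\<Phi> (\<lambda>i. g i + h i) = \<Phi> g + \<Phi> h" by simp
  next
    fix c g assume g: "g \<in> D"
    have "\<Phi> \<in> {\<Psi>. \<Psi> (\<lambda>i. c * g i) = c * \<Psi> g}"
      by (rule all) (intro closed_Collect_eq continuous_intros ev, use dual_spaceD(2)[OF eval_bidual[OF u(1)] g] in auto)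
    then show "\<Phi> (\<lambda>i. c * g i) = c * \<Phi> g" by simp
  next
    fix g assume g: "g \<in> D"
    have "\<Phi> \<in> {\<Psi>. cmod (\<Psi> g) \<le> C * dn g}"
    proof (rule all)
      show "closed {\<Psi>. cmod (\<Psi> g) \<le> C * dn g}" by (intro closed_Collect_le continuous_intros ev)
      show "eval (u n) \<in> {\<Psi>. cmod (\<Psi> g) \<le> C * dn g}" for n
        using dual_bound[OF g u(1), of n] mult_left_mono[OF u(2) dual_norm_nonneg[OF g], of n] g
        by (simp add: eval_def mult.commute)
    qed
    then show "cmod (\<Phi> g) \<le> C * dn g" by simp
  next
    fix g assume "g \<notin> D"
    have "\<Phi> \<in> {\<Psi>. \<Psi> g = 0}"
      by (rule all) (intro closed_Collect_eq continuous_intros ev, use \<open>g \<notin> D\<close> in \<open>auto simp: eval_def\<close>)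
    then show "\<Phi> g = 0" by simp
  qed
  then show ?thesis using that cl by blast
qed

text \<open>Weak* open sets are locally traces of sets open in the product topology, in which the
  cluster points live.\<close>

lemma openin_weak_star:
  assumes "openin (weak_star X N) T" "\<Psi> \<in> T"
  obtains V where "open V" "\<Psi> \<in> V" "V \<inter> D \<subseteq> T"
proof -
  let ?G = "{{f \<in> D. f x \<in> U} |x U. x \<in> X \<and> open U}"
  have "generate_topology_on ?G T"
    using assms(1) by (simp add: weak_star_def openin_topology_generated_by_iff)
  then have "\<exists>V. open V \<and> \<Psi> \<in> V \<and> V \<inter> D \<subseteq> T" using assms(2)
  proof (induction arbitrary: \<Psi>)
    case Empty
    then show ?case by simp
  next
    case (Int a b)
    then have "\<Psi> \<in> a" "\<Psi> \<in> b" by auto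
    with Int.IH obtain V V' where "open V \<and> \<Psi> \<in> V \<and> V \<inter> D \<subseteq> a" "open V' \<and> \<Psi> \<in> V' \<and> V' \<inter> D \<subseteq> b"
      by meson
    then show ?case by (intro exI[of _ "V \<inter> V'"]) auto
  next
    case (UN K)
    then obtain k where k: "k \<in> K" "\<Psi> \<in> k" by blast
    then obtain V where "open V \<and> \<Psi> \<in> V \<and> V \<inter> D \<subseteq> k" using UN.IH k by meson
    then show ?case using k by (intro exI[of _ V]) auto
  next
    case (Basis s)
    then obtain x U where xU: "s = {f \<in> D. f x \<in> U}" "open U" by blast
    have "open ((\<lambda>f. f x) -` U)"
      by (rule open_vimage[OF xU(2) continuous_on_product_coordinates])
    then show ?case using xU Basis by (intro exI[of _ "(\<lambda>f. f x) -` U"]) auto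
  qed
  then show ?thesis using that by blast
qed

end

section \<open>Arens products and Arens regularity\<close>

locale nalg = nspace +
  fixes p
  assumes closed_p: "\<And>x y. x \<in> X \<Longrightarrow> y \<in> X \<Longrightarrow> p x y \<in> X"
    and addl: "\<And>x y z. x \<in> X \<Longrightarrow> y \<in> X \<Longrightarrow> z \<in> X \<Longrightarrow> p (\<lambda>i. x i + y i) z = (\<lambda>i. p x z i + p y z i)"
    and addr: "\<And>x y z. x \<in> X \<Longrightarrow> y \<in> X \<Longrightarrow> z \<in> X \<Longrightarrow> p z (\<lambda>i. x i + y i) = (\<lambda>i. p z x i + p z y i)"
    and scalel: "\<And>c x z. x \<in> X \<Longrightarrow> z \<in> X \<Longrightarrow> p (\<lambda>i. c * x i) z = (\<lambda>i. c * p x z i)"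
    and scaler: "\<And>c x z. x \<in> X \<Longrightarrow> z \<in> X \<Longrightarrow> p z (\<lambda>i. c * x i) = (\<lambda>i. c * p z x i)"
    and norm_p: "\<And>x y. x \<in> X \<Longrightarrow> y \<in> X \<Longrightarrow> N (p x y) \<le> N x * N y"
begin

abbreviation "DD \<equiv> dual_space D dn"
abbreviation "ddn \<equiv> dual_norm D dn"

text \<open>\<open>bidual_act\<close> for the reversed product is the action behind the second Arens
  product, so every estimate is proved once and used for both.\<close>

lemma opposite: "nalg X N (\<lambda>x y. p y x)"
proof -
  have "N (p y x) \<le> N x * N y" if "x \<in> X" "y \<in> X" for x y
    using norm_p[OF that(2,1)] by (simp add: mult.commute)
  then show ?thesis
    by unfold_locales (use closed_p addl addr scalel scaler in auto)
qed

lemma cmod_dual_p_le: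
  assumes "f \<in> D" "a \<in> X" "b \<in> X"
  shows "cmod (f (p a b)) \<le> dn f * N a * N b"
  using dual_bound[OF assms(1) closed_p[OF assms(2,3)]] mult_left_mono[OF norm_p[OF assms(2,3)] dual_norm_nonneg[OF assms(1)]]
  by (simp add: mult.assoc)

lemma fun_act_dual:
  assumes f: "f \<in> D" and a: "a \<in> X"
  shows "fun_act X p f a \<in> D" "dn (fun_act X p f a) \<le> dn f * N a"
proof -
  have b: "cmod (fun_act X p f a x) \<le> dn f * N a * N x" if "x \<in> X" for x
    using cmod_dual_p_le[OF f a that] that by (simp add: fun_act_def)
  show "fun_act X p f a \<in> D"
    by (rule dual_spaceI[OF _ _ b])
      (use a in \<open>auto simp: fun_act_def add scale addr scaler dual_spaceD(1,2)[OF f] closed_p\<close>)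
  show "dn (fun_act X p f a) \<le> dn f * N a"
    using dual_norm_nonneg[OF f] norm_nonneg[OF a] b by (intro dual_norm_le) auto
qed

lemma fun_act_add:
  assumes f: "f \<in> D" "a \<in> X" "b \<in> X"
  shows "fun_act X p f (\<lambda>i. a i + b i) = (\<lambda>x. fun_act X p f a x + fun_act X p f b x)"
  using assms by (auto simp: fun_act_def fun_eq_iff addl dual_spaceD(1)[OF f(1)] closed_p)

lemma fun_act_scale:
  assumes f: "f \<in> D" "a \<in> X"
  shows "fun_act X p f (\<lambda>i. c * a i) = (\<lambda>x. c * fun_act X p f a x)"
  using assms by (auto simp: fun_act_def fun_eq_iff scalel dual_spaceD(2)[OF f(1)] closed_p)

lemma bidual_act_dual:
  assumes \<Psi>: "\<Psi> \<in> DD" and f: "f \<in> D"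
  shows "bidual_act X p \<Psi> f \<in> D" "dn (bidual_act X p \<Psi> f) \<le> ddn \<Psi> * dn f"
proof -
  interpret d: nspace D dn by (rule dual_nspace)
  have b: "cmod (bidual_act X p \<Psi> f a) \<le> ddn \<Psi> * dn f * N a" if "a \<in> X" for a
  proof -
    have "cmod (bidual_act X p \<Psi> f a) \<le> ddn \<Psi> * dn (fun_act X p f a)"
      using d.dual_bound[OF \<Psi> fun_act_dual(1)[OF f that]] that by (simp add: bidual_act_def)
    also have "\<dots> \<le> ddn \<Psi> * (dn f * N a)"
      by (intro mult_left_mono fun_act_dual f that d.dual_norm_nonneg \<Psi>)
    finally show ?thesis by (simp add: mult.assoc)
  qed
  show "bidual_act X p \<Psi> f \<in> D"
    by (rule dual_spaceI[OF _ _ b])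
      (auto simp: bidual_act_def add scale fun_act_add[OF f] fun_act_scale[OF f] fun_act_dual(1)[OF f] dual_spaceD(1,2)[OF \<Psi>])
  show "dn (bidual_act X p \<Psi> f) \<le> ddn \<Psi> * dn f"
    using d.dual_norm_nonneg[OF \<Psi>] dual_norm_nonneg[OF f] b by (intro dual_norm_le) auto
qed

lemma arens_prod_bidual:
  assumes \<Phi>: "\<Phi> \<in> DD" and \<Psi>: "\<Psi> \<in> DD"
  shows "arens_prod X p D \<Phi> \<Psi> \<in> DD"
proof -
  interpret d: nspace D dn by (rule dual_nspace)
  have fadd: "fun_act X p (\<lambda>x. f x + g x) a = (\<lambda>x. fun_act X p f a x + fun_act X p g a x)" for f g a
    by (auto simp: fun_act_def)
  have fscale: "fun_act X p (\<lambda>x. c * f x) a = (\<lambda>x. c * fun_act X p f a x)" for c f a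
    by (auto simp: fun_act_def)
  have badd: "bidual_act X p \<Psi> (\<lambda>x. f x + g x) = (\<lambda>x. bidual_act X p \<Psi> f x + bidual_act X p \<Psi> g x)"
    if "f \<in> D" "g \<in> D" for f g
    using that by (auto simp: bidual_act_def fun_eq_iff fadd dual_spaceD(1)[OF \<Psi>] fun_act_dual)
  have bscale: "bidual_act X p \<Psi> (\<lambda>x. c * f x) = (\<lambda>x. c * bidual_act X p \<Psi> f x)" if "f \<in> D" for c f
    using that by (auto simp: bidual_act_def fun_eq_iff fscale dual_spaceD(2)[OF \<Psi>] fun_act_dual)
  show ?thesis
  proof (rule dual_spaceI[where B = "ddn \<Phi> * ddn \<Psi>"])
    fix f assume f: "f \<in> D"
    have "cmod (\<Phi> (bidual_act X p \<Psi> f)) \<le> ddn \<Phi> * dn (bidual_act X p \<Psi> f)"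
      by (rule d.dual_bound[OF \<Phi> bidual_act_dual(1)[OF \<Psi> f]])
    also have "\<dots> \<le> ddn \<Phi> * (ddn \<Psi> * dn f)"
      by (intro mult_left_mono bidual_act_dual \<Psi> f d.dual_norm_nonneg \<Phi>)
    finally show "cmod (arens_prod X p D \<Phi> \<Psi> f) \<le> ddn \<Phi> * ddn \<Psi> * dn f"
      using f by (simp add: arens_prod_def mult.assoc)
  qed (auto simp: arens_prod_def d.add d.scale badd bscale dual_spaceD(1,2)[OF \<Phi>] bidual_act_dual \<Psi>)
qed

text \<open>On a form of finite rank the Arens product is an explicit sum, symmetric in the roles of
  \<Phi> and \<Psi>. The error of the form passes through both functionals.\<close>

lemma arens_finite_rank_approx:
  assumes \<Phi>: "\<Phi> \<in> DD" and \<Psi>: "\<Psi> \<in> DD" and f: "f \<in> D" and F: "finite F"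
    and \<phi>: "\<And>k. k \<in> F \<Longrightarrow> \<phi> k \<in> D" and \<psi>: "\<And>k. k \<in> F \<Longrightarrow> \<psi> k \<in> D" and e: "0 \<le> e"
    and ap: "\<And>a b. a \<in> X \<Longrightarrow> b \<in> X \<Longrightarrow> cmod (f (p a b) - (\<Sum>k\<in>F. \<phi> k a * \<psi> k b)) \<le> e * N a * N b"
  shows "cmod (\<Phi> (bidual_act X p \<Psi> f) - (\<Sum>k\<in>F. \<Phi> (\<phi> k) * \<Psi> (\<psi> k))) \<le> e * ddn \<Phi> * ddn \<Psi>"
proof -
  interpret d: nspace D dn by (rule dual_nspace)
  note \<Phi>0 = d.dual_norm_nonneg[OF \<Phi>] and \<Psi>0 = d.dual_norm_nonneg[OF \<Psi>]
  \<comment> \<open>What \<open>bidual_act\<close> would be if the form were exactly the finite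
    sum.\<close>
  define g where "g = (\<lambda>a. \<Sum>k\<in>F. \<Psi> (\<psi> k) * \<phi> k a)"
  have g: "g \<in> D" unfolding g_def by (rule d.sum_closed[OF F \<phi>])
  have bd: "cmod (bidual_act X p \<Psi> f a - g a) \<le> e * ddn \<Psi> * N a" if a: "a \<in> X" for a
  proof -
    define k where "k = (\<lambda>b. \<Sum>j\<in>F. \<phi> j a * \<psi> j b)"
    have k: "k \<in> D" unfolding k_def by (rule d.sum_closed[OF F \<psi>])
    note fa = fun_act_dual(1)[OF f a]
    have "dn (\<lambda>b. fun_act X p f a b - k b) \<le> e * N a"
      using ap[OF a] e norm_nonneg[OF a] by (intro dual_norm_le) (auto simp: fun_act_def k_def)
    moreover have "g a = \<Psi> k"
      unfolding g_def k_def by (simp add: d.dual_sum[OF \<Psi> F \<psi>] mult.commute)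
    then have "bidual_act X p \<Psi> f a - g a = \<Psi> (\<lambda>b. fun_act X p f a b - k b)"
      using a by (simp add: bidual_act_def d.dual_diff[OF \<Psi> fa k])
    moreover have "cmod (\<Psi> (\<lambda>b. fun_act X p f a b - k b)) \<le> ddn \<Psi> * dn (\<lambda>b. fun_act X p f a b - k b)"
      by (rule d.dual_bound[OF \<Psi> d.diff_closed[OF fa k]])
    ultimately show ?thesis
      using mult_left_mono[of "dn (\<lambda>b. fun_act X p f a b - k b)" "e * N a" "ddn \<Psi>"] \<Psi>0
      by (simp add: mult_ac)
  qed
  note ba = bidual_act_dual(1)[OF \<Psi> f]
  have "dn (\<lambda>a. bidual_act X p \<Psi> f a - g a) \<le> e * ddn \<Psi>"
    using bd e \<Psi>0 by (intro dual_norm_le) auto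
  then have "ddn \<Phi> * dn (\<lambda>a. bidual_act X p \<Psi> f a - g a) \<le> ddn \<Phi> * (e * ddn \<Psi>)"
    using \<Phi>0 by (rule mult_left_mono)
  moreover have "cmod (\<Phi> (\<lambda>a. bidual_act X p \<Psi> f a - g a)) \<le> ddn \<Phi> * dn (\<lambda>a. bidual_act X p \<Psi> f a - g a)"
    by (rule d.dual_bound[OF \<Phi> d.diff_closed[OF ba g]])
  moreover have "\<Phi> g = (\<Sum>k\<in>F. \<Phi> (\<phi> k) * \<Psi> (\<psi> k))"
    unfolding g_def by (simp add: d.dual_sum[OF \<Phi> F \<phi>] mult.commute)
  ultimately show ?thesis by (simp add: d.dual_diff[OF \<Phi> ba g] mult_ac)
qed

text \<open>Once the two Arens products agree, \<Psi> enters through its value at a functional that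
  depends only on \<Phi> and \<open>f\<close>, and such evaluations are weak* continuous.\<close>

theorem arens_regularI:
  assumes ap: "\<And>f e. f \<in> D \<Longrightarrow> 0 < e \<Longrightarrow> \<exists>(F :: 'k set) \<phi> \<psi>. finite F \<and> (\<forall>k\<in>F. \<phi> k \<in> D \<and> \<psi> k \<in> D) \<and>
      (\<forall>a\<in>X. \<forall>b\<in>X. cmod (f (p a b) - (\<Sum>k\<in>F. \<phi> k a * \<psi> k b)) \<le> e * N a * N b)"
  shows "arens_regular X N p"
  unfolding arens_regular_def
proof
  interpret d: nspace D dn by (rule dual_nspace)
  interpret op: nalg X N "\<lambda>x y. p y x" by (rule opposite)
  fix \<Phi> assume \<Phi>: "\<Phi> \<in> DD"
  \<comment> \<open>Both sides are within a multiple of \<open>e\<close> of the same finite sum; the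
    right side by the estimate in the opposite algebra.\<close>
  have key: "\<Phi> (bidual_act X p \<Psi> f) = \<Psi> (bidual_act X (\<lambda>x y. p y x) \<Phi> f)"
    if \<Psi>: "\<Psi> \<in> DD" and f: "f \<in> D" for \<Psi> f
  proof -
    let ?x = "\<Phi> (bidual_act X p \<Psi> f)" and ?y = "\<Psi> (bidual_act X (\<lambda>x y. p y x) \<Phi> f)"
    define c where "c = 2 * ddn \<Phi> * ddn \<Psi>"
    have c0: "0 \<le> c" using d.dual_norm_nonneg[OF \<Phi>] d.dual_norm_nonneg[OF \<Psi>] by (simp add: c_def)
    have le: "cmod (?x - ?y) \<le> e * c" if e: "0 < e" for e
    proof -
      obtain F :: "'k set" and \<phi> \<psi> where F: "finite F" "\<And>k. k \<in> F \<Longrightarrow> \<phi> k \<in> D" "\<And>k. k \<in> F \<Longrightarrow> \<psi> k \<in> D"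
        "\<And>a b. a \<in> X \<Longrightarrow> b \<in> X \<Longrightarrow> cmod (f (p a b) - (\<Sum>k\<in>F. \<phi> k a * \<psi> k b)) \<le> e * N a * N b"
        using ap[OF f e] by blast
      have 1: "cmod (?x - (\<Sum>k\<in>F. \<Phi> (\<phi> k) * \<Psi> (\<psi> k))) \<le> e * ddn \<Phi> * ddn \<Psi>"
        using e by (intro arens_finite_rank_approx[OF \<Phi> \<Psi> f F(1,2,3) _ F(4)]) auto
      have "cmod (?y - (\<Sum>k\<in>F. \<Psi> (\<psi> k) * \<Phi> (\<phi> k))) \<le> e * ddn \<Psi> * ddn \<Phi>"
      proof (rule op.arens_finite_rank_approx[OF \<Psi> \<Phi> f F(1,3,2)])
        fix a b assume "a \<in> X" "b \<in> X"
        then show "cmod (f (p b a) - (\<Sum>k\<in>F. \<psi> k a * \<phi> k b)) \<le> e * N a * N b"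
          using F(4)[of b a] by (simp add: mult_ac)
      qed (use e in auto)
      then have 2: "cmod ((\<Sum>k\<in>F. \<Phi> (\<phi> k) * \<Psi> (\<psi> k)) - ?y) \<le> e * ddn \<Phi> * ddn \<Psi>"
        by (simp add: norm_minus_commute mult_ac)
      have "cmod (?x - ?y) \<le> cmod (?x - (\<Sum>k\<in>F. \<Phi> (\<phi> k) * \<Psi> (\<psi> k))) + cmod ((\<Sum>k\<in>F. \<Phi> (\<phi> k) * \<Psi> (\<psi> k)) - ?y)"
        using norm_triangle_ineq[of "?x - (\<Sum>k\<in>F. \<Phi> (\<phi> k) * \<Psi> (\<psi> k))" "(\<Sum>k\<in>F. \<Phi> (\<phi> k) * \<Psi> (\<psi> k)) - ?y"] by simp
      then show ?thesis using 1 2 by (simp add: c_def)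
    qed
    have "cmod (?x - ?y) \<le> 0"
    proof (rule field_le_epsilon)
      fix e :: real assume e: "0 < e"
      have "cmod (?x - ?y) \<le> e / (c + 1) * c" using c0 e by (intro le) auto
      also have "\<dots> \<le> e" using c0 e by (simp add: field_simps)
      finally show "cmod (?x - ?y) \<le> 0 + e" by simp
    qed
    then show ?thesis by simp
  qed
  have "continuous_map (weak_star D dn) (topology_generated_by {{F \<in> DD. F x \<in> U} |x U. x \<in> D \<and> open U})
      (arens_prod X p D \<Phi>)"
  proof (rule continuous_on_generated_topo)
    fix T assume "T \<in> {{F \<in> DD. F x \<in> U} |x U. x \<in> D \<and> open U}"
    then obtain f U where fU: "T = {F \<in> DD. F f \<in> U}" "f \<in> D" "open U" by blast
    have "arens_prod X p D \<Phi> -` T \<inter> topspace (weak_star D dn)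
        = {\<Psi> \<in> DD. \<Psi> (bidual_act X (\<lambda>x y. p y x) \<Phi> f) \<in> U}"
      using fU key arens_prod_bidual[OF \<Phi>] by (auto simp: d.topspace_weak_star arens_prod_def)
    then show "openin (weak_star D dn) (arens_prod X p D \<Phi> -` T \<inter> topspace (weak_star D dn))"
      unfolding weak_star_def using op.bidual_act_dual(1)[OF \<Phi> fU(2)] fU(3)
      by (auto intro!: topology_generated_by_Basis)
  next
    show "arens_prod X p D \<Phi> ` topspace (weak_star D dn) \<subseteq> \<Union> {{F \<in> DD. F x \<in> U} |x U. x \<in> D \<and> open U}"
      using arens_prod_bidual[OF \<Phi>] d.zero open_UNIV by (simp add: d.topspace_weak_star image_subset_iff) blast
  qed
  then show "continuous_map (weak_star D dn) (weak_star D dn) (arens_prod X p D \<Phi>)"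
    unfolding weak_star_def .
qed

text \<open>The two iterated limits of the array \<open>f (u n v m)\<close> are 1 and 0, and the two Arens products
  of cluster points of \<open>u\<close> and \<open>v\<close> would have to agree on \<open>f\<close>.\<close>

theorem not_arens_regularI:
  assumes f: "f \<in> D" and u: "\<And>n :: nat. u n \<in> X" "\<And>n. N (u n) \<le> C"
    and v: "\<And>n :: nat. v n \<in> X" "\<And>n. N (v n) \<le> C"
    and tri: "\<And>m n. f (p (u n) (v m)) = (if n < m then 1 else 0)"
  shows "\<not> arens_regular X N p"
proof
  assume reg: "arens_regular X N p"
  interpret d: nspace D dn by (rule dual_nspace)
  obtain \<Phi> where \<Phi>: "\<Phi> \<in> DD"
    "\<And>S. closed S \<Longrightarrow> eventually (\<lambda>n. eval (u n) \<in> S) sequentially \<Longrightarrow> \<Phi> \<in> S"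
    using bidual_cluster_point[of u C] u by blast
  obtain \<Psi> where \<Psi>: "\<Psi> \<in> DD"
    "\<And>S. closed S \<Longrightarrow> eventually (\<lambda>n. eval (v n) \<in> S) sequentially \<Longrightarrow> \<Psi> \<in> S"
    using bidual_cluster_point[of v C] v by blast
  have cl: "closed {F :: (('a \<Rightarrow> complex) \<Rightarrow> complex) \<Rightarrow> complex. F g = c}" for g c
    by (intro closed_Collect_eq continuous_on_product_coordinates continuous_intros)
  \<comment> \<open>The condition F(g) = c is closed, so eventually constant values pass to the
    cluster point; no convergence is involved.\<close>
  have \<Phi>c: "\<Phi> g = c" if "g \<in> D" "eventually (\<lambda>n. g (u n) = c) sequentially" for g c
    using \<Phi>(2)[OF cl[of g c]] that by (simp add: eval_def)
  have \<Psi>c: "\<Psi> g = c" if "g \<in> D" "eventually (\<lambda>n. g (v n) = c) sequentially" for g c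
    using \<Psi>(2)[OF cl[of g c]] that by (simp add: eval_def)
  have "bidual_act X p \<Psi> f (u n) = 1" for n
  proof -
    have "\<Psi> (fun_act X p f (u n)) = 1"
    proof (rule \<Psi>c[OF fun_act_dual(1)[OF f u(1)]])
      show "\<forall>\<^sub>F m in sequentially. fun_act X p f (u n) (v m) = 1"
        using eventually_gt_at_top[of n] by eventually_elim (simp add: fun_act_def v tri)
    qed
    then show ?thesis by (simp add: bidual_act_def u)
  qed
  then have one: "arens_prod X p D \<Phi> \<Psi> f = 1"
    using f by (simp add: arens_prod_def \<Phi>c[OF bidual_act_dual(1)[OF \<Psi>(1) f]])
  have zero: "arens_prod X p D \<Phi> (eval (v m)) f = 0" for m
  proof -
    have "\<Phi> (bidual_act X p (eval (v m)) f) = 0"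
    proof (rule \<Phi>c[OF bidual_act_dual(1)[OF eval_bidual[OF v(1)] f]])
      show "\<forall>\<^sub>F n in sequentially. bidual_act X p (eval (v m)) f (u n) = 0"
        using eventually_ge_at_top[of m]
        by eventually_elim (simp add: bidual_act_def eval_def fun_act_dual f u, simp add: fun_act_def v tri)
    qed
    then show ?thesis using f by (simp add: arens_prod_def)
  qed
  have cont: "continuous_map (weak_star D dn) (weak_star D dn) (arens_prod X p D \<Phi>)"
    using reg \<Phi>(1) by (auto simp: arens_regular_def)
  have "openin (weak_star D dn) {F \<in> DD. F f \<in> - {0}}"
    unfolding weak_star_def using f by (intro topology_generated_by_Basis) (auto intro!: exI[of _ "- {0}"] open_Compl)
  then have "openin (weak_star D dn) {x \<in> topspace (weak_star D dn). arens_prod X p D \<Phi> x \<in> {F \<in> DD. F f \<in> - {0}}}"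
    using cont by (rule openin_continuous_map_preimage[rotated])
  moreover have "\<Psi> \<in> {x \<in> topspace (weak_star D dn). arens_prod X p D \<Phi> x \<in> {F \<in> DD. F f \<in> - {0}}}"
    using \<Psi>(1) one arens_prod_bidual[OF \<Phi>(1) \<Psi>(1)] by (simp add: d.topspace_weak_star)
  ultimately obtain V where V: "open V" "\<Psi> \<in> V"
      "V \<inter> DD \<subseteq> {x \<in> topspace (weak_star D dn). arens_prod X p D \<Phi> x \<in> {F \<in> DD. F f \<in> - {0}}}"
    by (rule d.openin_weak_star)
  \<comment> \<open>On \<open>V\<close> the product with \<Phi> is nonzero at \<open>f\<close>, but
    it is 0 at every \<open>eval (v n)\<close>. So the whole sequence stays in the closed complement
    of \<open>V\<close>, and with it its cluster point \<Psi>.\<close>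
  have "eval (v n) \<notin> V" for n
    using V(3) eval_bidual[OF v(1), of n] zero[of n] by auto
  then have "\<Psi> \<in> - V" using V(1) by (intro \<Psi>(2)) (auto simp: closed_Compl)
  then show False using V(2) by simp
qed

end

section \<open>The space of functionals vanishing at infinity\<close>

lemma scaled_epsilon:
  fixes e c :: real
  assumes "0 < e" "0 \<le> c"
  shows "0 < e / (c + 1)" "c * (e / (c + 1)) \<le> e"
proof -
  have "0 < c + 1" using assms by linarith
  then show "0 < e / (c + 1)" "c * (e / (c + 1)) \<le> e"
    using assms by (auto simp: pos_divide_le_eq)
qed

lemma unit_phase: "\<exists>u. cmod u \<le> 1 \<and> u * z = complex_of_real (cmod z)"
proof (cases "z = 0")
  case False
  then show ?thesis
    by (intro exI[of _ "cnj z / complex_of_real (cmod z)"])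
      (simp add: norm_divide complex_norm_square[symmetric] mult.commute power2_eq_square)
qed (auto intro: exI[of _ 0])

locale weighted_group =
  fixes \<omega> :: "'a::{topological_group_add, t2_space} \<Rightarrow> real"
  assumes W: "weight \<omega>"
    and LC: "locally_compact_space (euclidean :: 'a topology)"
begin

abbreviation "X \<equiv> wmeas_space \<omega>"
abbreviation "N \<equiv> wmeas_norm \<omega>"
abbreviation "Y \<equiv> Mstar \<omega>"
abbreviation "yn \<equiv> Mstar_norm \<omega>"
abbreviation "Z \<equiv> Mstar_dual \<omega>"
abbreviation "zn \<equiv> Mstar_dual_norm \<omega>"
abbreviation "prd \<equiv> Mstar_dual_prod \<omega>"

sublocale XA: nalg X N conv_meas
  by unfold_locales
    (auto simp: wmeas_zero[OF W] wmeas_add[OF W] wmeas_scale[OF W] wmeas_norm_nonneg[OF W] wmeas_conv(1)[OF W LC]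
      conv_meas_add_left[OF W] conv_meas_add_right[OF W] conv_meas_scale_left[OF W] conv_meas_scale_right[OF W]
      wmeas_norm_conv_le[OF W LC])

lemma total_var_scale_null:
  assumes "\<mu> \<in> X" "K \<in> sets borel" "emeasure (total_var \<mu>) K = 0"
  shows "emeasure (total_var (\<lambda>E. c * \<mu> E)) K = 0"
proof -
  let ?M = "density (total_var \<mu>) (\<lambda>_. ennreal (cmod c))"
  have em: "emeasure ?M E = ennreal (cmod c) * emeasure (total_var \<mu>) E" if "E \<in> sets borel" for E
    using that by (subst emeasure_density) (auto intro!: nn_integral_cmult_indicator)
  have "emeasure (total_var (\<lambda>E. c * \<mu> E)) K \<le> emeasure ?M K"
  proof (rule total_var_le)
    show "complex_measure (\<lambda>E. c * \<mu> E)" by (rule wmeasD(1)[OF W XA.scale[OF assms(1)]])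
    fix A :: "'a set" assume "A \<in> sets borel"
    then show "ennreal (cmod (c * \<mu> A)) \<le> emeasure ?M A"
      using mult_left_mono[OF cmod_le_total_var[OF wmeasD(1)[OF W assms(1)], of A], of "ennreal (cmod c)"]
      by (simp add: em norm_mult ennreal_mult)
  qed simp
  then show ?thesis using assms em by simp
qed

text \<open>A homogeneous form of vanishing at infinity, free of the normalisation to norm 1;
  halving \<open>e\<close> restores the strict inequality.\<close>

lemma MstarI:
  assumes "h \<in> XA.D"
    and "\<And>e. 0 < e \<Longrightarrow> \<exists>K. compact K \<and> (\<forall>\<mu>\<in>X. emeasure (total_var \<mu>) K = 0 \<longrightarrow> cmod (h \<mu>) \<le> e * N \<mu>)"
  shows "h \<in> Y"
  unfolding Mstar_def vanishes_at_infinity_def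
proof (intro CollectI conjI allI impI assms(1))
  fix e :: real assume e: "0 < e"
  then obtain K where K: "compact K" "\<forall>\<mu>\<in>X. emeasure (total_var \<mu>) K = 0 \<longrightarrow> cmod (h \<mu>) \<le> e / 2 * N \<mu>"
    using assms(2)[of "e / 2"] by auto
  then show "\<exists>K. compact K \<and> (\<forall>\<mu>\<in>X. emeasure (total_var \<mu>) K = 0 \<longrightarrow> N \<mu> = 1 \<longrightarrow> cmod (h \<mu>) < e)"
    using e by (intro exI[of _ K]) fastforce
qed

lemma MstarD: "h \<in> Y \<Longrightarrow> h \<in> XA.D"
  by (simp add: Mstar_def)

lemma Mstar_vanishes:
  assumes h: "h \<in> Y" and e: "0 < e"
  obtains K where "compact K" "\<And>\<mu>. \<mu> \<in> X \<Longrightarrow> emeasure (total_var \<mu>) K = 0 \<Longrightarrow> cmod (h \<mu>) \<le> e * N \<mu>"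
proof -
  obtain K where K: "compact K" "\<forall>\<mu>\<in>X. emeasure (total_var \<mu>) K = 0 \<longrightarrow> N \<mu> = 1 \<longrightarrow> cmod (h \<mu>) < e"
    using h e by (auto simp: Mstar_def vanishes_at_infinity_def)
  have "cmod (h \<mu>) \<le> e * N \<mu>" if \<mu>: "\<mu> \<in> X" "emeasure (total_var \<mu>) K = 0" for \<mu>
  \<comment> \<open>A measure of norm 0 cannot be normalised, but the norm bound gives the value 0
    there.\<close>
  proof (cases "N \<mu> = 0")
    case True
    then show ?thesis using XA.dual_bound[OF MstarD[OF h] \<mu>(1)] by simp
  next
    case False
    then have pos: "0 < N \<mu>" using XA.norm_nonneg[OF \<mu>(1)] by simp
    define c where "c = complex_of_real (1 / N \<mu>)"
    have nc: "cmod c = 1 / N \<mu>" using pos by (simp add: c_def norm_divide)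
    have "N (\<lambda>E. c * \<mu> E) = 1" using pos XA.norm_scale[OF \<mu>(1), of c] nc by simp
    then have "cmod (h (\<lambda>E. c * \<mu> E)) < e"
      using K(2) XA.scale[OF \<mu>(1), of c] total_var_scale_null[OF \<mu>(1) compact_borel[OF K(1)] \<mu>(2), of c] by blast
    then have "cmod (h \<mu>) / N \<mu> < e"
      by (simp add: dual_spaceD(2)[OF MstarD[OF h] \<mu>(1)] norm_mult nc)
    then show ?thesis using pos by (simp add: pos_divide_less_eq less_imp_le)
  qed
  then show ?thesis using that K(1) by blast
qed

sublocale XD: nspace XA.D XA.dn by (rule XA.dual_nspace)

section \<open>M_*(G,\<omega>) and its dual as normed spaces\<close>

lemma total_var_null_Un:
  assumes "\<mu> \<in> X" "compact K" "compact L" "emeasure (total_var \<mu>) (K \<union> L) = 0"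
  shows "emeasure (total_var \<mu>) K = 0" "emeasure (total_var \<mu>) L = 0"
proof -
  have "K \<union> L \<in> sets (total_var \<mu>)" using assms by (auto simp: compact_borel)
  then have "emeasure (total_var \<mu>) K \<le> emeasure (total_var \<mu>) (K \<union> L)"
    "emeasure (total_var \<mu>) L \<le> emeasure (total_var \<mu>) (K \<union> L)"
    by (auto intro!: emeasure_mono)
  then show "emeasure (total_var \<mu>) K = 0" "emeasure (total_var \<mu>) L = 0" using assms(4) by auto
qed

sublocale YS: nspace Y yn
  unfolding Mstar_norm_def
proof (rule XD.subspace)
  show "Y \<subseteq> XA.D" using MstarD by blast
  show "(\<lambda>i. 0) \<in> Y" by (rule MstarI) (auto simp: XD.zero XA.norm_nonneg intro!: exI[of _ "{}"])
  show "(\<lambda>i. g i + h i) \<in> Y" if gh: "g \<in> Y" "h \<in> Y" for g h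
  proof (rule MstarI[OF XD.add[OF gh[THEN MstarD]]])
    fix e :: real assume "0 < e"
    then have e: "0 < e / 2" by simp
    obtain K where K: "compact K" "\<And>\<mu>. \<mu> \<in> X \<Longrightarrow> emeasure (total_var \<mu>) K = 0 \<Longrightarrow> cmod (g \<mu>) \<le> e / 2 * N \<mu>"
      using Mstar_vanishes[OF gh(1) e] by blast
    obtain L where L: "compact L" "\<And>\<mu>. \<mu> \<in> X \<Longrightarrow> emeasure (total_var \<mu>) L = 0 \<Longrightarrow> cmod (h \<mu>) \<le> e / 2 * N \<mu>"
      using Mstar_vanishes[OF gh(2) e] by blast
    have "cmod (g \<mu> + h \<mu>) \<le> e * N \<mu>" if "\<mu> \<in> X" "emeasure (total_var \<mu>) (K \<union> L) = 0" for \<mu>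
      using K(2)[OF that(1) total_var_null_Un(1)[OF that(1) K(1) L(1) that(2)]]
        L(2)[OF that(1) total_var_null_Un(2)[OF that(1) K(1) L(1) that(2)]]
        norm_triangle_ineq[of "g \<mu>" "h \<mu>"] by (simp add: field_simps)
    then show "\<exists>K. compact K \<and> (\<forall>\<mu>\<in>X. emeasure (total_var \<mu>) K = 0 \<longrightarrow> cmod (g \<mu> + h \<mu>) \<le> e * N \<mu>)"
      using K(1) L(1) by (intro exI[of _ "K \<union> L"]) auto
  qed
  show "(\<lambda>i. c * h i) \<in> Y" if h: "h \<in> Y" for c h
  proof (rule MstarI[OF XD.scale[OF MstarD[OF h]]])
    fix e :: real assume e: "0 < e"
    define d where "d = e / (cmod c + 1)"
    have d: "0 < d" "cmod c * d \<le> e"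
      using scaled_epsilon[OF e norm_ge_zero[of c]] by (auto simp: d_def)
    obtain K where K: "compact K" "\<And>\<mu>. \<mu> \<in> X \<Longrightarrow> emeasure (total_var \<mu>) K = 0 \<Longrightarrow> cmod (h \<mu>) \<le> d * N \<mu>"
      using Mstar_vanishes[OF h d(1)] by blast
    have "cmod (c * h \<mu>) \<le> e * N \<mu>" if "\<mu> \<in> X" "emeasure (total_var \<mu>) K = 0" for \<mu>
    proof -
      have "cmod (c * h \<mu>) \<le> cmod c * (d * N \<mu>)" unfolding norm_mult by (intro mult_left_mono K that) auto
      also have "\<dots> \<le> e * N \<mu>"
        using mult_right_mono[OF d(2) XA.norm_nonneg[OF that(1)]] by (simp add: mult.assoc)
      finally show ?thesis .
    qed
    then show "\<exists>K. compact K \<and> (\<forall>\<mu>\<in>X. emeasure (total_var \<mu>) K = 0 \<longrightarrow> cmod (c * h \<mu>) \<le> e * N \<mu>)"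
      using K(1) by blast
  qed
qed

lemma Z_eq: "Z = dual_space Y yn" and zn_eq: "zn = dual_norm Y yn"
  by (simp_all add: Mstar_dual_def Mstar_dual_norm_def fun_eq_iff)

sublocale ZS: nspace Z zn
  unfolding Z_eq zn_eq by (rule YS.dual_nspace)

lemma Mstar_bound: "h \<in> Y \<Longrightarrow> \<mu> \<in> X \<Longrightarrow> cmod (h \<mu>) \<le> yn h * N \<mu>"
  unfolding Mstar_norm_def by (rule XA.dual_bound[OF MstarD])

lemma Mstar_norm_le: "0 \<le> B \<Longrightarrow> (\<And>\<mu>. \<mu> \<in> X \<Longrightarrow> cmod (h \<mu>) \<le> B * N \<mu>) \<Longrightarrow> yn h \<le> B"
  unfolding Mstar_norm_def by (rule XA.dual_norm_le)

lemmas Y_add = dual_spaceD(1)[OF MstarD] and Y_scale = dual_spaceD(2)[OF MstarD]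

lemma Z_bound: "b \<in> Z \<Longrightarrow> h \<in> Y \<Longrightarrow> cmod (b h) \<le> zn b * yn h"
  unfolding Z_eq zn_eq by (rule YS.dual_bound)

lemma Z_norm_le: "0 \<le> B \<Longrightarrow> (\<And>h. h \<in> Y \<Longrightarrow> cmod (b h) \<le> B * yn h) \<Longrightarrow> zn b \<le> B"
  unfolding zn_eq by (rule YS.dual_norm_le)

lemmas ZD = dual_spaceD[where X = "Mstar \<omega>" and N = "Mstar_norm \<omega>", folded Z_eq]
lemmas ZI = dual_spaceI[where X = "Mstar \<omega>" and N = "Mstar_norm \<omega>", folded Z_eq]

text \<open>The transpose of restricting measures to \<open>B\<close>: the part of a functional that
  lives on \<open>B\<close>.\<close>

definition rest_fun :: "'a set \<Rightarrow> (('a set \<Rightarrow> complex) \<Rightarrow> complex) \<Rightarrow> ('a set \<Rightarrow> complex) \<Rightarrow> complex" where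
  "rest_fun B h = (\<lambda>\<mu>. if \<mu> \<in> X then h (restr B \<mu>) else 0)"

lemma restr_add: "restr B (\<lambda>E. \<mu> E + \<nu> E) = (\<lambda>E. restr B \<mu> E + restr B \<nu> E)"
  and restr_scale: "restr B (\<lambda>E. c * \<mu> E) = (\<lambda>E. c * restr B \<mu> E)"
  by (auto simp: restr_def)

lemma cmod_rest_fun_le:
  assumes "h \<in> Y" "B \<in> sets borel" "\<mu> \<in> X"
  shows "cmod (rest_fun B h \<mu>) \<le> yn h * N (restr B \<mu>)"
  using Mstar_bound[OF assms(1) wmeas_restr(1)[OF W assms(3,2)]] assms(3) by (simp add: rest_fun_def)

lemma rest_fun_Mstar:
  assumes h: "h \<in> Y" and B: "B \<in> sets borel"
  shows "rest_fun B h \<in> Y" "yn (rest_fun B h) \<le> yn h"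
proof -
  note r = wmeas_restr(1)[OF W _ B]
  have bd: "cmod (rest_fun B h \<mu>) \<le> yn h * N \<mu>" if "\<mu> \<in> X" for \<mu>
    using cmod_rest_fun_le[OF h B that] mult_left_mono[OF wmeas_norm_restr_le[OF W that B] YS.norm_nonneg[OF h]] by linarith
  show "yn (rest_fun B h) \<le> yn h" by (rule Mstar_norm_le[OF YS.norm_nonneg[OF h] bd])
  show "rest_fun B h \<in> Y"
  proof (rule MstarI)
    show "rest_fun B h \<in> XA.D"
      by (rule dual_spaceI[OF _ _ bd]) (auto simp: rest_fun_def restr_add restr_scale XA.add XA.scale r Y_add[OF h] Y_scale[OF h])
    fix e :: real assume "0 < e"
    then obtain K where K: "compact K" "\<And>\<mu>. \<mu> \<in> X \<Longrightarrow> emeasure (total_var \<mu>) K = 0 \<Longrightarrow> cmod (h \<mu>) \<le> e * N \<mu>"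
      using Mstar_vanishes[OF h] by blast
    have "cmod (rest_fun B h \<mu>) \<le> e * N \<mu>" if \<mu>: "\<mu> \<in> X" "emeasure (total_var \<mu>) K = 0" for \<mu>
    proof -
      have "emeasure (total_var (restr B \<mu>)) K = emeasure (total_var \<mu>) (B \<inter> K)"
        by (rule emeasure_total_var_restr[OF W \<mu>(1) B compact_borel[OF K(1)]])
      also have "\<dots> \<le> emeasure (total_var \<mu>) K" using compact_borel[OF K(1)] by (intro emeasure_mono) auto
      finally have "cmod (h (restr B \<mu>)) \<le> e * N (restr B \<mu>)" using \<mu> by (intro K r) auto
      also have "\<dots> \<le> e * N \<mu>" using \<open>0 < e\<close> by (intro mult_left_mono wmeas_norm_restr_le[OF W \<mu>(1) B]) auto
      finally show ?thesis using \<mu> by (simp add: rest_fun_def)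
    qed
    then show "\<exists>K. compact K \<and> (\<forall>\<mu>\<in>X. emeasure (total_var \<mu>) K = 0 \<longrightarrow> cmod (rest_fun B h \<mu>) \<le> e * N \<mu>)"
      using K(1) by blast
  qed
qed

lemma rest_fun_split:
  assumes h: "h \<in> Y" and B: "B \<in> sets borel"
  shows "(\<lambda>\<mu>. rest_fun B h \<mu> + rest_fun (- B) h \<mu>) = h"
proof
  fix \<mu>
  show "rest_fun B h \<mu> + rest_fun (- B) h \<mu> = h \<mu>"
  proof (cases "\<mu> \<in> X")
    case True
    have "h \<mu> = h (\<lambda>E. restr B \<mu> E + restr (- B) \<mu> E)" by (simp add: restr_split[OF W True B])
    then show ?thesis using True B by (simp add: rest_fun_def Y_add[OF h] wmeas_restr(1)[OF W])
  next
    case False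
    then show ?thesis by (simp add: rest_fun_def dual_spaceD(3)[OF MstarD[OF h]])
  qed
qed

text \<open>A measure restricted to the complement of \<open>K\<close> is null on \<open>K\<close>,
  so vanishing at infinity becomes smallness in norm off a compact set.\<close>

lemma rest_fun_compl_small:
  assumes h: "h \<in> Y" and e: "0 < e"
  obtains K where "compact K" "yn (rest_fun (- K) h) \<le> e"
proof -
  obtain K where K: "compact K" "\<And>\<mu>. \<mu> \<in> X \<Longrightarrow> emeasure (total_var \<mu>) K = 0 \<Longrightarrow> cmod (h \<mu>) \<le> e * N \<mu>"
    using Mstar_vanishes[OF h e] by blast
  have B: "- K \<in> sets borel" using compact_borel[OF K(1)] by simp
  have "yn (rest_fun (- K) h) \<le> e"
  proof (rule Mstar_norm_le)
    fix \<mu> assume \<mu>: "\<mu> \<in> X"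
    have "cmod (h (restr (- K) \<mu>)) \<le> e * N (restr (- K) \<mu>)"
      using emeasure_total_var_restr[OF W \<mu> B compact_borel[OF K(1)]] by (intro K wmeas_restr(1)[OF W \<mu> B]) simp
    also have "\<dots> \<le> e * N \<mu>" using e by (intro mult_left_mono wmeas_norm_restr_le[OF W \<mu> B]) auto
    finally show "cmod (rest_fun (- K) h \<mu>) \<le> e * N \<mu>" using \<mu> by (simp add: rest_fun_def)
  qed (use e in simp)
  then show ?thesis using that K(1) by blast
qed

text \<open>If \<open>h\<close> is supported in \<open>K\<close> and almost attains the norm of \<open>b\<close>, then \<open>b\<close> is small on the functionals
  \<open>g\<close> supported off \<open>K\<close>, because \<open>h + g\<close> has norm at most 1 whenever \<open>h\<close> and \<open>g\<close> have.\<close>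

lemma Mstar_dual_tight:
  assumes b: "b \<in> Z" and e: "0 < e"
  obtains K where "compact K" "\<And>g. g \<in> Y \<Longrightarrow> cmod (b (rest_fun (- K) g)) \<le> e * yn g"
proof -
  have "\<exists>h\<in>Y. yn h \<le> 1 \<and> zn b - e / 2 < cmod (b h)"
  proof (rule ccontr)
    assume none: "\<not> ?thesis"
    have "zn b \<le> zn b - e / 2"
      unfolding zn_eq dual_norm_def
    proof (rule cSUP_least)
      show "{x \<in> Y. yn x \<le> 1} \<noteq> {}" using YS.zero YS.norm_zero by auto
      fix x assume "x \<in> {x \<in> Y. yn x \<le> 1}"
      then show "cmod (b x) \<le> (SUP x\<in>{x \<in> Y. yn x \<le> 1}. cmod (b x)) - e / 2"
        using none unfolding zn_eq dual_norm_def by force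
    qed
    then show False using e by simp
  qed
  then obtain h where h: "h \<in> Y" "yn h \<le> 1" "zn b - e / 2 < cmod (b h)" by blast
  have zb: "0 \<le> zn b" by (rule ZS.norm_nonneg[OF b])
  \<comment> \<open>Makes the part of \<open>h\<close> off \<open>K\<close> cost at most e/2 under
    \<open>b\<close>; the other e/2 was lost in choosing \<open>h\<close>.\<close>
  define d where "d = e / 2 / (zn b + 1)"
  have d: "0 < d" "zn b * d \<le> e / 2"
    using scaled_epsilon[of "e / 2" "zn b"] e zb by (auto simp: d_def)
  obtain K where K: "compact K" "yn (rest_fun (- K) h) \<le> d"
    using rest_fun_compl_small[OF h(1) d(1)] by blast
  note Kb = compact_borel[OF K(1)]
  have Cb: "- K \<in> sets borel" using Kb by simp
  have hK: "rest_fun K h \<in> Y" "rest_fun (- K) h \<in> Y" using rest_fun_Mstar(1)[OF h(1)] Kb Cb by auto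
  have "b h = b (rest_fun K h) + b (rest_fun (- K) h)"
    using ZD(1)[OF b hK] rest_fun_split[OF h(1) Kb] by simp
  moreover have "cmod (b (rest_fun (- K) h)) \<le> e / 2"
    using Z_bound[OF b hK(2)] mult_left_mono[OF K(2) zb] d(2) by linarith
  ultimately have big: "zn b - e < cmod (b (rest_fun K h))"
    using h(3) norm_triangle_ineq[of "b (rest_fun K h)" "b (rest_fun (- K) h)"] by simp
  have one: "cmod (b (rest_fun (- K) g)) \<le> e" if g: "g \<in> Y" "yn g \<le> 1" for g
  proof -
    define s t where "s = b (rest_fun K h)" and "t = b (rest_fun (- K) g)"
    note gK = rest_fun_Mstar(1)[OF g(1) Cb]
    \<comment> \<open>The phases \<open>u\<close> and \<open>v\<close> align the two values of
      \<open>b\<close>, so that their moduli add up in \<open>b ?k\<close>.\<close>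
    obtain u where u: "cmod u \<le> 1" "u * s = complex_of_real (cmod s)" using unit_phase by blast
    obtain v where v: "cmod v \<le> 1" "v * t = complex_of_real (cmod t)" using unit_phase by blast
    let ?k = "\<lambda>\<mu>. u * rest_fun K h \<mu> + v * rest_fun (- K) g \<mu>"
    have kY: "?k \<in> Y" by (intro YS.add YS.scale hK gK)
    have "b ?k = u * s + v * t"
      unfolding s_def t_def using ZD(1)[OF b YS.scale[OF hK(1)] YS.scale[OF gK]] ZD(2)[OF b hK(1)] ZD(2)[OF b gK] by simp
    then have "b ?k = complex_of_real (cmod s + cmod t)" using u v by simp
    then have "cmod (b ?k) = cmod s + cmod t" by (simp add: norm_of_real del: of_real_add)
    \<comment> \<open>The two parts see disjoint parts of \<mu>, whose norms add up to that of
      \<mu>.\<close>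
    moreover have "yn ?k \<le> 1"
    proof (rule Mstar_norm_le)
      fix \<mu> assume \<mu>: "\<mu> \<in> X"
      have "cmod (?k \<mu>) \<le> cmod (u * rest_fun K h \<mu>) + cmod (v * rest_fun (- K) g \<mu>)" by (rule norm_triangle_ineq)
      also have "\<dots> \<le> 1 * cmod (rest_fun K h \<mu>) + 1 * cmod (rest_fun (- K) g \<mu>)"
        unfolding norm_mult using u v by (intro add_mono mult_right_mono) auto
      also have "\<dots> \<le> 1 * N (restr K \<mu>) + 1 * N (restr (- K) \<mu>)"
      proof (rule add_mono)
        have "cmod (rest_fun K h \<mu>) \<le> yn h * N (restr K \<mu>)" by (rule cmod_rest_fun_le[OF h(1) Kb \<mu>])
        also have "\<dots> \<le> 1 * N (restr K \<mu>)" using h(2) by (intro mult_right_mono wmeas_norm_nonneg[OF W])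
        finally show "1 * cmod (rest_fun K h \<mu>) \<le> 1 * N (restr K \<mu>)" by simp
        have "cmod (rest_fun (- K) g \<mu>) \<le> yn g * N (restr (- K) \<mu>)" by (rule cmod_rest_fun_le[OF g(1) Cb \<mu>])
        also have "\<dots> \<le> 1 * N (restr (- K) \<mu>)" using g(2) by (intro mult_right_mono wmeas_norm_nonneg[OF W])
        finally show "1 * cmod (rest_fun (- K) g \<mu>) \<le> 1 * N (restr (- K) \<mu>)" by simp
      qed
      also have "\<dots> = 1 * N \<mu>" using wmeas_norm_split[OF W \<mu> Kb] by simp
      finally show "cmod (?k \<mu>) \<le> 1 * N \<mu>" .
    qed simp
    ultimately have "cmod s + cmod t \<le> zn b"
      using Z_bound[OF b kY] mult_left_mono[of "yn ?k" 1 "zn b"] zb by simp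
    then show ?thesis using big by (simp add: s_def t_def)
  qed
  have "cmod (b (rest_fun (- K) g)) \<le> e * yn g" if g: "g \<in> Y" for g
  proof (cases "yn g = 0")
    case True
    have "yn (rest_fun (- K) g) = 0"
      using rest_fun_Mstar[OF g Cb] YS.norm_nonneg[of "rest_fun (- K) g"] True by auto
    then show ?thesis using Z_bound[OF b rest_fun_Mstar(1)[OF g Cb]] True by simp
  next
    case False
    then have pos: "0 < yn g" using YS.norm_nonneg[OF g] by simp
    define c where "c = complex_of_real (1 / yn g)"
    have nc: "cmod c = 1 / yn g" using pos by (simp add: c_def norm_divide)
    have "yn (\<lambda>\<mu>. c * g \<mu>) = 1" using pos YS.norm_scale[OF g, of c] nc by simp
    then have "cmod (b (rest_fun (- K) (\<lambda>\<mu>. c * g \<mu>))) \<le> e" using one[OF YS.scale[OF g]] by simp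
    moreover have "rest_fun (- K) (\<lambda>\<mu>. c * g \<mu>) = (\<lambda>\<mu>. c * rest_fun (- K) g \<mu>)" by (auto simp: rest_fun_def)
    ultimately have "cmod (b (rest_fun (- K) g)) / yn g \<le> e"
      by (simp add: ZD(2)[OF b rest_fun_Mstar(1)[OF g Cb]] norm_mult nc)
    then show ?thesis using pos by (simp add: pos_divide_le_eq)
  qed
  then show ?thesis using that K(1) by blast
qed

section \<open>Left introversion and the product of the dual\<close>

abbreviation "fct \<equiv> fun_act X conv_meas"
abbreviation "bact \<equiv> bidual_act X conv_meas"

text \<open>Up to a small tail, \<mu> sits on a compact \<open>K1\<close>. If \<nu> misses the set
  -K1 + K0, the main part of the convolution misses \<open>K0\<close>, where \<open>h\<close> is
  concentrated.\<close>

lemma fun_act_Mstar: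
  assumes h: "h \<in> Y" and \<mu>: "\<mu> \<in> X"
  shows "fct h \<mu> \<in> Y" "yn (fct h \<mu>) \<le> yn h * N \<mu>"
proof -
  note hD = MstarD[OF h]
  show "yn (fct h \<mu>) \<le> yn h * N \<mu>"
    unfolding Mstar_norm_def by (rule XA.fun_act_dual(2)[OF hD \<mu>])
  note h0 = YS.norm_nonneg[OF h] and N0 = XA.norm_nonneg[OF \<mu>]
  show "fct h \<mu> \<in> Y"
  proof (rule MstarI[OF XA.fun_act_dual(1)[OF hD \<mu>]])
    fix e :: real assume e: "0 < e"
    define d where "d = e / 2 / (N \<mu> + 1)"
    have d: "0 < d" "d * N \<mu> \<le> e / 2"
      using scaled_epsilon[of "e / 2" "N \<mu>"] e N0 by (auto simp: d_def mult.commute)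
    define d' where "d' = e / 2 / (yn h + 1)"
    have d': "0 < d'" "yn h * d' \<le> e / 2"
      using scaled_epsilon[of "e / 2" "yn h"] e h0 by (auto simp: d'_def)
    obtain K0 where K0: "compact K0" "\<And>\<nu>. \<nu> \<in> X \<Longrightarrow> emeasure (total_var \<nu>) K0 = 0 \<Longrightarrow> cmod (h \<nu>) \<le> d * N \<nu>"
      using Mstar_vanishes[OF h d(1)] by blast
    obtain K1 where K1: "compact K1" "N (restr (- K1) \<mu>) < d'"
      using wmeas_tight[OF W \<mu> d'(1)] by blast
    note Kb = compact_borel[OF K1(1)]
    have Cb: "- K1 \<in> sets borel" using Kb by simp
    let ?K = "(\<lambda>(a, b). - b + a) ` (K0 \<times> K1)"
    have cK: "compact ?K"
      using K0(1) K1(1) by (intro compact_continuous_image compact_Times)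
        (auto intro!: continuous_intros simp: split_beta)
    have "cmod (fct h \<mu> \<nu>) \<le> e * N \<nu>" if \<nu>: "\<nu> \<in> X" "emeasure (total_var \<nu>) ?K = 0" for \<nu>
    proof -
      note r = wmeas_restr(1)[OF W \<mu> Kb] wmeas_restr(1)[OF W \<mu> Cb]
      note n0 = XA.norm_nonneg[OF \<nu>(1)]
      have "conv_meas \<mu> \<nu> = (\<lambda>E. conv_meas (restr K1 \<mu>) \<nu> E + conv_meas (restr (- K1) \<mu>) \<nu> E)"
        using conv_meas_add_left[OF W r \<nu>(1)] restr_split[OF W \<mu> Kb] by simp
      then have "h (conv_meas \<mu> \<nu>) = h (conv_meas (restr K1 \<mu>) \<nu>) + h (conv_meas (restr (- K1) \<mu>) \<nu>)"
        using Y_add[OF h XA.closed_p[OF r(1) \<nu>(1)] XA.closed_p[OF r(2) \<nu>(1)]] by simp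
      moreover have "cmod (h (conv_meas (restr K1 \<mu>) \<nu>)) \<le> e / 2 * N \<nu>"
      proof -
        have "cmod (h (conv_meas (restr K1 \<mu>) \<nu>)) \<le> d * N (conv_meas (restr K1 \<mu>) \<nu>)"
          by (rule K0(2)[OF XA.closed_p[OF r(1) \<nu>(1)] total_var_conv_null_right[OF W LC \<mu> \<nu>(1) K0(1) K1(1) \<nu>(2)]])
        also have "\<dots> \<le> d * (N \<mu> * N \<nu>)"
          using d(1) XA.norm_p[OF r(1) \<nu>(1)] mult_right_mono[OF wmeas_norm_restr_le[OF W \<mu> Kb] n0]
          by (intro mult_left_mono) auto
        also have "\<dots> \<le> e / 2 * N \<nu>" using mult_right_mono[OF d(2) n0] by (simp add: mult.assoc)
        finally show ?thesis .
      qed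
      moreover have "cmod (h (conv_meas (restr (- K1) \<mu>) \<nu>)) \<le> e / 2 * N \<nu>"
      proof -
        have "cmod (h (conv_meas (restr (- K1) \<mu>) \<nu>)) \<le> yn h * N (conv_meas (restr (- K1) \<mu>) \<nu>)"
          by (rule Mstar_bound[OF h XA.closed_p[OF r(2) \<nu>(1)]])
        also have "\<dots> \<le> yn h * (d' * N \<nu>)"
          using h0 XA.norm_p[OF r(2) \<nu>(1)] mult_right_mono[OF less_imp_le[OF K1(2)] n0]
          by (intro mult_left_mono) auto
        also have "\<dots> \<le> e / 2 * N \<nu>" using mult_right_mono[OF d'(2) n0] by (simp add: mult.assoc)
        finally show ?thesis .
      qed
      ultimately have "cmod (h (conv_meas \<mu> \<nu>)) \<le> e / 2 * N \<nu> + e / 2 * N \<nu>"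
        by (metis norm_triangle_mono)
      then show ?thesis using \<nu> by (simp add: fun_act_def)
    qed
    then show "\<exists>K. compact K \<and> (\<forall>\<nu>\<in>X. emeasure (total_var \<nu>) K = 0 \<longrightarrow> cmod (fct h \<mu> \<nu>) \<le> e * N \<nu>)"
      using cK by blast
  qed
qed

text \<open>This is left introversion. Tightness of \<open>b\<close> from
  \<open>Mstar_dual_tight\<close> plays the role that tightness of the measure plays in
  \<open>fun_act_Mstar\<close>.\<close>

lemma bidual_act_Mstar:
  assumes b: "b \<in> Z" and h: "h \<in> Y"
  shows "bact b h \<in> Y" "yn (bact b h) \<le> zn b * yn h"
proof -
  note hD = MstarD[OF h] and b0 = ZS.norm_nonneg[OF b] and h0 = YS.norm_nonneg[OF h]
  have bd: "cmod (bact b h \<mu>) \<le> zn b * yn h * N \<mu>" if "\<mu> \<in> X" for \<mu>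
    using Z_bound[OF b fun_act_Mstar(1)[OF h that]] mult_left_mono[OF fun_act_Mstar(2)[OF h that] b0] that
    by (simp add: bidual_act_def mult.assoc)
  show "yn (bact b h) \<le> zn b * yn h" by (rule Mstar_norm_le[OF _ bd]) (use b0 h0 in auto)
  show "bact b h \<in> Y"
  proof (rule MstarI)
    show "bact b h \<in> XA.D"
      by (rule dual_spaceI[OF _ _ bd])
        (auto simp: bidual_act_def XA.add XA.scale XA.fun_act_add[OF hD] XA.fun_act_scale[OF hD] fun_act_Mstar(1)[OF h] ZD(1,2)[OF b])
    fix e :: real assume e: "0 < e"
    define d where "d = e / 2 / (zn b + 1)"
    have d: "0 < d" "zn b * d \<le> e / 2"
      using scaled_epsilon[of "e / 2" "zn b"] e b0 by (auto simp: d_def)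
    define d' where "d' = e / 2 / (yn h + 1)"
    have d': "0 < d'" "d' * yn h \<le> e / 2"
      using scaled_epsilon[of "e / 2" "yn h"] e h0 by (auto simp: d'_def mult.commute)
    obtain K0 where K0: "compact K0" "\<And>\<nu>. \<nu> \<in> X \<Longrightarrow> emeasure (total_var \<nu>) K0 = 0 \<Longrightarrow> cmod (h \<nu>) \<le> d * N \<nu>"
      using Mstar_vanishes[OF h d(1)] by blast
    obtain K1 where K1: "compact K1" "\<And>g. g \<in> Y \<Longrightarrow> cmod (b (rest_fun (- K1) g)) \<le> d' * yn g"
      using Mstar_dual_tight[OF b d'(1)] by blast
    note Kb = compact_borel[OF K1(1)]
    have Cb: "- K1 \<in> sets borel" using Kb by simp
    let ?K = "(\<lambda>(a, b). a - b) ` (K0 \<times> K1)"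
    have cK: "compact ?K"
      using K0(1) K1(1) by (intro compact_continuous_image compact_Times)
        (auto intro!: continuous_intros simp: split_beta diff_conv_add_uminus simp del: add_uminus_conv_diff)
    have "cmod (bact b h \<mu>) \<le> e * N \<mu>" if \<mu>: "\<mu> \<in> X" "emeasure (total_var \<mu>) ?K = 0" for \<mu>
    proof -
      define g where "g = fct h \<mu>"
      have g: "g \<in> Y" "yn g \<le> yn h * N \<mu>" unfolding g_def using fun_act_Mstar[OF h \<mu>(1)] by auto
      note n0 = XA.norm_nonneg[OF \<mu>(1)]
      note gr = rest_fun_Mstar(1)[OF g(1) Kb] rest_fun_Mstar(1)[OF g(1) Cb]
      have "b g = b (rest_fun K1 g) + b (rest_fun (- K1) g)"
        using ZD(1)[OF b gr] rest_fun_split[OF g(1) Kb] by simp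
      moreover have "cmod (b (rest_fun (- K1) g)) \<le> e / 2 * N \<mu>"
      proof -
        have "cmod (b (rest_fun (- K1) g)) \<le> d' * yn g" by (rule K1(2)[OF g(1)])
        also have "\<dots> \<le> d' * (yn h * N \<mu>)" using g(2) d'(1) by (intro mult_left_mono) auto
        also have "\<dots> \<le> e / 2 * N \<mu>" using mult_right_mono[OF d'(2) n0] by (simp add: mult.assoc)
        finally show ?thesis .
      qed
      moreover have "cmod (b (rest_fun K1 g)) \<le> e / 2 * N \<mu>"
      proof -
        \<comment> \<open>This part tests \<nu> only on \<open>K1\<close>, so \<mu> missing the set
          K0 - K1 makes the convolution miss \<open>K0\<close>.\<close>
        have "yn (rest_fun K1 g) \<le> d * N \<mu>"
        proof (rule Mstar_norm_le)
          fix \<nu> assume \<nu>: "\<nu> \<in> X"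
          note r = wmeas_restr(1)[OF W \<nu> Kb]
          have "cmod (h (conv_meas \<mu> (restr K1 \<nu>))) \<le> d * N (conv_meas \<mu> (restr K1 \<nu>))"
            by (rule K0(2)[OF XA.closed_p[OF \<mu>(1) r] total_var_conv_null_left[OF W LC \<mu>(1) \<nu> K0(1) K1(1) \<mu>(2)]])
          also have "\<dots> \<le> d * (N \<mu> * N \<nu>)"
            using d(1) XA.norm_p[OF \<mu>(1) r] mult_left_mono[OF wmeas_norm_restr_le[OF W \<nu> Kb] n0]
            by (intro mult_left_mono) auto
          finally show "cmod (rest_fun K1 g \<nu>) \<le> d * N \<mu> * N \<nu>"
            using \<nu> r by (simp add: rest_fun_def g_def fun_act_def mult.assoc)
        qed (use d(1) n0 in auto)
        then have "zn b * yn (rest_fun K1 g) \<le> zn b * (d * N \<mu>)" using b0 by (rule mult_left_mono)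
        also have "\<dots> \<le> e / 2 * N \<mu>" using mult_right_mono[OF d(2) n0] by (simp add: mult.assoc)
        finally show ?thesis using Z_bound[OF b gr(1)] by linarith
      qed
      ultimately have "cmod (b g) \<le> e / 2 * N \<mu> + e / 2 * N \<mu>"
        by (metis norm_triangle_mono)
      then show ?thesis using \<mu> by (simp add: bidual_act_def g_def)
    qed
    then show "\<exists>K. compact K \<and> (\<forall>\<mu>\<in>X. emeasure (total_var \<mu>) K = 0 \<longrightarrow> cmod (bact b h \<mu>) \<le> e * N \<mu>)"
      using cK by blast
  qed
qed

lemma prd_apply: "h \<in> Y \<Longrightarrow> prd a b h = a (bact b h)"
  by (simp add: Mstar_dual_prod_def arens_prod_def)

lemma fun_act_fun_add: "fct (\<lambda>\<mu>. g \<mu> + h \<mu>) \<mu> = (\<lambda>\<nu>. fct g \<mu> \<nu> + fct h \<mu> \<nu>)"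
  and fun_act_fun_scale: "fct (\<lambda>\<mu>. c * h \<mu>) \<mu> = (\<lambda>\<nu>. c * fct h \<mu> \<nu>)"
  by (auto simp: fun_act_def)

lemma bidual_act_add:
  assumes "b \<in> Z" "g \<in> Y" "h \<in> Y"
  shows "bact b (\<lambda>\<mu>. g \<mu> + h \<mu>) = (\<lambda>\<mu>. bact b g \<mu> + bact b h \<mu>)"
  using assms by (auto simp: bidual_act_def fun_eq_iff fun_act_fun_add ZD(1) fun_act_Mstar)

lemma bidual_act_scale:
  assumes "b \<in> Z" "h \<in> Y"
  shows "bact b (\<lambda>\<mu>. c * h \<mu>) = (\<lambda>\<mu>. c * bact b h \<mu>)"
  using assms by (auto simp: bidual_act_def fun_eq_iff fun_act_fun_scale ZD(2) fun_act_Mstar)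

lemma prd_Mstar_dual:
  assumes a: "a \<in> Z" and b: "b \<in> Z"
  shows "prd a b \<in> Z" "zn (prd a b) \<le> zn a * zn b"
proof -
  note a0 = ZS.norm_nonneg[OF a] and b0 = ZS.norm_nonneg[OF b]
  have bd: "cmod (prd a b h) \<le> zn a * zn b * yn h" if h: "h \<in> Y" for h
    using Z_bound[OF a bidual_act_Mstar(1)[OF b h]] mult_left_mono[OF bidual_act_Mstar(2)[OF b h] a0]
    by (simp add: prd_apply[OF h] mult.assoc)
  show "zn (prd a b) \<le> zn a * zn b" by (rule Z_norm_le[OF _ bd]) (use a0 b0 in auto)
  show "prd a b \<in> Z"
  proof (rule ZI[OF _ _ bd])
    show "prd a b h = 0" if "h \<notin> Y" for h using that by (simp add: Mstar_dual_prod_def arens_prod_def)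
  qed (simp_all add: prd_apply YS.add YS.scale bidual_act_add[OF b] bidual_act_scale[OF b] bidual_act_Mstar[OF b] ZD(1,2)[OF a])
qed

sublocale ZA: nalg Z zn prd
proof unfold_locales
  fix a b c assume Z: "a \<in> Z" "b \<in> Z" "c \<in> Z"
  show "prd (\<lambda>i. a i + b i) c = (\<lambda>i. prd a c i + prd b c i)"
    by (auto simp: Mstar_dual_prod_def arens_prod_def)
  have "bact (\<lambda>i. a i + b i) h = (\<lambda>\<mu>. bact a h \<mu> + bact b h \<mu>)" for h
    by (auto simp: bidual_act_def)
  then have "prd c (\<lambda>i. a i + b i) h = prd c a h + prd c b h" for h
    using Z by (simp add: Mstar_dual_prod_def arens_prod_def ZD(1) bidual_act_Mstar)
  then show "prd c (\<lambda>i. a i + b i) = (\<lambda>i. prd c a i + prd c b i)" by blast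
next
  fix a b k assume Z: "a \<in> Z" "b \<in> Z"
  show "prd (\<lambda>i. k * a i) b = (\<lambda>i. k * prd a b i)"
    by (auto simp: Mstar_dual_prod_def arens_prod_def)
  have "bact (\<lambda>i. k * a i) h = (\<lambda>\<mu>. k * bact a h \<mu>)" for h
    by (auto simp: bidual_act_def)
  then have "prd b (\<lambda>i. k * a i) h = k * prd b a h" for h
    using Z by (simp add: Mstar_dual_prod_def arens_prod_def ZD(2) bidual_act_Mstar)
  then show "prd b (\<lambda>i. k * a i) = (\<lambda>i. k * prd b a i)" by blast
qed (use prd_Mstar_dual in auto)

end

section \<open>Point masses\<close>

context weighted_group
begin

text \<open>The image of the Dirac measure at \<open>x\<close> in the dual of
  M_*(G,\<omega>).\<close>

definition pt :: "'a \<Rightarrow> (('a set \<Rightarrow> complex) \<Rightarrow> complex) \<Rightarrow> complex" where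
  "pt x = (\<lambda>h. if h \<in> Y then h (dirac x) else 0)"

text \<open>Applying an element \<open>a\<close> of the dual to \<open>pf z\<close> reads off the
  mass of \<open>a\<close> at \<open>z\<close>; these are the coordinates dual to the point
  masses.\<close>

definition pf :: "'a \<Rightarrow> ('a set \<Rightarrow> complex) \<Rightarrow> complex" where
  "pf z = (\<lambda>\<mu>. if \<mu> \<in> X then \<mu> {z} else 0)"

lemma pt_Mstar_dual: "pt x \<in> Z" "zn (pt x) \<le> \<omega> x"
proof -
  have bd: "cmod (pt x h) \<le> \<omega> x * yn h" if "h \<in> Y" for h
    using Mstar_bound[OF that wmeas_dirac(1)[OF W, of x]] that by (simp add: pt_def wmeas_dirac(2)[OF W] mult.commute)
  show "pt x \<in> Z" by (rule ZI[OF _ _ bd]) (simp_all add: pt_def YS.add YS.scale)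
  show "zn (pt x) \<le> \<omega> x" by (rule Z_norm_le[OF weight_nonneg[OF W] bd])
qed

lemma prd_pt: "prd (pt x) (pt y) = pt (x + y)"
proof
  fix h
  show "prd (pt x) (pt y) h = pt (x + y) h"
  proof (cases "h \<in> Y")
    case True
    note d = wmeas_dirac(1)[OF W]
    have "prd (pt x) (pt y) h = bact (pt y) h (dirac x)"
      using bidual_act_Mstar(1)[OF pt_Mstar_dual(1) True] by (simp add: prd_apply[OF True] pt_def[of x])
    also have "\<dots> = h (conv_meas (dirac x) (dirac y))"
      using fun_act_Mstar(1)[OF True d] d by (simp add: bidual_act_def pt_def) (simp add: fun_act_def)
    finally show ?thesis using True by (simp add: pt_def conv_meas_dirac[OF W])
  qed (simp add: Mstar_dual_prod_def arens_prod_def pt_def)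
qed

lemma sum_point_masses_le:
  assumes \<mu>: "\<mu> \<in> X" and F: "finite F"
  shows "(\<Sum>z\<in>F. cmod (\<mu> {z})) \<le> N \<mu>"
proof -
  note \<mu>' = wmeasD[OF W \<mu>]
  interpret finite_measure "total_var \<mu>" by (rule \<mu>'(4))
  have "(\<Sum>z\<in>F. cmod (\<mu> {z})) \<le> (\<Sum>z\<in>F. measure (total_var \<mu>) {z})"
    using cmod_le_total_var[OF \<mu>'(1)] by (intro sum_mono) (simp add: emeasure_eq_measure)
  also have "\<dots> = measure (total_var \<mu>) F"
    using F by (intro finite_measure_eq_sum_singleton[symmetric]) auto
  also have "\<dots> \<le> measure (total_var \<mu>) UNIV"
    using bounded_measure[of F] by simp
  also have "\<dots> \<le> N \<mu>"
  proof -
    have "emeasure (total_var \<mu>) UNIV = (\<integral>\<^sup>+x. 1 \<partial>total_var \<mu>)" by simp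
    also have "\<dots> \<le> (\<integral>\<^sup>+x. ennreal (\<omega> x) \<partial>total_var \<mu>)"
      using weight_ge_1[OF W] by (intro nn_integral_mono) simp
    finally have "ennreal (measure (total_var \<mu>) UNIV) \<le> ennreal (N \<mu>)"
      by (simp only: wmeas_norm_eq[OF W \<mu>] emeasure_eq_measure)
    then show ?thesis using wmeas_norm_nonneg[OF W] by (simp add: ennreal_le_iff)
  qed
  finally show ?thesis .
qed

text \<open>The compact set {z} serves for every error bound: a measure that is null there has value
  0.\<close>

lemma pf_Mstar: "pf z \<in> Y"
proof (rule MstarI)
  show "pf z \<in> XA.D"
  proof (rule dual_spaceI[where B = 1])
    show "cmod (pf z \<mu>) \<le> 1 * N \<mu>" if "\<mu> \<in> X" for \<mu>
      using sum_point_masses_le[OF that, of "{z}"] that by (simp add: pf_def)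
  qed (auto simp: pf_def XA.add XA.scale)
  fix e :: real assume "0 < e"
  have "cmod (pf z \<mu>) \<le> e * N \<mu>" if "\<mu> \<in> X" "emeasure (total_var \<mu>) {z} = 0" for \<mu>
    using cmod_le_total_var[OF wmeasD(1)[OF W that(1)], of "{z}"] that \<open>0 < e\<close>
    by (simp add: pf_def wmeas_norm_nonneg[OF W])
  then show "\<exists>K. compact K \<and> (\<forall>\<mu>\<in>X. emeasure (total_var \<mu>) K = 0 \<longrightarrow> cmod (pf z \<mu>) \<le> e * N \<mu>)"
    by (intro exI[of _ "{z}"]) auto
qed

lemma pt_pf: "pt x (pf z) = (if x = z then 1 else 0)"
  using pf_Mstar wmeas_dirac(1)[OF W] by (simp add: pt_def pf_def) (simp add: dirac_def)

text \<open>Point values of \<open>a\<close> are absolutely summable: the sum of the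
  \<open>pf z\<close> with phases attached has norm at most 1 by \<open>sum_point_masses_le\<close>,
  and \<open>a\<close> maps it to the sum of the moduli.\<close>

lemma sum_dual_point_le:
  assumes a: "a \<in> Z" and F: "finite F"
  shows "(\<Sum>z\<in>F. cmod (a (pf z))) \<le> zn a"
proof -
  have "\<forall>z. \<exists>u. cmod u \<le> 1 \<and> u * a (pf z) = complex_of_real (cmod (a (pf z)))"
    using unit_phase by blast
  then obtain u where u: "\<And>z. cmod (u z) \<le> 1" "\<And>z. u z * a (pf z) = complex_of_real (cmod (a (pf z)))"
    by metis
  define k where "k = (\<lambda>\<mu>. \<Sum>z\<in>F. u z * pf z \<mu>)"
  have k: "k \<in> Y" unfolding k_def by (rule YS.sum_closed[OF F pf_Mstar])
  have "a k = (\<Sum>z\<in>F. u z * a (pf z))"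
    unfolding k_def by (rule YS.dual_sum[OF a[unfolded Z_eq] F pf_Mstar])
  also have "\<dots> = complex_of_real (\<Sum>z\<in>F. cmod (a (pf z)))" by (simp add: u(2))
  finally have "cmod (a k) = (\<Sum>z\<in>F. cmod (a (pf z)))" by (simp only: norm_of_real) (simp add: sum_nonneg)
  moreover have "yn k \<le> 1"
  proof (rule Mstar_norm_le)
    fix \<mu> assume \<mu>: "\<mu> \<in> X"
    have "cmod (k \<mu>) \<le> (\<Sum>z\<in>F. cmod (u z * pf z \<mu>))" unfolding k_def by (rule norm_sum)
    also have "\<dots> \<le> (\<Sum>z\<in>F. 1 * cmod (\<mu> {z}))"
      unfolding norm_mult using u(1) \<mu> by (intro sum_mono mult_mono) (auto simp: pf_def)
    also have "\<dots> \<le> 1 * N \<mu>" using sum_point_masses_le[OF \<mu> F] by simp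
    finally show "cmod (k \<mu>) \<le> 1 * N \<mu>" .
  qed simp
  ultimately show ?thesis
    using Z_bound[OF a k] mult_left_mono[of "yn k" 1 "zn a"] ZS.norm_nonneg[OF a] by simp
qed

section \<open>Arens regularity forces finite level sets\<close>

text \<open>An arbitrary indicator function on the group acts on the dual of M_*(G,\<omega>) in this
  way, although it need not vanish at infinity; this is the functional that detects
  irregularity.\<close>

definition set_functional :: "'a set \<Rightarrow> ((('a set \<Rightarrow> complex) \<Rightarrow> complex) \<Rightarrow> complex) \<Rightarrow> complex" where
  "set_functional S = (\<lambda>a. if a \<in> Z then infsum (\<lambda>z. a (pf z)) S else 0)"

lemma set_functional_dual: "set_functional S \<in> ZS.D"
proof -
  have abs: "(\<lambda>z. norm (a (pf z))) summable_on S" if a: "a \<in> Z" for a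
  proof (rule nonneg_bdd_above_summable_on)
    show "bdd_above (sum (\<lambda>z. cmod (a (pf z))) ` {F. F \<subseteq> S \<and> finite F})"
      using sum_dual_point_le[OF a] by (auto intro!: bdd_aboveI)
  qed simp
  note sm = abs_summable_summable[OF abs]
  show ?thesis
  proof (rule dual_spaceI[where B = 1])
    fix a assume a: "a \<in> Z"
    have "cmod (infsum (\<lambda>z. a (pf z)) S) \<le> infsum (\<lambda>z. cmod (a (pf z))) S"
      by (rule norm_infsum_bound[OF abs[OF a]])
    also have "\<dots> \<le> zn a"
      by (rule infsum_le_finite_sums[OF abs[OF a] sum_dual_point_le[OF a]])
    finally show "cmod (set_functional S a) \<le> 1 * zn a" using a by (simp add: set_functional_def)
  qed (auto simp: set_functional_def ZS.add ZS.scale infsum_add sm infsum_cmult_right')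
qed

lemma set_functional_pt: "set_functional S (pt x) = (if x \<in> S then 1 else 0)"
proof -
  have "infsum (\<lambda>z. pt x (pf z)) S = infsum (\<lambda>z. 1) (S \<inter> {x})"
    by (rule infsum_cong_neutral) (auto simp: pt_pf)
  then show ?thesis by (auto simp: set_functional_def pt_Mstar_dual)
qed

end

text \<open>Earlier terms exclude only finitely many candidates for the next one, and
  \<open>A\<close> is infinite.\<close>

lemma sparse_sequence_exists:
  fixes A :: "'a::group_add set"
  assumes "infinite A"
  shows "\<exists>z :: nat \<Rightarrow> 'a. \<forall>k. z k \<in> A \<and> (\<forall>i<k. \<forall>j<k. \<forall>l<k. z i + z k \<noteq> z j + z l \<and> z k + z i \<noteq> z j + z l)"
proof (rule dependent_wellorder_choice)
  fix r and f g :: "nat \<Rightarrow> 'a" and k :: nat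
  assume "\<And>i. i < k \<Longrightarrow> f i = g i"
  then show "(r \<in> A \<and> (\<forall>i<k. \<forall>j<k. \<forall>l<k. f i + r \<noteq> f j + f l \<and> r + f i \<noteq> f j + f l)) =
      (r \<in> A \<and> (\<forall>i<k. \<forall>j<k. \<forall>l<k. g i + r \<noteq> g j + g l \<and> r + g i \<noteq> g j + g l))" by auto
next
  fix k :: nat and f :: "nat \<Rightarrow> 'a"
  \<comment> \<open>All solutions \<open>r\<close> of the forbidden equations; the second half
    solves for \<open>r\<close> on the left because the group need not commute.\<close>
  define B where "B = (\<lambda>(i, j, l). - f i + (f j + f l)) ` ({..<k} \<times> {..<k} \<times> {..<k}) \<union>
      (\<lambda>(i, j, l). (f j + f l) - f i) ` ({..<k} \<times> {..<k} \<times> {..<k})"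
  have "finite B" unfolding B_def by auto
  then obtain r where r: "r \<in> A" "r \<notin> B" using assms by (metis finite_subset subsetI)
  have "f i + r \<noteq> f j + f l \<and> r + f i \<noteq> f j + f l" if "i < k" "j < k" "l < k" for i j l
  proof (intro conjI notI)
    have "(i, j, l) \<in> {..<k} \<times> {..<k} \<times> {..<k}" using that by auto
    then have B: "- f i + (f j + f l) \<in> B" "(f j + f l) - f i \<in> B"
      unfolding B_def by (auto intro!: image_eqI[of _ _ "(i, j, l)"])
    show False if "f i + r = f j + f l"
      using B(1) r unfolding that[symmetric] by (simp add: add.assoc[symmetric])
    show False if "r + f i = f j + f l"
      using B(2) r unfolding that[symmetric] by simp
  qed
  then show "\<exists>r. r \<in> A \<and> (\<forall>i<k. \<forall>j<k. \<forall>l<k. f i + r \<noteq> f j + f l \<and> r + f i \<noteq> f j + f l)"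
    using r by blast
qed

text \<open>Odd terms serve as left factors and even terms as right factors, so the two indices in a
  product always differ.\<close>

lemma (in weighted_group) not_regular_of_infinite_level:
  assumes inf: "infinite {x. \<omega> x \<le> C}"
  shows "\<not> arens_regular Z zn prd"
proof -
  obtain z :: "nat \<Rightarrow> 'a" where "\<forall>k. z k \<in> {x. \<omega> x \<le> C} \<and>
      (\<forall>i<k. \<forall>j<k. \<forall>l<k. z i + z k \<noteq> z j + z l \<and> z k + z i \<noteq> z j + z l)"
    using sparse_sequence_exists[OF inf] ..
  then have zA: "\<omega> (z k) \<le> C"
    and z: "i < k \<Longrightarrow> j < k \<Longrightarrow> l < k \<Longrightarrow> z i + z k \<noteq> z j + z l \<and> z k + z i \<noteq> z j + z l" for i j k l
    by blast+
  define S where "S = {z (2 * i + 1) + z (2 * j) | i j. i < j}"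
  have notin: "z (2 * n + 1) + z (2 * m) \<notin> S" if "m \<le> n" for m n
  proof
    assume "z (2 * n + 1) + z (2 * m) \<in> S"
    then obtain i j where ij: "i < j" "z (2 * n + 1) + z (2 * m) = z (2 * i + 1) + z (2 * j)"
      by (auto simp: S_def)
    show False
    \<comment> \<open>The largest indices of the two products are 2n+1 and 2j, which differ by
      parity. Whichever is larger contradicts sparseness.\<close>
    proof (cases "2 * j < 2 * n + 1")
      case True
      then show False using z[of "2 * m" "2 * n + 1" "2 * i + 1" "2 * j"] ij that by auto
    next
      case False
      then have "2 * n + 1 < 2 * j" by presburger
      then show False using z[of "2 * i + 1" "2 * j" "2 * n + 1" "2 * m"] ij that by simp
    qed
  qed
  show ?thesis
  proof (rule ZA.not_arens_regularI[OF set_functional_dual[of S]])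
    show "pt (z (2 * n + 1)) \<in> Z" "pt (z (2 * n)) \<in> Z" for n by (rule pt_Mstar_dual)+
    show "zn (pt (z (2 * n + 1))) \<le> C" "zn (pt (z (2 * n))) \<le> C" for n
      using pt_Mstar_dual(2) zA by (blast intro: order_trans)+
    fix m n
    have "z (2 * n + 1) + z (2 * m) \<in> S \<longleftrightarrow> n < m"
      using notin[of m n] by (auto simp: S_def not_le[symmetric])
    then show "set_functional S (prd (pt (z (2 * n + 1))) (pt (z (2 * m)))) = (if n < m then 1 else 0)"
      by (simp add: prd_pt set_functional_pt)
  qed
qed

section \<open>Arens regularity for weights that are small on products\<close>

context weighted_group
begin

text \<open>The transpose of \<open>rest_fun\<close>, that is, restriction to \<open>B\<close> one
  dual further up.\<close>

definition cut :: "'a set \<Rightarrow> ((('a set \<Rightarrow> complex) \<Rightarrow> complex) \<Rightarrow> complex) \<Rightarrow> (('a set \<Rightarrow> complex) \<Rightarrow> complex) \<Rightarrow> complex" where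
  "cut B a = (\<lambda>h. if h \<in> Y then a (rest_fun B h) else 0)"

lemma rest_fun_add: "rest_fun B (\<lambda>\<mu>. g \<mu> + h \<mu>) = (\<lambda>\<mu>. rest_fun B g \<mu> + rest_fun B h \<mu>)"
  and rest_fun_scale: "rest_fun B (\<lambda>\<mu>. c * h \<mu>) = (\<lambda>\<mu>. c * rest_fun B h \<mu>)"
  by (auto simp: rest_fun_def)

lemma cut_Mstar_dual:
  assumes a: "a \<in> Z" and B: "B \<in> sets borel"
  shows "cut B a \<in> Z" "zn (cut B a) \<le> zn a"
proof -
  note a0 = ZS.norm_nonneg[OF a]
  have bd: "cmod (cut B a h) \<le> zn a * yn h" if "h \<in> Y" for h
    using Z_bound[OF a rest_fun_Mstar(1)[OF that B]] mult_left_mono[OF rest_fun_Mstar(2)[OF that B] a0] that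
    by (simp add: cut_def)
  show "cut B a \<in> Z"
    by (rule ZI[OF _ _ bd]) (simp_all add: cut_def YS.add YS.scale rest_fun_add rest_fun_scale ZD(1,2)[OF a] rest_fun_Mstar B)
  show "zn (cut B a) \<le> zn a" by (rule Z_norm_le[OF a0 bd])
qed

lemma cut_split:
  assumes "a \<in> Z" "B \<in> sets borel"
  shows "(\<lambda>h. cut B a h + cut (- B) a h) = a"
proof
  fix h
  show "cut B a h + cut (- B) a h = a h"
  proof (cases "h \<in> Y")
    case True
    have "- B \<in> sets borel" using assms(2) by simp
    then have "a (\<lambda>\<mu>. rest_fun B h \<mu> + rest_fun (- B) h \<mu>) = a (rest_fun B h) + a (rest_fun (- B) h)"
      by (intro ZD(1)[OF assms(1)] rest_fun_Mstar(1)[OF True] assms(2))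
    then show ?thesis unfolding rest_fun_split[OF True assms(2)] using True by (simp add: cut_def)
  next
    case False
    then show ?thesis using ZD(3)[OF assms(1) False] by (simp add: cut_def)
  qed
qed

lemma restr_finite:
  assumes \<mu>: "\<mu> \<in> X" and F: "finite F"
  shows "restr F \<mu> = (\<lambda>E. \<Sum>x\<in>F. \<mu> {x} * dirac x E)"
proof
  fix E
  show "restr F \<mu> E = (\<Sum>x\<in>F. \<mu> {x} * dirac x E)"
  proof (cases "E \<in> sets borel")
    case True
    note cm = wmeasD(1)[OF W \<mu>]
    have "\<mu> (E \<inter> F) = (\<Sum>x\<in>F. \<mu> {x} * indicator E x)" using F
    proof (induction F rule: finite_induct)
      case empty
      then show ?case by (simp add: complex_measure_empty[OF cm])
    next
      case (insert a F)
      have Fb: "E \<inter> F \<in> sets borel" using insert.hyps by (intro borel_closed finite_imp_closed) auto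
      have "\<mu> (E \<inter> insert a F) = \<mu> {a} * indicator E a + \<mu> (E \<inter> F)"
      proof (cases "a \<in> E")
        case True
        then have "E \<inter> insert a F = {a} \<union> (E \<inter> F)" by blast
        then show ?thesis using complex_measure_Un[OF cm _ Fb, of "{a}"] insert.hyps True by simp
      qed simp
      then show ?case by (simp only: sum.insert[OF insert.hyps] insert.IH)
    qed
    then show ?thesis using True by (simp add: restr_def dirac_def)
  qed (simp add: restr_def dirac_def)
qed

text \<open>Restricting to a finite set is an operation of finite rank: point values of
  \<open>a\<close> are the coefficients of point masses.\<close>

lemma cut_finite:
  assumes a: "a \<in> Z" and F: "finite F"
  shows "cut F a = (\<lambda>h. \<Sum>x\<in>F. a (pf x) * pt x h)"
proof
  fix h
  show "cut F a h = (\<Sum>x\<in>F. a (pf x) * pt x h)"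
  proof (cases "h \<in> Y")
    case True
    have "rest_fun F h = (\<lambda>\<mu>. \<Sum>x\<in>F. h (dirac x) * pf x \<mu>)"
    proof
      fix \<mu>
      show "rest_fun F h \<mu> = (\<Sum>x\<in>F. h (dirac x) * pf x \<mu>)"
      proof (cases "\<mu> \<in> X")
        case \<mu>: True
        have "h (restr F \<mu>) = (\<Sum>x\<in>F. \<mu> {x} * h (dirac x))"
          unfolding restr_finite[OF \<mu> F] by (rule XA.dual_sum[OF MstarD[OF True] F wmeas_dirac(1)[OF W]])
        then show ?thesis using \<mu> by (simp add: rest_fun_def pf_def mult.commute)
      qed (simp add: rest_fun_def pf_def)
    qed
    then have "a (rest_fun F h) = (\<Sum>x\<in>F. h (dirac x) * a (pf x))"
      by (simp add: YS.dual_sum[OF a[unfolded Z_eq] F pf_Mstar])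
    then show ?thesis using True by (simp add: cut_def pt_def mult.commute)
  qed (simp add: cut_def pt_def)
qed

text \<open>The smallness of \<omega>(xy) is used on measures by
  \<open>wmeas_norm_conv_restr_le\<close> and lifted through two dualities, first for
  \<open>b\<close> and then for \<open>a\<close>.\<close>

lemma prd_cut_small:
  assumes a: "a \<in> Z" and b: "b \<in> Z" and B: "B \<in> sets borel" and e: "0 \<le> e"
    and small: "\<And>x y. x \<in> B \<Longrightarrow> y \<in> B \<Longrightarrow> \<omega> (x + y) \<le> e * (\<omega> x * \<omega> y)"
  shows "zn (prd (cut B a) (cut B b)) \<le> e * zn a * zn b"
proof (rule Z_norm_le)
  note a0 = ZS.norm_nonneg[OF a] and b0 = ZS.norm_nonneg[OF b]
  note cb = cut_Mstar_dual(1)[OF b B]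
  show "0 \<le> e * zn a * zn b" using e a0 b0 by simp
  fix h assume h: "h \<in> Y"
  note h0 = YS.norm_nonneg[OF h]
  define k where "k = bact (cut B b) h"
  have k: "k \<in> Y" unfolding k_def by (rule bidual_act_Mstar(1)[OF cb h])
  have "yn (rest_fun B k) \<le> e * zn b * yn h"
  proof (rule Mstar_norm_le)
    show "0 \<le> e * zn b * yn h" using e b0 h0 by simp
    fix \<mu> assume \<mu>: "\<mu> \<in> X"
    note r = wmeas_restr(1)[OF W \<mu> B]
    note g = fun_act_Mstar(1)[OF h r]
    have "rest_fun B k \<mu> = k (restr B \<mu>)" using \<mu> by (simp add: rest_fun_def)
    also have "\<dots> = cut B b (fct h (restr B \<mu>))" using r by (simp add: k_def bidual_act_def)
    also have "\<dots> = b (rest_fun B (fct h (restr B \<mu>)))" using g by (simp add: cut_def)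
    finally have "rest_fun B k \<mu> = b (rest_fun B (fct h (restr B \<mu>)))" .
    moreover have "yn (rest_fun B (fct h (restr B \<mu>))) \<le> e * yn h * N \<mu>"
    proof (rule Mstar_norm_le)
      show "0 \<le> e * yn h * N \<mu>" using e h0 wmeas_norm_nonneg[OF W] by simp
      fix \<nu> assume \<nu>: "\<nu> \<in> X"
      note s = wmeas_restr(1)[OF W \<nu> B]
      have "cmod (h (conv_meas (restr B \<mu>) (restr B \<nu>))) \<le> yn h * N (conv_meas (restr B \<mu>) (restr B \<nu>))"
        by (rule Mstar_bound[OF h XA.closed_p[OF r s]])
      also have "\<dots> \<le> yn h * (e * (N \<mu> * N \<nu>))"
        by (intro mult_left_mono h0 wmeas_norm_conv_restr_le[OF W LC \<mu> \<nu> e B B small])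
      finally show "cmod (rest_fun B (fct h (restr B \<mu>)) \<nu>) \<le> e * yn h * N \<mu> * N \<nu>"
        using \<nu> s by (simp add: rest_fun_def fun_act_def mult_ac)
    qed
    ultimately show "cmod (rest_fun B k \<mu>) \<le> e * zn b * yn h * N \<mu>"
      using Z_bound[OF b rest_fun_Mstar(1)[OF g B]]
        mult_left_mono[of "yn (rest_fun B (fct h (restr B \<mu>)))" "e * yn h * N \<mu>" "zn b"] b0
      by (simp add: mult_ac)
  qed
  moreover have "prd (cut B a) (cut B b) h = a (rest_fun B k)"
    using k by (simp add: prd_apply[OF h] k_def[symmetric] cut_def[of B a])
  ultimately show "cmod (prd (cut B a) (cut B b) h) \<le> e * zn a * zn b * yn h"
    using Z_bound[OF a rest_fun_Mstar(1)[OF k B]]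
      mult_left_mono[of "yn (rest_fun B k)" "e * zn b * yn h" "zn a"] a0
    by (simp add: mult_ac)
qed

text \<open>Up to a small error, \<open>f (a b)\<close> depends only on finitely many point values of \<open>a\<close> or of \<open>b\<close>,
  so the bilinear form is a norm limit of forms of finite rank.\<close>

theorem regular_of_small_products:
  assumes small: "\<And>e. 0 < e \<Longrightarrow> \<exists>F. finite F \<and> (\<forall>x y. x \<notin> F \<longrightarrow> y \<notin> F \<longrightarrow> \<omega> (x + y) \<le> e * (\<omega> x * \<omega> y))"
  shows "arens_regular Z zn prd"
\<comment> \<open>The Boolean tags the two kinds of terms: \<open>True\<close> for those with a
  point value of \<open>a\<close>, \<open>False\<close> for those with a point value of
  \<open>b\<close>.\<close>
proof (rule ZA.arens_regularI[where 'k = "'a \<times> bool"])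
  interpret op: nalg Z zn "\<lambda>x y. prd y x" by (rule ZA.opposite)
  fix f and e :: real assume f: "f \<in> ZS.D" and e: "0 < e"
  have f0: "0 \<le> ZS.dn f" by (rule ZS.dual_norm_nonneg[OF f])
  define d where "d = e / (ZS.dn f + 1)"
  have d: "0 < d" "ZS.dn f * d \<le> e" using scaled_epsilon[OF e f0] by (auto simp: d_def)
  obtain F where F: "finite F" "\<And>x y. x \<notin> F \<Longrightarrow> y \<notin> F \<Longrightarrow> \<omega> (x + y) \<le> d * (\<omega> x * \<omega> y)"
    using small[OF d(1)] by blast
  have Fb: "F \<in> sets borel" using F(1) by (intro borel_closed finite_imp_closed)
  then have Cb: "- F \<in> sets borel" by simp
  define ev where "ev x = (\<lambda>a. if a \<in> Z then a (pf x) else 0)" for x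
  have ev: "ev x \<in> ZS.D" for x
  proof (rule dual_spaceI[where B = 1])
    show "cmod (ev x a) \<le> 1 * zn a" if "a \<in> Z" for a
      using sum_dual_point_le[OF that, of "{x}"] that by (simp add: ev_def)
  qed (auto simp: ev_def ZS.add ZS.scale)
  \<comment> \<open>The coefficient of the point value of \<open>b\<close> at \<open>y\<close> once
    the part of \<open>a\<close> on \<open>F\<close> has been split off.\<close>
  define w where "w y = (\<lambda>a. if a \<in> Z then f (prd (cut (- F) a) (pt y)) else 0)" for y
  have w: "w y \<in> ZS.D" for y
  proof -
    define g where "g = fun_act Z (\<lambda>x y. prd y x) f (pt y)"
    have g: "g \<in> ZS.D" unfolding g_def by (rule op.fun_act_dual(1)[OF f pt_Mstar_dual(1)])
    have wg: "w y a = g (cut (- F) a)" if "a \<in> Z" for a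
      using that cut_Mstar_dual(1)[OF that Cb] by (simp add: w_def g_def fun_act_def)
    have cadd: "cut (- F) (\<lambda>h. a h + b h) = (\<lambda>h. cut (- F) a h + cut (- F) b h)"
      and cscale: "cut (- F) (\<lambda>h. c * a h) = (\<lambda>h. c * cut (- F) a h)" for a b c
      by (auto simp: cut_def)
    show ?thesis
    proof (rule dual_spaceI[where B = "ZS.dn g"])
      fix a assume a: "a \<in> Z"
      show "cmod (w y a) \<le> ZS.dn g * zn a"
        using ZS.dual_bound[OF g cut_Mstar_dual(1)[OF a Cb]]
          mult_left_mono[OF cut_Mstar_dual(2)[OF a Cb] ZS.dual_norm_nonneg[OF g]] wg[OF a] by simp
    qed (simp_all add: wg ZS.add ZS.scale cadd cscale dual_spaceD(1,2)[OF g] cut_Mstar_dual(1) Cb, simp add: w_def)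
  qed
  define \<phi> where "\<phi> k = (if snd k then ev (fst k) else w (fst k))" for k
  define \<psi> where "\<psi> k = (if snd k then fun_act Z prd f (pt (fst k)) else ev (fst k))" for k
  have "cmod (f (prd a b) - (\<Sum>k\<in>F \<times> UNIV. \<phi> k a * \<psi> k b)) \<le> e * zn a * zn b" if a: "a \<in> Z" and b: "b \<in> Z" for a b
  proof -
    note ca = cut_Mstar_dual(1)[OF a Fb] cut_Mstar_dual(1)[OF a Cb]
    note cb = cut_Mstar_dual(1)[OF b Fb] cut_Mstar_dual(1)[OF b Cb]
    \<comment> \<open>First \<open>a\<close> is split along \<open>F\<close>, then \<open>b\<close>,
      but only against the part of \<open>a\<close> off \<open>F\<close>. The two terms with a
      factor on \<open>F\<close> are exactly the finite sum.\<close>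
    have "f (prd a b) = f (prd (cut F a) b) + f (prd (cut (- F) a) b)"
      using ZA.addl[OF ca b] dual_spaceD(1)[OF f ZA.closed_p[OF ca(1) b] ZA.closed_p[OF ca(2) b]] cut_split[OF a Fb] by simp
    moreover have "f (prd (cut (- F) a) b) = f (prd (cut (- F) a) (cut F b)) + f (prd (cut (- F) a) (cut (- F) b))"
      using ZA.addr[OF cb ca(2)] dual_spaceD(1)[OF f ZA.closed_p[OF ca(2) cb(1)] ZA.closed_p[OF ca(2) cb(2)]] cut_split[OF b Fb] by simp
    moreover have "fun_act Z (\<lambda>x y. prd y x) f b (cut F a) = (\<Sum>x\<in>F. a (pf x) * fun_act Z (\<lambda>x y. prd y x) f b (pt x))"
      unfolding cut_finite[OF a F(1)] by (rule ZS.dual_sum[OF op.fun_act_dual(1)[OF f b] F(1) pt_Mstar_dual(1)])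
    then have "f (prd (cut F a) b) = (\<Sum>x\<in>F. a (pf x) * f (prd (pt x) b))"
      using ca(1) by (simp add: fun_act_def pt_Mstar_dual)
    moreover have "fun_act Z prd f (cut (- F) a) (cut F b) = (\<Sum>y\<in>F. b (pf y) * fun_act Z prd f (cut (- F) a) (pt y))"
      unfolding cut_finite[OF b F(1)] by (rule ZS.dual_sum[OF ZA.fun_act_dual(1)[OF f ca(2)] F(1) pt_Mstar_dual(1)])
    then have "f (prd (cut (- F) a) (cut F b)) = (\<Sum>y\<in>F. b (pf y) * f (prd (cut (- F) a) (pt y)))"
      using cb(1) by (simp add: fun_act_def pt_Mstar_dual)
    moreover have "(\<Sum>k\<in>F \<times> UNIV. \<phi> k a * \<psi> k b)
        = (\<Sum>x\<in>F. a (pf x) * f (prd (pt x) b)) + (\<Sum>y\<in>F. b (pf y) * f (prd (cut (- F) a) (pt y)))"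
      using a b by (simp add: sum.cartesian_product' UNIV_bool sum.distrib \<phi>_def \<psi>_def ev_def w_def fun_act_def mult.commute)
    ultimately have "f (prd a b) - (\<Sum>k\<in>F \<times> UNIV. \<phi> k a * \<psi> k b) = f (prd (cut (- F) a) (cut (- F) b))"
      by simp
    also have "cmod \<dots> \<le> ZS.dn f * zn (prd (cut (- F) a) (cut (- F) b))"
      by (rule ZS.dual_bound[OF f ZA.closed_p[OF ca(2) cb(2)]])
    also have "\<dots> \<le> ZS.dn f * (d * zn a * zn b)"
      using d(1) F(2) by (intro mult_left_mono[OF _ f0] prd_cut_small[OF a b Cb]) auto
    also have "\<dots> \<le> e * zn a * zn b"
      using mult_right_mono[OF d(2), of "zn a * zn b"] ZS.norm_nonneg[OF a] ZS.norm_nonneg[OF b] by (simp add: mult.assoc)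
    finally show ?thesis .
  qed
  moreover have "\<phi> k \<in> ZS.D \<and> \<psi> k \<in> ZS.D" for k
    unfolding \<phi>_def \<psi>_def using ev w ZA.fun_act_dual(1)[OF f pt_Mstar_dual(1)] by auto
  ultimately show "\<exists>(K :: ('a \<times> bool) set) \<phi> \<psi>. finite K \<and> (\<forall>k\<in>K. \<phi> k \<in> ZS.D \<and> \<psi> k \<in> ZS.D) \<and>
      (\<forall>a\<in>Z. \<forall>b\<in>Z. cmod (f (prd a b) - (\<Sum>k\<in>K. \<phi> k a * \<psi> k b)) \<le> e * zn a * zn b)"
    using F(1) by (intro exI[of _ "F \<times> UNIV"] exI[of _ \<phi>] exI[of _ \<psi>]) auto
qed

end

section \<open>Weights with finite level sets\<close>

text \<open>The group is the union of countably many level sets. The set where \<omega> is below 2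
  is a finite open neighbourhood of the identity, so the identity is isolated, and translations do
  the rest.\<close>

lemma discrete_of_finite_levels:
  fixes \<omega> :: "'a::{topological_group_add, t2_space} \<Rightarrow> real"
  assumes W: "weight \<omega>" and fin: "\<And>C. finite {x. \<omega> x \<le> C}"
  shows "countable (UNIV :: 'a set)" "(euclidean :: 'a topology) = discrete_topology UNIV"
proof -
  have "(UNIV :: 'a set) = (\<Union>n :: nat. {x. \<omega> x \<le> real n})"
    by (auto intro: real_arch_simple)
  moreover have "countable (\<Union>n :: nat. {x. \<omega> x \<le> real n})"
    by (rule countable_UN, simp, rule countable_finite, rule fin)
  ultimately show "countable (UNIV :: 'a set)" by simp
  let ?V = "{x. \<omega> x < 2}"
  have "finite ?V" using fin[of 2] by (rule rev_finite_subset) auto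
  then have "closed (?V - {0})" by (intro finite_imp_closed) auto
  moreover have "open ?V"
    using W by (intro open_Collect_less continuous_intros) (simp add: weight_def)
  ultimately have "open (?V - (?V - {0}))" by (intro open_Diff)
  moreover have "?V - (?V - {0}) = {0}" using W by (auto simp: weight_def)
  ultimately have o: "open {0 :: 'a}" by simp
  have "open {x}" for x :: 'a
  proof -
    have "open ((\<lambda>y. y + - x) -` {0})" by (intro open_vimage[OF o] continuous_intros)
    moreover have "(\<lambda>y. y + - x) -` {0} = {x}" by (auto simp: add_eq_0_iff)
    ultimately show ?thesis by simp
  qed
  then have "discrete_topology UNIV = (euclidean :: 'a topology)"
    by (subst discrete_topology_unique) auto
  then show "(euclidean :: 'a topology) = discrete_topology UNIV" ..
qed

text \<open>On an infinite level set \<open>\<Omega>\<close> is bounded away from 0, and a subsequence makes all limits exist.\<close>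

lemma finite_levels_of_zero_cluster:
  fixes \<omega> :: "'a::{topological_group_add, t2_space} \<Rightarrow> real"
  assumes W: "weight \<omega>" and zc: "zero_cluster (\<lambda>z. complex_of_real (Omega \<omega> z))"
  shows "finite {x. \<omega> x \<le> C}"
proof (rule ccontr)
  assume "infinite {x. \<omega> x \<le> C}"
  then obtain x :: "nat \<Rightarrow> 'a" where x: "inj x" "range x \<subseteq> {x. \<omega> x \<le> C}"
    using infinite_countable_subset by blast
  have xC: "\<omega> (x n) \<le> C" for n using x(2) by auto
  have C: "1 \<le> C" using weight_ge_1[OF W, of "x 0"] xC[of 0] by linarith
  \<comment> \<open>A lower bound for \<open>Omega\<close> on the level set, since \<omega>(xy) is
    at least 1.\<close>
  define c where "c = 1 / (C * C)"
  have c: "0 < c" using C by (simp add: c_def)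
  have Om: "c \<le> Omega \<omega> (x n, x m)" "Omega \<omega> (x n, x m) \<le> 1" for m n
  proof -
    have pos: "0 < \<omega> (x n) * \<omega> (x m)" using weight_pos[OF W] by simp
    have "\<omega> (x n) * \<omega> (x m) \<le> C * C"
      using xC C weight_nonneg[OF W] by (intro mult_mono) auto
    then have "c \<le> 1 / (\<omega> (x n) * \<omega> (x m))" using pos unfolding c_def by (intro divide_left_mono) auto
    also have "\<dots> \<le> Omega \<omega> (x n, x m)"
      unfolding Omega_def using pos weight_ge_1[OF W] by (auto intro!: divide_right_mono)
    finally show "c \<le> Omega \<omega> (x n, x m)" .
    show "Omega \<omega> (x n, x m) \<le> 1"
      using weight_mult[OF W, of "x n" "x m"] pos by (simp add: Omega_def)
  qed
  let ?I = "{c..1} \<times> {c..1}"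
  \<comment> \<open>Each point records a row and a column of the array at once, so that one
    subsequence \<open>r\<close> gives the inner limits in both orders.\<close>
  define V where "V m = (\<lambda>n. (Omega \<omega> (x n, x m), Omega \<omega> (x m, x n)))" for m
  have "compactin (product_topology (\<lambda>n :: nat. euclidean) UNIV) (PiE UNIV (\<lambda>n. ?I))"
    by (subst compactin_PiE) (auto intro: compact_Times)
  then have "compact (PiE (UNIV :: nat set) (\<lambda>n. ?I))" by (simp add: euclidean_product_topology)
  then have "seq_compact (PiE (UNIV :: nat set) (\<lambda>n. ?I))" by (rule compact_imp_seq_compact)
  moreover have "\<forall>m. V m \<in> PiE UNIV (\<lambda>n. ?I)" using Om by (auto simp: V_def)
  ultimately obtain l r where l: "l \<in> PiE UNIV (\<lambda>n. ?I)" and r: "strict_mono (r :: nat \<Rightarrow> nat)" "(V \<circ> r) \<longlonglongrightarrow> l"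
    by (rule seq_compactE)
  have "(\<lambda>m. (V \<circ> r) m n) \<longlonglongrightarrow> l n" for n
    by (rule continuous_on_tendsto_compose[OF continuous_on_product_coordinates r(2)]) auto
  then have Vn: "(\<lambda>m. V (r m) n) \<longlonglongrightarrow> l n" for n by simp
  \<comment> \<open>A second subsequence \<open>q\<close> makes the inner limits converge as well;
    it does not disturb the inner limits already obtained.\<close>
  have "seq_compact ?I" by (intro compact_imp_seq_compact compact_Times) auto
  moreover have "\<forall>n. l (r n) \<in> ?I" using l by auto
  ultimately obtain p q where p: "p \<in> ?I" and q: "strict_mono (q :: nat \<Rightarrow> nat)" "((\<lambda>n. l (r n)) \<circ> q) \<longlonglongrightarrow> p"
    by (rule seq_compactE)
  define X where "X n = x (r (q n))" for n
  have "inj X"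
    unfolding X_def inj_def
    using injD[OF x(1)] injD[OF strict_mono_imp_inj_on[OF r(1)]] injD[OF strict_mono_imp_inj_on[OF q(1)]] by blast
  have lim: "(\<lambda>m. V (r (q m)) n) \<longlonglongrightarrow> l n" for n
    using LIMSEQ_subseq_LIMSEQ[OF Vn q(1)] by (simp add: o_def)
  have 1: "(\<lambda>m. Omega \<omega> (X n, X m)) \<longlonglongrightarrow> fst (l (r (q n)))" for n
    using tendsto_fst[OF lim[of "r (q n)"]] by (simp add: V_def X_def)
  have 2: "(\<lambda>n. Omega \<omega> (X n, X m)) \<longlonglongrightarrow> snd (l (r (q m)))" for m
    using tendsto_snd[OF lim[of "r (q m)"]] by (simp add: V_def X_def)
  have 3: "(\<lambda>n. fst (l (r (q n)))) \<longlonglongrightarrow> fst p" "(\<lambda>n. snd (l (r (q n)))) \<longlonglongrightarrow> snd p"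
    using tendsto_fst[OF q(2)] tendsto_snd[OF q(2)] by (simp_all add: o_def)
  have "complex_of_real (fst p) = 0"
    using zc[unfolded zero_cluster_def, rule_format, OF \<open>inj X\<close> \<open>inj X\<close>
        tendsto_of_real[OF 1] tendsto_of_real[OF 3(1)] tendsto_of_real[OF 2] tendsto_of_real[OF 3(2)]] by blast
  then show False using p c by auto
qed

text \<open>The weight is \<open>1 + l\<close> for the word length \<open>l\<close> in which the \<open>n\<close>-th element of an enumeration of the
  group costs \<open>n + 1\<close>; only finitely many words have a given cost.\<close>

lemma subadditive_weight_exists:
  assumes count: "countable (UNIV :: 'a::{topological_group_add, t2_space} set)"
    and disc: "(euclidean :: 'a::{topological_group_add, t2_space} topology) = discrete_topology UNIV"
  obtains \<omega> :: "'a::{topological_group_add, t2_space} \<Rightarrow> real" where "weight \<omega>" "\<And>C. finite {x. \<omega> x \<le> C}"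
    "\<And>x y. \<omega> (x + y) \<le> \<omega> x + \<omega> y"
proof -
  \<comment> \<open>The successor makes every letter cost at least 1, so the cost of a word also
    bounds its length.\<close>
  define c where "c x = Suc (to_nat_on UNIV x)" for x :: 'a
  have injc: "inj c" using inj_on_to_nat_on[OF count] by (auto simp: c_def inj_on_def)
  define cost where "cost xs = sum_list (map c xs)" for xs
  define l where "l x = (LEAST n. \<exists>xs. sum_list xs = x \<and> cost xs = n)" for x :: 'a
  have ex: "\<exists>n xs. sum_list xs = x \<and> cost xs = n" for x
    by (intro exI[of _ "cost [x]"] exI[of _ "[x]"]) simp
  have l_ex: "\<exists>xs. sum_list xs = x \<and> cost xs = l x" for x
    unfolding l_def by (rule LeastI_ex[OF ex])
  have l_le: "l x \<le> cost xs" if "sum_list xs = x" for x xs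
    unfolding l_def using that by (intro Least_le) auto
  have l0: "l 0 = 0" using l_le[of "[]" 0] by (simp add: cost_def)
  have ladd: "l (x + y) \<le> l x + l y" for x y
  proof -
    obtain xs ys where "sum_list xs = x" "cost xs = l x" "sum_list ys = y" "cost ys = l y"
      using l_ex by metis
    then show ?thesis using l_le[of "xs @ ys" "x + y"] by (simp add: cost_def)
  qed
  have len: "length xs \<le> cost xs" for xs by (induction xs) (auto simp: cost_def c_def)
  have mem: "c x \<le> cost xs" if "x \<in> set xs" for x xs
    using that by (induction xs) (auto simp: cost_def)
  have finl: "finite {x. l x \<le> n}" for n
  proof -
    have "finite {x. c x \<le> n}"
      using finite_vimageI[OF finite_atMost[of n] injc] by (simp add: vimage_def)
    then have "finite {xs. set xs \<subseteq> {x. c x \<le> n} \<and> length xs \<le> n}"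
      by (rule finite_lists_length_le)
    then have "finite (sum_list ` {xs. set xs \<subseteq> {x. c x \<le> n} \<and> length xs \<le> n})" by (rule finite_imageI)
    moreover have "{x. l x \<le> n} \<subseteq> sum_list ` {xs. set xs \<subseteq> {x. c x \<le> n} \<and> length xs \<le> n}"
    proof
      fix x assume "x \<in> {x. l x \<le> n}"
      moreover obtain xs where "sum_list xs = x" "cost xs = l x" using l_ex by blast
      ultimately show "x \<in> sum_list ` {xs. set xs \<subseteq> {x. c x \<le> n} \<and> length xs \<le> n}"
        using len[of xs] mem[of _ xs] by (intro image_eqI[of _ _ xs]) force+
    qed
    ultimately show ?thesis by (rule rev_finite_subset)
  qed
  define \<omega> where "\<omega> x = 1 + real (l x)" for x
  have "open S" for S :: "'a set"
    using disc by (metis open_openin openin_discrete_topology subset_UNIV)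
  then have "continuous_on UNIV \<omega>" by (auto simp: continuous_on_open_vimage)
  moreover have sub: "\<omega> (x + y) \<le> 1 + real (l x) + real (l y)" for x y
    using ladd[of x y] by (simp add: \<omega>_def)
  \<comment> \<open>The summand 1 turns subadditivity into submultiplicativity: 1 + s + t is at most
    (1 + s)(1 + t) for nonnegative s and t.\<close>
  moreover have "1 + real (l x) + real (l y) \<le> \<omega> x * \<omega> y" for x y
    by (simp add: \<omega>_def algebra_simps)
  ultimately have "\<forall>x y. \<omega> (x + y) \<le> \<omega> x * \<omega> y" "continuous_on UNIV \<omega>" by (blast intro: order_trans)+
  then have "weight \<omega>"
    unfolding weight_def by (simp add: \<omega>_def l0)
  moreover have "finite {x. \<omega> x \<le> C}" for C
    by (rule rev_finite_subset[OF finl[of "nat \<lceil>C\<rceil>"]]) (auto simp: \<omega>_def, linarith)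
  moreover have "\<omega> (x + y) \<le> \<omega> x + \<omega> y" for x y using sub[of x y] by (simp add: \<omega>_def)
  ultimately show ?thesis using that by blast
qed

text \<open>Along an injective sequence \<omega> tends to infinity, so each inner limit is at most
  the reciprocal weight of the fixed argument, which tends to 0 in turn.\<close>

lemma zero_cluster_of_subadditive:
  fixes \<omega> :: "'a::{topological_group_add, t2_space} \<Rightarrow> real"
  assumes W: "weight \<omega>" and fin: "\<And>C. finite {x. \<omega> x \<le> C}" and sub: "\<And>x y. \<omega> (x + y) \<le> \<omega> x + \<omega> y"
  shows "zero_cluster (\<lambda>z. complex_of_real (Omega \<omega> z))"
proof -
  note pos = weight_pos[OF W]
  have lim0: "(\<lambda>n. 1 / \<omega> (x n)) \<longlonglongrightarrow> 0" if "inj x" for x :: "nat \<Rightarrow> 'a"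
  proof -
    have "filterlim (\<lambda>n. \<omega> (x n)) at_top sequentially"
      unfolding filterlim_at_top
    proof
      fix C
      have "finite {n. \<omega> (x n) \<le> C}"
        using finite_vimageI[OF fin[of C] that] by (simp add: vimage_def)
      then have "\<forall>\<^sub>F n in cofinite. \<not> \<omega> (x n) \<le> C" by (simp add: eventually_cofinite)
      then show "\<forall>\<^sub>F n in sequentially. C \<le> \<omega> (x n)"
        unfolding cofinite_eq_sequentially by eventually_elim simp
    qed
    then show ?thesis
      using tendsto_inverse_0_at_top by (simp add: inverse_eq_divide[symmetric])
  qed
  have bd: "cmod (complex_of_real (Omega \<omega> (x, y))) \<le> 1 / \<omega> x + 1 / \<omega> y" for x y
  proof -
    have "Omega \<omega> (x, y) \<le> (\<omega> x + \<omega> y) / (\<omega> x * \<omega> y)"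
      unfolding Omega_def using sub pos by (auto intro!: divide_right_mono simp: less_imp_le)
    also have "\<dots> = 1 / \<omega> x + 1 / \<omega> y" using pos[of x] pos[of y] by (simp add: field_simps)
    moreover have "0 \<le> Omega \<omega> (x, y)" using pos by (simp add: Omega_def less_imp_le)
    ultimately show ?thesis by (simp only: norm_of_real abs_of_nonneg)
  qed
  show ?thesis
    unfolding zero_cluster_def
  proof (intro allI impI)
    fix x y :: "nat \<Rightarrow> 'a" and r s l k
    assume x: "inj x" and y: "inj y"
      and r: "\<forall>n. (\<lambda>m. complex_of_real (Omega \<omega> (x n, y m))) \<longlonglongrightarrow> r n" and l: "r \<longlonglongrightarrow> l"
      and s: "\<forall>m. (\<lambda>n. complex_of_real (Omega \<omega> (x n, y m))) \<longlonglongrightarrow> s m" and k: "s \<longlonglongrightarrow> k"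
    have "cmod (r n) \<le> 1 / \<omega> (x n)" for n
    proof (rule LIMSEQ_le[OF tendsto_norm[OF r[rule_format]]])
      show "(\<lambda>m. 1 / \<omega> (x n) + 1 / \<omega> (y m)) \<longlonglongrightarrow> 1 / \<omega> (x n)"
        using tendsto_add[OF tendsto_const lim0[OF y]] by simp
    qed (use bd in blast)
    then have "r \<longlonglongrightarrow> 0" by (intro Lim_null_comparison[OF _ lim0[OF x]]) simp
    have "cmod (s m) \<le> 1 / \<omega> (y m)" for m
    proof (rule LIMSEQ_le[OF tendsto_norm[OF s[rule_format]]])
      show "(\<lambda>n. 1 / \<omega> (x n) + 1 / \<omega> (y m)) \<longlonglongrightarrow> 1 / \<omega> (y m)"
        using tendsto_add[OF lim0[OF x] tendsto_const] by simp
    qed (use bd in blast)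
    then have "s \<longlonglongrightarrow> 0" by (intro Lim_null_comparison[OF _ lim0[OF y]]) simp
    then show "l = 0 \<and> k = 0" using \<open>r \<longlonglongrightarrow> 0\<close> l k LIMSEQ_unique by blast
  qed
qed

text \<open>Above the level 2/e, each of \<omega>(x) and \<omega>(y) is at most half of
  e\<omega>(x)\<omega>(y).\<close>

lemma small_products_of_subadditive:
  fixes \<omega> :: "'a::{topological_group_add, t2_space} \<Rightarrow> real"
  assumes W: "weight \<omega>" and fin: "\<And>C. finite {x. \<omega> x \<le> C}" and sub: "\<And>x y. \<omega> (x + y) \<le> \<omega> x + \<omega> y"
    and e: "0 < e"
  shows "\<exists>F. finite F \<and> (\<forall>x y. x \<notin> F \<longrightarrow> y \<notin> F \<longrightarrow> \<omega> (x + y) \<le> e * (\<omega> x * \<omega> y))"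
proof (intro exI[of _ "{x. \<omega> x \<le> 2 / e}"] conjI allI impI fin)
  fix x y assume "x \<notin> {x. \<omega> x \<le> 2 / e}" "y \<notin> {x. \<omega> x \<le> 2 / e}"
  then have "2 / e \<le> \<omega> x" "2 / e \<le> \<omega> y" by auto
  then have "1 \<le> e / 2 * \<omega> x" "1 \<le> e / 2 * \<omega> y" using e by (auto simp: field_simps)
  then have "1 * \<omega> y \<le> (e / 2 * \<omega> x) * \<omega> y" "1 * \<omega> x \<le> (e / 2 * \<omega> y) * \<omega> x"
    using weight_nonneg[OF W] by (intro mult_right_mono; simp)+
  then show "\<omega> (x + y) \<le> e * (\<omega> x * \<omega> y)" using sub[of x y] by (simp add: mult_ac)
qed

section \<open>The equivalence\<close>

theorem theorem3p1:
  assumes "locally_compact_space (euclidean :: 'a::{topological_group_add, t2_space} topology)"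
  shows "(weight_regular TYPE('a) \<longleftrightarrow>
            countable (UNIV :: 'a set) \<and> (euclidean :: 'a topology) = discrete_topology UNIV) \<and>
         (countable (UNIV :: 'a set) \<and> (euclidean :: 'a topology) = discrete_topology UNIV \<longleftrightarrow>
            finite (UNIV :: 'a set) \<or>
            (\<exists>\<omega> :: 'a \<Rightarrow> real. weight \<omega> \<and> zero_cluster (\<lambda>z. complex_of_real (Omega \<omega> z))))"
    (is "(?a \<longleftrightarrow> ?b) \<and> (?b \<longleftrightarrow> ?c)")
proof -
  have ab: ?b if a: ?a
  proof -
    obtain \<omega> :: "'a \<Rightarrow> real" where W: "weight \<omega>"
      and reg: "arens_regular (Mstar_dual \<omega>) (Mstar_dual_norm \<omega>) (Mstar_dual_prod \<omega>)"
      using a unfolding weight_regular_def by blast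
    interpret weighted_group \<omega> by unfold_locales (rule W assms)+
    have "finite {x. \<omega> x \<le> C}" for C
      using not_regular_of_infinite_level reg by blast
    then show ?b using discrete_of_finite_levels[OF W] by blast
  qed
  \<comment> \<open>One weight witnesses both (a) and (c).\<close>
  have weights: "\<exists>\<omega> :: 'a \<Rightarrow> real. weight \<omega> \<and> zero_cluster (\<lambda>z. complex_of_real (Omega \<omega> z)) \<and>
      arens_regular (Mstar_dual \<omega>) (Mstar_dual_norm \<omega>) (Mstar_dual_prod \<omega>)" if b: ?b
  proof -
    obtain \<omega> :: "'a \<Rightarrow> real" where \<omega>: "weight \<omega>" "\<And>C. finite {x. \<omega> x \<le> C}"
      "\<And>x y. \<omega> (x + y) \<le> \<omega> x + \<omega> y"
      using subadditive_weight_exists b by blast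
    interpret weighted_group \<omega> by unfold_locales (rule \<omega> assms)+
    show ?thesis
      using \<omega>(1) zero_cluster_of_subadditive[OF \<omega>]
        regular_of_small_products[OF small_products_of_subadditive[OF \<omega>]] by blast
  qed
  have cb: ?b if ?c
    using that
  proof
    assume fin: "finite (UNIV :: 'a set)"
    \<comment> \<open>On a finite group the constant weight has finite level sets, so the
      discreteness lemma covers this case too.\<close>
    have "weight (\<lambda>_ :: 'a. 1 :: real)" by (simp add: weight_def)
    moreover have "finite {x :: 'a. (1 :: real) \<le> C}" for C
      using fin by (rule rev_finite_subset) simp
    ultimately show ?b using discrete_of_finite_levels by blast
  next
    assume "\<exists>\<omega> :: 'a \<Rightarrow> real. weight \<omega> \<and> zero_cluster (\<lambda>z. complex_of_real (Omega \<omega> z))"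
    then show ?b
      using discrete_of_finite_levels finite_levels_of_zero_cluster by blast
  qed
  have ba: ?a if b: ?b
    using weights[OF b] unfolding weight_regular_def by blast
  have bc: ?c if b: ?b
    using weights[OF b] by blast
  show ?thesis
    using iffI[OF ab ba] iffI[OF bc cb] by (rule conjI)
qed

end
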